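(* Let $d\ge1$, $0<q<2$, $K(z)=-|z|^q$ on $\mathbb R^d$. Assume one of the following: (i) $d+q-2>0$ and $p_c<p\le\infty$, where $p_c:=d/(d+q-2)$; (ii) $d=q=1$ and $p=\infty$; (iii) $d=1$, $0<q<1$, and $1/q<p\le\infty$. Let $\mu\in\mathcal P_{\max\{1,q\}}(\mathbb R^d)\cap L^p(\mathbb R^d)$ be a probability density. For every $N\ge2$, let $X_N^0\in\mathcal D_N$, let $X_N^t=(x_i^t)_{i\in[N]}$ be any corresponding global collision-free $C^1$ solution of $$\dot x_i^t=-\frac1N\sum_{j\in[N]\setminus\{i\}}\nabla K(x_i^t-x_j^t)+\nabla K*\mu(x_i^t),\qquad i\in[N],$$ and choose $$Y_N=(y_i^N)_{i\in[N]}\in\omega(X_N):=\bigcap_{T\ge0}\overline{\{X_N^t:t\ge T\}}.$$ Suppose that $$\sup_{N\ge2}\mathcal E_N(Y_N)<\infty,$$ and, when $0<q<1$, suppose in addition that $$\sup_{N\ge2}\frac1{N^2}\sum_{\substack{i,j\in[N]\\ i\ne j}}\frac1{|y_i^N-y_j^N|^{1-q}}<\infty.$$ Then there are a subsequence $N_k\to\infty$, times $t_k\to\infty$, and a Lagrangian critical point $\bar\rho$ of the MMD energy with target $\mu$ such that $$\rho_{t_k}^{N_k}\rightharpoonup\bar\rho\qquad\text{narrowly},$$ where $\rho_t^N:=\frac1N\sum_{i=1}^N\delta_{x_i^t}$ is the empirical measure of $X_N^t$. The bound $\sup_{N\ge2}\mathcal E_N(Y_N)<\infty$ is automatic if $\sup_{N\ge2}\mathcal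 E_N(X_N^0)<\infty$ or if $\mu$ is compactly supported.
   Context: $[N]=\{1,\dots,N\}$; $\mathcal D_N:=\{(x_i)_{i\in[N]}\in(\mathbb R^d)^N:x_i\ne x_j\text{ for all distinct }i,j\}$; a collision-free solution takes values in $\mathcal D_N$ for all times. $\mathcal P_s(\mathbb R^d)$: Borel probability measures with finite $s$-th moment; densities are identified with measures. $\nabla K*\mu(x)=\int\nabla K(x-y)\,\mathrm d\mu(y)$. The particle energy of $X_N=(x_i)_{i\in[N]}$, with $\rho^N:=\frac1N\sum_i\delta_{x_i}$, is $\mathcal E_N(X_N):=\frac12\iint K(x-y)\,\mathrm d(\rho^N-\mu)(x)\,\mathrm d(\rho^N-\mu)(y)$. The MMD energy with target $\mu$ is $E_\mu(\rho)=\mathrm{MMD}_q^2(\rho,\mu)=\frac12\iint(|x|^q+|y|^q-|x-y|^q)\,\mathrm d(\rho-\mu)(x)\,\mathrm d(\rho-\mu)(y)$. Under the stated hypotheses, global collision-free solutions exist from every $X_N^0\in\mathcal D_N$ and their $\omega$-limit sets are nonempty subsets of $\mathcal D_N$. Lagrangian critical point. Use the convention $\nabla K(z)=-q|z|^{q-2}z$ for $z\ne0$ and $\nabla K(0):=0$. At every point $x$ where the integral is absolutely convergent, set $g_\rho(x):=\int\nabla K(x-y)\,\mathrm d(\rho-\mu)(y)$, and set $g_\rho(x):=0$ elsewhere. One requires that the integral converges absolutely for $\rho$-a.e. $x$ and that $g_\rho\in L^1_{\mathrm{loc}}(\rho)$. Then $\rho$ is a Lagrangian critical point of $E_\mu$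 if $g_\rho=0$ $\rho$-a.e. *)

theory Defs
  imports "HOL-Probability.Probability"
begin

text \<open>
  A configuration of \<open>N\<close> particles is an extensional function on \<open>{1..N}\<close>, so that
  \<open>{1..N} \<rightarrow>\<^sub>E UNIV\<close> with the product topology is the \<open>N\<close>-fold power of the space.
\<close>

definition collision_free :: "nat \<Rightarrow> (nat \<Rightarrow> 'a) set" where
  "collision_free N =
    {x \<in> {1..N} \<rightarrow>\<^sub>E UNIV. \<forall>i\<in>{1..N}. \<forall>j\<in>{1..N}. i \<noteq> j \<longrightarrow> x i \<noteq> x j}"

definition omega_limit :: "nat \<Rightarrow> (real \<Rightarrow> nat \<Rightarrow> 'a::topological_space) \<Rightarrow> (nat \<Rightarrow> 'a) set" where
  "omega_limit N X =
    (\<Inter>T\<in>{0..}. (product_topology (\<lambda>_. euclidean) {1..N}) closure_of (X ` {T..}))"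

definition borel_prob :: "'a::topological_space measure set" where
  "borel_prob = {\<mu>. prob_space \<mu> \<and> sets \<mu> = sets borel}"

definition prob_moment :: "real \<Rightarrow> 'a::euclidean_space measure set" where
  "prob_moment s = {\<mu> \<in> borel_prob. integrable \<mu> (\<lambda>x. norm x powr s)}"

definition in_Lp :: "ereal \<Rightarrow> ('a::euclidean_space \<Rightarrow> real) \<Rightarrow> bool" where
  "in_Lp p f \<longleftrightarrow> f \<in> borel_measurable borel \<and>
    (if p = \<infinity> then \<exists>C. AE x in lborel. \<bar>f x\<bar> \<le> C
     else integrable lborel (\<lambda>x. \<bar>f x\<bar> powr real_of_ereal p))"

definition Lp_density_measures :: "ereal \<Rightarrow> 'a::euclidean_space measure set" where
  "Lp_density_measures p =
    {\<mu>. \<exists>f. in_Lp p f \<and> (\<forall>x. 0 \<le> f x) \<and> \<mu> = density lborel (\<lambda>x. ennreal (f x))}"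

definition ker :: "real \<Rightarrow> 'a::euclidean_space \<Rightarrow> real" where
  "ker q z = - (norm z powr q)"

definition grad_ker :: "real \<Rightarrow> 'a::euclidean_space \<Rightarrow> 'a" where
  "grad_ker q z = (if z = 0 then 0 else - (q * norm z powr (q - 2)) *\<^sub>R z)"

definition particle_velocity ::
  "real \<Rightarrow> 'a::euclidean_space measure \<Rightarrow> nat \<Rightarrow> (nat \<Rightarrow> 'a) \<Rightarrow> nat \<Rightarrow> 'a" where
  "particle_velocity q \<mu> N x i =
    - (1 / real N) *\<^sub>R (\<Sum>j\<in>{1..N} - {i}. grad_ker q (x i - x j))
    + (\<integral>y. grad_ker q (x i - y) \<partial>\<mu>)"

text \<open>
  \<open>C\<^sup>1\<close> on \<open>[0, \<infinity>)\<close>, one-sided at \<open>0\<close>: the derivative, which is the velocity along the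
  trajectory, is continuous.
\<close>

definition global_solution ::
  "real \<Rightarrow> 'a::euclidean_space measure \<Rightarrow> nat \<Rightarrow> (nat \<Rightarrow> 'a) \<Rightarrow> (real \<Rightarrow> nat \<Rightarrow> 'a) \<Rightarrow> bool" where
  "global_solution q \<mu> N X0 X \<longleftrightarrow>
    X 0 = X0 \<and>
    (\<forall>t\<ge>0. X t \<in> collision_free N) \<and>
    (\<forall>i\<in>{1..N}.
      (\<forall>t\<ge>0. ((\<lambda>s. X s i) has_vector_derivative particle_velocity q \<mu> N (X t) i)
                 (at t within {0..})) \<and>
      continuous_on {0..} (\<lambda>t. particle_velocity q \<mu> N (X t) i))"

definition empirical :: "nat \<Rightarrow> (nat \<Rightarrow> 'a::euclidean_space) \<Rightarrow> 'a measure" where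
  "empirical N x = distr (uniform_count_measure {1..N}) borel x"

text \<open>
  Integration against the signed measure \<open>\<rho> - \<mu>\<close>; meaningful when the integrand is integrable
  with respect to both measures.
\<close>

definition integral_diff ::
  "'a measure \<Rightarrow> 'a measure \<Rightarrow> ('a \<Rightarrow> 'b::{banach, second_countable_topology}) \<Rightarrow> 'b" where
  "integral_diff \<rho> \<mu> h = (\<integral>x. h x \<partial>\<rho>) - (\<integral>x. h x \<partial>\<mu>)"

definition particle_energy ::
  "real \<Rightarrow> 'a::euclidean_space measure \<Rightarrow> nat \<Rightarrow> (nat \<Rightarrow> 'a) \<Rightarrow> real" where
  "particle_energy q \<mu> N x =
    1 / 2 * integral_diff (empirical N x) \<mu>
              (\<lambda>u. integral_diff (empirical N x) \<mu> (\<lambda>v. ker q (u - v)))"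

text \<open>
  Valued in \<open>ennreal\<close>, where \<open>1 / 0 = \<infinity>\<close>, so that a collision makes the sum infinite.
\<close>

definition singular_interaction ::
  "real \<Rightarrow> nat \<Rightarrow> (nat \<Rightarrow> 'a::euclidean_space) \<Rightarrow> ennreal" where
  "singular_interaction q N y =
    1 / of_nat (N ^ 2) *
    (\<Sum>(i, j) \<in> {(i, j) \<in> {1..N} \<times> {1..N}. i \<noteq> j}.
       1 / ennreal (norm (y i - y j) powr (1 - q)))"

definition narrowly_converges ::
  "(nat \<Rightarrow> 'a::euclidean_space measure) \<Rightarrow> 'a measure \<Rightarrow> bool" where
  "narrowly_converges \<rho> \<rho>' \<longleftrightarrow>
    (\<forall>\<phi>::'a \<Rightarrow> real. continuous_on UNIV \<phi> \<longrightarrow> bounded (range \<phi>) \<longrightarrow>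
       (\<lambda>k. \<integral>x. \<phi> x \<partial>\<rho> k) \<longlonglongrightarrow> (\<integral>x. \<phi> x \<partial>\<rho>'))"

text \<open>
  Absolute convergence against \<open>\<rho> - \<mu>\<close> is integrability with respect to both \<open>\<rho>\<close> and \<open>\<mu>\<close>.
  If the integrand is \<open>\<mu>\<close>-integrable this is the same as integrability with respect to the
  total variation of \<open>\<rho> - \<mu>\<close>, because \<open>\<bar>\<rho> - \<mu>\<bar> \<le> \<rho> + \<mu>\<close> and \<open>\<rho> \<le> \<bar>\<rho> - \<mu>\<bar> + \<mu>\<close>.
\<close>

definition force_converges ::
  "real \<Rightarrow> 'a::euclidean_space measure \<Rightarrow> 'a measure \<Rightarrow> 'a \<Rightarrow> bool" where
  "force_converges q \<mu> \<rho> x \<longleftrightarrow>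
    integrable \<rho> (\<lambda>y. grad_ker q (x - y)) \<and> integrable \<mu> (\<lambda>y. grad_ker q (x - y))"

text \<open>
  The convolution of \<open>\<nabla>K\<close> with \<open>\<rho> - \<mu>\<close>, the formal Wasserstein gradient of the MMD energy
  \<open>1/2 \<integral>\<integral> (|x|\<^sup>q + |y|\<^sup>q - |x - y|\<^sup>q) d(\<rho> - \<mu>)(x) d(\<rho> - \<mu>)(y)\<close>, set to \<open>0\<close> where the integral
  does not converge absolutely.
\<close>

definition mmd_force ::
  "real \<Rightarrow> 'a::euclidean_space measure \<Rightarrow> 'a measure \<Rightarrow> 'a \<Rightarrow> 'a" where
  "mmd_force q \<mu> \<rho> x =
    (if force_converges q \<mu> \<rho> x then integral_diff \<rho> \<mu> (\<lambda>y. grad_ker q (x - y)) else 0)"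

definition lagrangian_critical ::
  "real \<Rightarrow> 'a::euclidean_space measure \<Rightarrow> 'a measure \<Rightarrow> bool" where
  "lagrangian_critical q \<mu> \<rho> \<longleftrightarrow>
    \<rho> \<in> borel_prob \<and>
    (AE x in \<rho>. force_converges q \<mu> \<rho> x) \<and>
    (\<forall>C. compact C \<longrightarrow> set_integrable \<rho> C (mmd_force q \<mu> \<rho>)) \<and>
    (AE x in \<rho>. mmd_force q \<mu> \<rho> x = 0)"

end

theory Submission
  imports Defs
begin

text \<open>
  The system is the gradient flow of the particle energy, which decreases along solutions and is
  nonnegative because \<open>\<bar>x - y\<bar>\<^sup>q\<close> is conditionally negative definite for \<open>0 < q < 2\<close>
  (\<open>energy_distance_nonneg\<close>). Since the total dissipation is finite, a solution that comes close to an
  omega-limit point stays there for arbitrarily long windows of time (\<open>omega_limit_trapping\<close>). Such a point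
  has no collisions, because a nearby cluster would be torn apart by its own repulsion within a
  bounded time (\<open>omega_limit_collision_free\<close>), and it is then a stationary point of the system
  (\<open>omega_limit_stationary\<close>). So \<open>Y\<^sub>N\<close> satisfies, for every particle, the balance
  \<open>1/N \<Sum>\<^sub>j \<nabla>K (y\<^sub>i - y\<^sub>j) = \<nabla>K * \<mu> (y\<^sub>i)\<close>, where \<open>\<nabla>K 0 = 0\<close>.

  It remains to let \<open>N\<close> tend to infinity in this balance. Boundedness of the energies bounds the tails of
  the empirical measures by a multiple of \<open>R powr (- q / 2)\<close> (\<open>empirical_tail_bound\<close>), by testing the conditionally negative definite form
  with a second difference at scale \<open>R\<close>. Hence a subsequence converges narrowly, and even almost surely
  after passing to suitable random variables (\<open>empirical_skorohod\<close>). The balance is multiplied by a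
  Lipschitz function \<open>\<psi>\<close> and symmetrized; the function \<open>(\<psi> x - \<psi> y) \<nabla>K (x - y)\<close> obtained in this way is continuous
  on the diagonal and uniformly integrable: it is bounded if \<open>q \<le> 1\<close>, and if \<open>q > 1\<close> it grows of order
  \<open>q - 1 < q / 2\<close>, which the tails permit. So the symmetrized balance holds for the limit \<open>\<rho>\<close>.
  The symmetrization is undone using integrability of \<open>\<bar>x - y\<bar> powr (q - 1)\<close> off the
  diagonal under \<open>\<rho> \<otimes> \<rho>\<close>, which follows by Fatou's lemma from the moments if \<open>q > 1\<close> and from the
  bound on the singular interaction if \<open>q < 1\<close> (\<open>lagrangian_critical_of_weak\<close>).

  Concerning the bound on the energies: it passes from the initial data to the omega-limit point by
  monotonicity and continuity of the energy. For compactly supported \<open>\<mu>\<close> it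
  follows from a virial identity for stationary configurations (\<open>stationary_energy_bounded\<close>).
\<close>


section \<open>The power kernel and its gradient\<close>

lemma powr_midpoint_convex:
  fixes a b p :: real
  assumes "1 \<le> p" "0 \<le> a" "0 \<le> b"
  shows "((a + b) / 2) powr p \<le> (a powr p + b powr p) / 2"
proof -
  have half: "(c / 2) powr p \<le> c powr p / 2" if "0 \<le> c" for c :: real
  proof -
    have "(1 / 2) powr p \<le> (1 / 2 :: real) powr 1"
      using assms(1) by (intro powr_mono') auto
    hence "c powr p * (1 / 2) powr p \<le> c powr p * (1 / 2)"
      by (intro mult_left_mono) auto
    thus ?thesis
      using that by (simp add: powr_divide)
  qed
  show ?thesis
  proof (cases "a = 0 \<or> b = 0")
    case True
    thus ?thesis using half[OF assms(2)] half[OF assms(3)] by auto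
  next
    case False
    hence "a \<in> {0<..}" "b \<in> {0<..}" using assms by auto
    from convex_onD[OF powr_convex[OF assms(1)] _ _ this, of "1/2"]
    show ?thesis by (simp add: field_simps)
  qed
qed

lemma powr_midpoint_concave:
  fixes a b s :: real
  assumes "0 < s" "s \<le> 1" "0 \<le> a" "0 \<le> b"
  shows "(a powr s + b powr s) / 2 \<le> ((a + b) / 2) powr s"
proof -
  have "((a powr s + b powr s) / 2) powr (1 / s) \<le> ((a powr s) powr (1/s) + (b powr s) powr (1/s)) / 2"
    using assms by (intro powr_midpoint_convex) auto
  also have "\<dots> = (a + b) / 2"
    using assms by (simp add: powr_powr)
  finally have "(((a powr s + b powr s) / 2) powr (1 / s)) powr s \<le> ((a + b) / 2) powr s"
    using assms by (intro powr_mono2) auto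
  thus ?thesis using assms by (simp add: powr_powr)
qed

lemma powr_subadditive:
  fixes a b s :: real
  assumes "0 \<le> s" "s \<le> 1" "0 \<le> a" "0 \<le> b"
  shows "(a + b) powr s \<le> a powr s + b powr s"
proof (cases "a = 0 \<or> b = 0")
  case True
  thus ?thesis by auto
next
  case False
  hence pos: "a > 0" "b > 0" using assms by auto
  have le: "(a + b) powr (s - 1) \<le> c powr (s - 1)" if "c \<in> {a, b}" for c
    using assms that pos by (intro powr_mono2') auto
  have "(a + b) powr s = a * (a + b) powr (s - 1) + b * (a + b) powr (s - 1)"
    using powr_mult_base[of "a + b" "s - 1"] pos by (simp add: distrib_right)
  also have "\<dots> \<le> a * a powr (s - 1) + b * b powr (s - 1)"
    using le pos by (intro add_mono mult_left_mono) auto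
  also have "\<dots> = a powr s + b powr s"
    using powr_mult_base[of a "s - 1"] powr_mult_base[of b "s - 1"] pos by simp
  finally show ?thesis .
qed

lemma powr_sum_subadditive:
  fixes f :: "'b \<Rightarrow> real"
  assumes "0 \<le> s" "s \<le> 1" "finite A" "\<And>i. i \<in> A \<Longrightarrow> 0 \<le> f i"
  shows "(\<Sum>i\<in>A. f i) powr s \<le> (\<Sum>i\<in>A. f i powr s)"
  using assms(3,4)
proof (induction A rule: finite_induct)
  case (insert i A)
  have "(\<Sum>i\<in>insert i A. f i) powr s \<le> f i powr s + (\<Sum>i\<in>A. f i) powr s"
    using insert assms by (simp add: powr_subadditive sum_nonneg)
  with insert show ?case by force
qed simp

lemma powr_add_le_4:
  fixes a b s :: real
  assumes "0 \<le> s" "s \<le> 2" "0 \<le> a" "0 \<le> b"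
  shows "(a + b) powr s \<le> 4 * (a powr s + b powr s)"
proof -
  have "(a + b) powr s \<le> (2 * max a b) powr s"
    using assms by (intro powr_mono2) auto
  also have "\<dots> = 2 powr s * max a b powr s"
    by (rule powr_mult)
  also have "\<dots> \<le> 2 powr 2 * (a powr s + b powr s)"
    using assms by (intro mult_mono powr_mono) (auto simp: max_def)
  finally show ?thesis by simp
qed

lemma norm_diff_powr_le:
  fixes x v :: "'a::real_normed_vector"
  assumes "0 \<le> s" "s \<le> 2"
  shows "norm (x - v) powr s \<le> 4 * (norm x powr s + norm v powr s)"
proof -
  have "norm (x - v) powr s \<le> (norm x + norm v) powr s"
    using assms by (intro powr_mono2 norm_triangle_ineq4) auto
  also have "\<dots> \<le> 4 * (norm x powr s + norm v powr s)"
    using assms by (intro powr_add_le_4) auto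
  finally show ?thesis .
qed

text \<open>
  By the mean value theorem; the slope is largest at the larger end point if \<open>q \<ge> 1\<close> and at the
  smaller one if \<open>q < 1\<close>. A vanishing end point contributes \<open>0 powr (q - 1) = 0\<close>, which is enough.
\<close>
lemma powr_diff_le:
  fixes a b q :: real
  assumes q: "0 < q" "q < 2" and "0 \<le> a" "0 \<le> b"
  shows "\<bar>a powr q - b powr q\<bar> \<le> 2 * \<bar>a - b\<bar> * (a powr (q - 1) + b powr (q - 1))"
proof -
  have *: "\<bar>a powr q - b powr q\<bar> \<le> 2 * \<bar>a - b\<bar> * (a powr (q - 1) + b powr (q - 1))"
    if ab: "0 \<le> b" "b < a" for a b :: real
  proof (cases "b = 0")
    case True
    have "a powr q = a * a powr (q - 1)" using ab by (simp add: powr_diff)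
    thus ?thesis using True ab by simp
  next
    case False
    hence b: "b > 0" using ab by auto
    have "\<exists>z>b. z < a \<and> a powr q - b powr q = (a - b) * (q * z powr (q - 1))"
      using b ab by (intro MVT2) (auto intro!: derivative_eq_intros)
    then obtain z where z: "b < z" "z < a" "a powr q - b powr q = (a - b) * (q * z powr (q - 1))"
      by auto
    have "z powr (q - 1) \<le> a powr (q - 1) + b powr (q - 1)"
    proof (cases "q \<ge> 1")
      case True
      hence "z powr (q - 1) \<le> a powr (q - 1)" using z b by (intro powr_mono2) auto
      thus ?thesis by (simp add: add_increasing2)
    next
      case False
      hence "z powr (q - 1) \<le> b powr (q - 1)" using z b by (intro powr_mono2') auto
      thus ?thesis by (simp add: add_increasing)
    qed
    hence "q * z powr (q - 1) \<le> 2 * (a powr (q - 1) + b powr (q - 1))"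
      using q by (intro mult_mono) auto
    hence "(a - b) * (q * z powr (q - 1)) \<le> (a - b) * (2 * (a powr (q - 1) + b powr (q - 1)))"
      using ab by (intro mult_left_mono) auto
    moreover have "0 \<le> (a - b) * (q * z powr (q - 1))" using ab q by auto
    ultimately show ?thesis using z(3) ab by (simp add: algebra_simps)
  qed
  consider "a = b" | "b < a" | "a < b" by linarith
  thus ?thesis
  proof cases
    case 3
    with *[of a b] assms show ?thesis by (simp add: abs_minus_commute add.commute)
  qed (use * assms in auto)
qed

lemma grad_ker_alt: "grad_ker q z = - (q * norm z powr (q - 2)) *\<^sub>R z"
  by (simp add: grad_ker_def)

lemma grad_ker_0 [simp]: "grad_ker q 0 = 0"
  by (simp add: grad_ker_def)

lemma grad_ker_minus: "grad_ker q (- z) = - grad_ker q z"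
  by (simp add: grad_ker_alt)

lemma grad_ker_commute: "grad_ker q (x - y) = - grad_ker q (y - x)"
  by (metis grad_ker_minus minus_diff_eq)

lemma norm_grad_ker:
  assumes "0 < q"
  shows "norm (grad_ker q z) = q * norm z powr (q - 1)"
proof (cases "z = 0")
  case False
  hence "norm z powr (q - 2) * norm z = norm z powr (q - 1)"
    using powr_mult_base[of "norm z" "q - 2"] by (simp add: mult.commute)
  thus ?thesis using assms by (simp add: grad_ker_alt)
qed simp

lemma grad_ker_inner:
  shows "grad_ker q z \<bullet> z = - q * norm z powr q"
proof (cases "z = 0")
  case False
  hence "norm z powr (q - 2) * (z \<bullet> z) = norm z powr q"
    by (simp add: dot_square_norm powr_diff powr_numeral)
  thus ?thesis by (simp add: grad_ker_alt mult.assoc)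
qed simp

lemma grad_ker_measurable [measurable]: "grad_ker q \<in> borel_measurable borel"
  unfolding grad_ker_alt by measurable

lemma isCont_grad_ker:
  assumes "z \<noteq> 0"
  shows "isCont (grad_ker q) z"
proof -
  have "isCont (\<lambda>z. - (q * norm z powr (q - 2)) *\<^sub>R z) z"
    using assms by (intro continuous_intros) auto
  thus ?thesis by (simp add: grad_ker_alt[abs_def])
qed

lemma has_derivative_norm_powr:
  assumes "z \<noteq> 0"
  shows "((\<lambda>z. norm z powr q) has_derivative (\<lambda>h. - (grad_ker q z \<bullet> h))) (at z)"
proof -
  have "norm z powr q * (h \<bullet> sgn z * q / norm z) = - (grad_ker q z \<bullet> h)" for h
    using assms by (simp add: grad_ker_alt sgn_div_norm powr_diff power2_eq_square powr_numeral
        inner_commute divide_simps)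
  thus ?thesis
    using assms
    by (auto intro!: derivative_eq_intros has_derivative_norm)
qed

text \<open>
  In the size of its argument, the gradient is nondecreasing while its quotient by the argument is
  nonincreasing; so the larger of the two arguments determines the Lipschitz constant. The bound
  gives Hoelder continuity of order \<open>q - 1\<close> everywhere and Lipschitz continuity away from the origin.
\<close>
lemma grad_ker_diff_le:
  assumes q: "1 \<le> q" "q < 2"
  shows "norm (grad_ker q a - grad_ker q b)
           \<le> 2 * q * max (norm a) (norm b) powr (q - 2) * norm (a - b)"
proof -
  have *: "norm (grad_ker q a - grad_ker q b) \<le> 2 * q * norm a powr (q - 2) * norm (a - b)"
    if le: "norm b \<le> norm a" for a b :: 'a
  proof (cases "b = 0")
    case True
    have "q * norm a powr (q - 1) = q * norm a powr (q - 2) * norm a"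
      using powr_mult_base[of "norm a" "q - 2"] by (simp add: mult.commute)
    also have "\<dots> \<le> 2 * (q * norm a powr (q - 2) * norm a)"
      using q by simp
    finally show ?thesis using True q by (simp add: norm_grad_ker)
  next
    case False
    hence pos: "0 < norm b" "0 < norm a" using le by auto
    define A where "A = norm a powr (q - 2)"
    define B where "B = norm b powr (q - 2)"
    have "A \<le> B" unfolding A_def B_def using le q pos by (intro powr_mono2') auto
    have "B * norm b \<le> A * norm a"
    proof -
      have "norm b powr (q - 1) \<le> norm a powr (q - 1)"
        using le q by (intro powr_mono2) auto
      thus ?thesis
        unfolding A_def B_def
        using powr_mult_base[of "norm a" "q - 2"] powr_mult_base[of "norm b" "q - 2"]
        by (simp add: mult.commute)
    qed
    have "grad_ker q a - grad_ker q b = - q *\<^sub>R (A *\<^sub>R (a - b) - (B - A) *\<^sub>R b)"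
      by (simp add: grad_ker_alt A_def B_def algebra_simps)
    hence "norm (grad_ker q a - grad_ker q b) = q * norm (A *\<^sub>R (a - b) - (B - A) *\<^sub>R b)"
      using q by simp
    also have "norm (A *\<^sub>R (a - b) - (B - A) *\<^sub>R b) \<le> A * norm (a - b) + (B - A) * norm b"
      using \<open>A \<le> B\<close> by (intro order_trans[OF norm_triangle_ineq4]) (simp add: A_def)
    also have "(B - A) * norm b \<le> A * (norm a - norm b)"
      using \<open>B * norm b \<le> A * norm a\<close> by (simp add: algebra_simps)
    also have "A * (norm a - norm b) \<le> A * norm (a - b)"
      by (intro mult_left_mono norm_triangle_ineq2) (simp add: A_def)
    finally show ?thesis using q by (simp add: A_def mult_ac)
  qed
  show ?thesis
  proof (cases "norm b \<le> norm a")
    case True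
    thus ?thesis using *[OF True] by (simp add: max_def)
  next
    case False
    thus ?thesis using *[of a b] by (simp add: max_def norm_minus_commute)
  qed
qed

lemma grad_ker_holder:
  assumes q: "1 \<le> q" "q < 2"
  shows "norm (grad_ker q a - grad_ker q b) \<le> 8 * norm (a - b) powr (q - 1)"
proof (cases "a = b")
  case False
  have h: "0 < norm (a - b)" using False by simp
  have "norm (a - b) \<le> norm a + norm b" by (rule norm_triangle_ineq4)
  hence "norm (a - b) / 2 \<le> max (norm a) (norm b)" by linarith
  hence "max (norm a) (norm b) powr (q - 2) \<le> (norm (a - b) / 2) powr (q - 2)"
    using h q by (intro powr_mono2') auto
  also have "\<dots> = norm (a - b) powr (q - 2) * 2 powr (2 - q)"
    using powr_minus_divide[of 2 "q - 2"] by (simp add: powr_divide)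
  finally have "2 * q * max (norm a) (norm b) powr (q - 2) * norm (a - b)
      \<le> 2 * q * (norm (a - b) powr (q - 2) * 2 powr (2 - q)) * norm (a - b)"
    using q by (intro mult_right_mono mult_left_mono) auto
  also have "\<dots> = 2 * (q * 2 powr (2 - q)) * norm (a - b) powr (q - 1)"
    using powr_mult_base[of "norm (a - b)" "q - 2"] by (simp add: mult_ac)
  also have "\<dots> \<le> 2 * (2 * 2 powr 1) * norm (a - b) powr (q - 1)"
  proof -
    have "q * 2 powr (2 - q) \<le> 2 * 2 powr 1" using q by (intro mult_mono powr_mono) auto
    thus ?thesis by (intro mult_right_mono mult_left_mono) auto
  qed
  finally have "2 * q * max (norm a) (norm b) powr (q - 2) * norm (a - b)
      \<le> 2 * (2 * 2 powr 1) * norm (a - b) powr (q - 1)" .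
  from order_trans[OF grad_ker_diff_le[OF q] this] show ?thesis by simp
qed simp

text \<open>
  The integral of \<open>\<bar>u - y\<bar>\<^sup>q\<close> against the neutral measure with mass \<open>1 / 2\<close> at \<open>e\<close> and at \<open>- e\<close> and mass \<open>- 1\<close> at
  the origin. It is largest at the origin and decays at infinity, and serves to detect mass that is far away.
\<close>
definition second_diff :: "real \<Rightarrow> 'a::real_inner \<Rightarrow> 'a \<Rightarrow> real" where
  "second_diff q e u = (norm (u + e) powr q + norm (u - e) powr q) / 2 - norm u powr q"

text \<open>
  By concavity of \<open>t powr (q / 2)\<close> and the parallelogram law.
\<close>
lemma second_diff_upper:
  assumes q: "0 < q" "q < 2" and e: "norm e = 1"
  shows "second_diff q e u \<le> (1 + (norm u)\<^sup>2) powr (q / 2) - norm u powr q"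
proof -
  have sq: "norm v powr q = ((norm v)\<^sup>2) powr (q / 2)" for v :: 'a
    by (cases "v = 0") (simp_all add: powr_powr flip: powr_numeral)
  have "(norm (u + e) powr q + norm (u - e) powr q) / 2
      \<le> (((norm (u + e))\<^sup>2 + (norm (u - e))\<^sup>2) / 2) powr (q / 2)"
    unfolding sq using q by (intro powr_midpoint_concave) auto
  also have "((norm (u + e))\<^sup>2 + (norm (u - e))\<^sup>2) / 2 = 1 + (norm u)\<^sup>2"
  proof -
    have "(norm (u + e))\<^sup>2 + (norm (u - e))\<^sup>2 = 2 * (norm u)\<^sup>2 + 2 * (norm e)\<^sup>2"
      by (simp add: power2_norm_eq_inner inner_add inner_diff inner_commute)
    thus ?thesis using e by simp
  qed
  finally show ?thesis by (simp add: second_diff_def)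
qed

lemma second_diff_le_1:
  assumes q: "0 < q" "q < 2" and e: "norm e = 1"
  shows "second_diff q e u \<le> 1"
proof -
  have "(1 + (norm u)\<^sup>2) powr (q / 2) \<le> 1 powr (q/2) + ((norm u)\<^sup>2) powr (q / 2)"
    using q by (intro powr_subadditive) auto
  also have "((norm u)\<^sup>2) powr (q / 2) = norm u powr q"
    by (cases "u = 0") (simp_all add: powr_powr flip: powr_numeral)
  finally show ?thesis using second_diff_upper[OF assms, of u] by simp
qed

lemma second_diff_decay:
  assumes q: "0 < q" "q < 2" and e: "norm e = 1" and u: "u \<noteq> 0"
  shows "second_diff q e u \<le> norm u powr (q - 2)"
proof -
  define t where "t = (norm u)\<^sup>2"
  have t: "t > 0" using u by (simp add: t_def)
  have "\<exists>z>t. z < 1 + t \<and> (1 + t) powr (q/2) - t powr (q/2) = (1 + t - t) * (q/2 * z powr (q/2 - 1))"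
    using t by (intro MVT2) (auto intro!: derivative_eq_intros)
  then obtain z where z: "z > t" "(1 + t) powr (q/2) - t powr (q/2) = q/2 * z powr (q/2 - 1)" by auto
  have "z powr (q/2 - 1) \<le> t powr (q/2 - 1)" using z t q by (intro powr_mono2') auto
  moreover have "q/2 * z powr (q/2 - 1) \<le> 1 * z powr (q/2 - 1)" using q by (intro mult_right_mono) auto
  moreover have "t powr (q/2) = norm u powr q"  "t powr (q/2 - 1) = norm u powr (q - 2)"
    using u by (simp_all add: t_def powr_powr algebra_simps flip: powr_numeral)
  ultimately show ?thesis
    using second_diff_upper[OF q e, of u] z(2) by (simp add: t_def)
qed

text \<open>
  By subadditivity of the power if \<open>q \<le> 1\<close> and by its convexity if \<open>q > 1\<close>.
\<close>
lemma second_diff_lower: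
  assumes q: "0 < q" "q < 2" and e: "norm e = 1"
  shows "1 - 2 * norm u powr q \<le> second_diff q e u"
proof (cases "q \<le> 1")
  case True
  have *: "1 \<le> norm (u + f) powr q + norm u powr q" if "norm f = 1" for f
  proof -
    have "1 \<le> norm (u + f) + norm u"
      using norm_triangle_ineq4[of "u + f" u] that by simp
    hence "1 powr q \<le> (norm (u + f) + norm u) powr q" using q by (intro powr_mono2) auto
    also have "\<dots> \<le> norm (u + f) powr q + norm u powr q"
      using True q by (intro powr_subadditive) auto
    finally show ?thesis by simp
  qed
  have "1 \<le> norm (u - e) powr q + norm u powr q" using *[of "- e"] e by simp
  thus ?thesis using *[OF e] by (simp add: second_diff_def field_simps)
next
  case False
  have "norm (u + e) + norm (u - e) \<ge> 2"
    using norm_triangle_ineq4[of "u + e" "u - e"] e by (simp add: scaleR_2[symmetric])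
  hence "1 powr q \<le> ((norm (u + e) + norm (u - e)) / 2) powr q"
    using q by (intro powr_mono2) auto
  also have "\<dots> \<le> (norm (u + e) powr q + norm (u - e) powr q) / 2"
    using False by (intro powr_midpoint_convex) auto
  finally have "2 \<le> norm (u + e) powr q + norm (u - e) powr q" by simp
  moreover have "0 \<le> norm u powr q" by simp
  ultimately show ?thesis by (simp add: second_diff_def field_simps del: powr_ge_zero)
qed


section \<open>Conditional negative definiteness of \<open>\<bar>x - y\<bar>\<^sup>q\<close>\<close>

text \<open>
  One factor \<open>x \<bullet> y\<close> splits into products of coordinates, which are absorbed by the weights; this is why
  the induction is over all weights.
\<close>
lemma inner_power_psd:
  fixes x :: "'i \<Rightarrow> 'a::euclidean_space" and w :: "'i \<Rightarrow> real"
  shows "0 \<le> (\<Sum>i\<in>I. \<Sum>j\<in>I. w i * w j * (x i \<bullet> x j) ^ k)"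
proof (induction k arbitrary: w)
  case 0
  have "(\<Sum>i\<in>I. \<Sum>j\<in>I. w i * w j) = (\<Sum>i\<in>I. w i)\<^sup>2"
    by (simp add: power2_eq_square sum_product)
  thus ?case by simp
next
  case (Suc k)
  have "(\<Sum>i\<in>I. \<Sum>j\<in>I. w i * w j * (x i \<bullet> x j) ^ Suc k)
      = (\<Sum>i\<in>I. \<Sum>j\<in>I. \<Sum>b\<in>Basis. (w i * (x i \<bullet> b)) * (w j * (x j \<bullet> b)) * (x i \<bullet> x j) ^ k)"
  proof (intro sum.cong refl)
    fix i j
    have "w i * w j * (x i \<bullet> x j) ^ Suc k = (w i * w j * (x i \<bullet> x j) ^ k) * (\<Sum>b\<in>Basis. (x i \<bullet> b) * (x j \<bullet> b))"
      by (subst euclidean_inner[symmetric]) simp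
    thus "w i * w j * (x i \<bullet> x j) ^ Suc k
        = (\<Sum>b\<in>Basis. (w i * (x i \<bullet> b)) * (w j * (x j \<bullet> b)) * (x i \<bullet> x j) ^ k)"
      by (simp add: sum_distrib_left mult_ac)
  qed
  also have "\<dots> = (\<Sum>i\<in>I. \<Sum>b\<in>Basis. \<Sum>j\<in>I. (w i * (x i \<bullet> b)) * (w j * (x j \<bullet> b)) * (x i \<bullet> x j) ^ k)"
    by (intro sum.cong refl sum.swap)
  also have "\<dots> = (\<Sum>b\<in>Basis. \<Sum>i\<in>I. \<Sum>j\<in>I. (w i * (x i \<bullet> b)) * (w j * (x j \<bullet> b)) * (x i \<bullet> x j) ^ k)"
    by (rule sum.swap)
  also have "\<dots> \<ge> 0"
    by (intro sum_nonneg Suc.IH)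
  finally show ?case .
qed

lemma exp_inner_psd:
  fixes x :: "'i \<Rightarrow> 'a::euclidean_space" and w :: "'i \<Rightarrow> real"
  assumes "0 \<le> s"
  shows "0 \<le> (\<Sum>i\<in>I. \<Sum>j\<in>I. w i * w j * exp (s * (x i \<bullet> x j)))"
proof -
  have lim: "(\<lambda>k. (\<Sum>i\<in>I. \<Sum>j\<in>I. w i * w j * ((s * (x i \<bullet> x j)) ^ k /\<^sub>R fact k)))
     sums (\<Sum>i\<in>I. \<Sum>j\<in>I. w i * w j * exp (s * (x i \<bullet> x j)))"
    by (intro sums_sum sums_mult exp_converges)
  have "0 \<le> (\<Sum>i\<in>I. \<Sum>j\<in>I. w i * w j * ((s * (x i \<bullet> x j)) ^ k /\<^sub>R fact k))" for k
  proof -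
    have "(\<Sum>i\<in>I. \<Sum>j\<in>I. w i * w j * ((s * (x i \<bullet> x j)) ^ k /\<^sub>R fact k))
        = s ^ k / fact k * (\<Sum>i\<in>I. \<Sum>j\<in>I. w i * w j * (x i \<bullet> x j) ^ k)"
      by (simp add: sum_distrib_left power_mult_distrib divide_inverse mult_ac)
    also have "\<dots> \<ge> 0"
      using assms inner_power_psd[of w x k I] by (intro mult_nonneg_nonneg) auto
    finally show ?thesis .
  qed
  thus ?thesis
    by (rule sums_le[OF _ sums_zero lim])
qed

text \<open>
  Up to factors that depend on one point only, the Gaussian is the exponential of the inner
  product, a power series with nonnegative coefficients in positive semidefinite kernels.
\<close>
lemma gaussian_psd:
  fixes x :: "'i \<Rightarrow> 'a::euclidean_space" and c :: "'i \<Rightarrow> real"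
  assumes "0 \<le> s"
  shows "0 \<le> (\<Sum>i\<in>I. \<Sum>j\<in>I. c i * c j * exp (- s * (norm (x i - x j))\<^sup>2))"
proof -
  define w where "w i = c i * exp (- s * (norm (x i))\<^sup>2)" for i
  have "c i * c j * exp (- s * (norm (x i - x j))\<^sup>2) = w i * w j * exp (2 * s * (x i \<bullet> x j))" for i j
  proof -
    have "- s * (norm (x i - x j))\<^sup>2 = - s * (norm (x i))\<^sup>2 + - s * (norm (x j))\<^sup>2 + 2 * s * (x i \<bullet> x j)"
      by (simp add: power2_norm_eq_inner inner_diff inner_commute algebra_simps)
    hence "exp (- s * (norm (x i - x j))\<^sup>2)
        = exp (- s * (norm (x i))\<^sup>2) * exp (- s * (norm (x j))\<^sup>2) * exp (2 * s * (x i \<bullet> x j))"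
      by (simp only: exp_add)
    thus ?thesis by (simp add: w_def mult_ac)
  qed
  thus ?thesis using exp_inner_psd[of "2 * s" w x I] assms by simp
qed

text \<open>
  The substitution \<open>s \<mapsto> r\<^sup>2 s\<close> shows that the integral is homogeneous of degree \<open>q\<close> in \<open>r\<close>; this
  writes \<open>r\<^sup>q\<close> as a superposition of the functions \<open>1 - exp (- s r\<^sup>2)\<close>.
\<close>
lemma powr_subordination:
  fixes q :: real
  assumes q: "0 < q" "q < 2"
  defines "g \<equiv> \<lambda>r s. indicator {0<..} s * ((1 - exp (- s * r\<^sup>2)) * s powr (- 1 - q / 2)) :: real"
  obtains K where "K > 0" "\<And>r. 0 \<le> r \<Longrightarrow> integrable lborel (g r)"
    "\<And>r. 0 \<le> r \<Longrightarrow> (\<integral>s. g r s \<partial>lborel) = K * r powr q"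
proof -
  define f where "f = g 1"
  \<comment> \<open>An integrable majorant of the case \<open>r = 1\<close>, to which the others reduce by scaling.\<close>
  define h where "h s = (if 1 \<le> s then s powr (- 1 - q / 2) else if 0 < s then s powr (- (q / 2)) else 0)" for s :: real
  have h_meas: "h \<in> borel_measurable borel" unfolding h_def by measurable
  have "(\<integral>\<^sup>+s. ennreal (h s) \<partial>lborel) < \<infinity>"
  proof -
    have 1: "(\<integral>\<^sup>+s. ennreal (s powr (- 1 - q / 2)) * indicator {1..} s \<partial>lborel) = ennreal (0 - (- (2 / q) * 1 powr (- (q / 2))))"
    proof (rule nn_integral_FTC_atLeast)
      show "((\<lambda>s. - (2 / q) * s powr (- (q / 2))) \<longlongrightarrow> 0) at_top"
        using q by (intro tendsto_mult_right_zero tendsto_neg_powr filterlim_ident) auto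
    next
      have eq: "- (q / 2) - 1 = - 1 - q / 2" by simp
      show "((\<lambda>s. - (2 / q) * s powr (- (q / 2))) has_real_derivative s powr (- 1 - q / 2)) (at s)"
        if "1 \<le> s" for s
        using q that by (auto intro!: derivative_eq_intros simp only: eq) simp
    qed auto
    have 2: "(\<integral>\<^sup>+s. ennreal (s powr (- (q / 2))) * indicator {0..1} s \<partial>lborel) < \<infinity>"
    proof -
      have "((\<lambda>s. s powr (- (q / 2))) has_integral (1 powr (- (q / 2) + 1) / (- (q / 2) + 1))) {0..1}"
        using q by (intro has_integral_powr_from_0) auto
      hence "(\<integral>\<^sup>+s. ennreal (indicator {0..1} s * s powr (- (q / 2))) \<partial>lborel) = ennreal (1 powr (- (q / 2) + 1) / (- (q / 2) + 1))"
        by (intro nn_integral_has_integral_lebesgue) auto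
      moreover have "ennreal (indicator {0..1} s * s powr (- (q / 2))) = ennreal (s powr (- (q / 2))) * indicator {0..1} s" for s :: real
        by (simp add: indicator_def)
      ultimately show ?thesis by simp
    qed
    have "(\<integral>\<^sup>+s. ennreal (h s) \<partial>lborel)
       \<le> (\<integral>\<^sup>+s. ennreal (s powr (- 1 - q / 2)) * indicator {1..} s + ennreal (s powr (- (q / 2))) * indicator {0..1} s \<partial>lborel)"
      by (intro nn_integral_mono) (auto simp: h_def indicator_def)
    also have "\<dots> < \<infinity>" using 1 2 by (subst nn_integral_add) auto
    finally show ?thesis .
  qed
  hence h_int: "integrable lborel h"
    using h_meas by (auto simp: integrable_iff_bounded h_def cong: if_cong)
  have f_int: "integrable lborel f"
  proof (rule Bochner_Integration.integrable_bound[OF h_int])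
    show "f \<in> borel_measurable lborel" unfolding f_def g_def by measurable
    show "AE s in lborel. norm (f s) \<le> norm (h s)"
    proof (rule AE_I2)
      fix s :: real
      show "norm (f s) \<le> norm (h s)"
      proof (cases "0 < s")
        case True
        have e: "0 \<le> 1 - exp (- s)" "1 - exp (- s) \<le> 1" "1 - exp (- s) \<le> s"
          using True exp_ge_add_one_self[of "- s"] by (auto)
        have "s * s powr (- 1 - q / 2) = s powr (- (q / 2))"
          using powr_mult_base[of s "- 1 - q / 2"] True by simp
        moreover have "(1 - exp (- s)) * s powr (- 1 - q / 2) \<le> s * s powr (- 1 - q / 2)"
          "(1 - exp (- s)) * s powr (- 1 - q / 2) \<le> 1 * s powr (- 1 - q / 2)"
          using e by (intro mult_right_mono; simp)+
        ultimately show ?thesis using True e by (simp add: f_def g_def h_def abs_mult)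
      qed (simp add: f_def g_def)
    qed
  qed
  define K where "K = (\<integral>s. f s \<partial>lborel)"
  have "K > 0"
  proof -
    define m where "m = (1 - exp (- 1)) * 2 powr (- 1 - q / 2)"
    have "m > 0" by (simp add: m_def)
    have "m = (\<integral>s. indicator {1..2::real} s * m \<partial>lborel)" by simp
    also have "\<dots> \<le> K" unfolding K_def
    proof (intro integral_mono f_int)
      fix s :: real
      have "0 \<le> f s" unfolding f_def g_def by (auto simp: indicator_def)
      moreover have "m \<le> f s" if "s \<in> {1..2}"
      proof -
        have "2 powr (- 1 - q / 2) \<le> s powr (- 1 - q / 2)"
          using that q by (intro powr_mono2') auto
        hence "m \<le> (1 - exp (- s)) * s powr (- 1 - q / 2)"
          unfolding m_def using that by (intro mult_mono) auto
        thus ?thesis using that by (simp add: f_def g_def)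
      qed
      ultimately show "indicator {1..2} s * m \<le> f s" by (auto simp: indicator_def)
    qed simp
    finally show ?thesis using \<open>m > 0\<close> by simp
  qed
  have scale: "integrable lborel (g r) \<and> (\<integral>s. g r s \<partial>lborel) = K * r powr q" if "0 \<le> r" for r
  proof (cases "r = 0")
    case True
    thus ?thesis by (simp add: g_def)
  next
    case False
    hence r: "r > 0" using that by simp
    have g_eq: "g r = (\<lambda>s. r powr (2 + q) * f (0 + r\<^sup>2 * s))"
    proof
      fix s :: real
      show "g r s = r powr (2 + q) * f (0 + r\<^sup>2 * s)"
      proof (cases "0 < s")
        case True
        have "(r\<^sup>2 * s) powr (- 1 - q / 2) = r powr (- (2 + q)) * s powr (- 1 - q / 2)"
        proof -
          have "(r\<^sup>2) powr (- 1 - q / 2) = r powr (2 * (- 1 - q / 2))"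
            using powr_powr[of r 2 "- 1 - q / 2"] r by simp
          also have "2 * (- 1 - q / 2) = - (2 + q)" by simp
          finally show ?thesis by (simp add: powr_mult)
        qed
        moreover have "r powr (2 + q) * r powr (- (2 + q)) = 1"
          using r by (simp flip: powr_add)
        ultimately show ?thesis
          using r True by (simp add: g_def f_def mult_ac)
      qed (use r in \<open>auto simp: g_def f_def zero_less_mult_iff\<close>)
    qed
    have i: "integrable lborel (\<lambda>s. f (0 + r\<^sup>2 * s))"
      using f_int r by (intro lborel_integrable_real_affine) auto
    have "K = r\<^sup>2 * (\<integral>s. f (0 + r\<^sup>2 * s) \<partial>lborel)"
      unfolding K_def using r by (subst lborel_integral_real_affine[of "r\<^sup>2" f 0]) auto
    hence "r powr (2 + q) * (\<integral>s. f (0 + r\<^sup>2 * s) \<partial>lborel) = K * r powr q"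
      using r by (simp add: powr_add field_simps)
    thus ?thesis unfolding g_eq using i by simp
  qed
  show ?thesis using that[of K] \<open>K > 0\<close> scale by blast
qed

text \<open>
  By subordination to the kernels \<open>1 - exp (- s \<bar>x - y\<bar>\<^sup>2)\<close>; as the weights sum to zero, the
  constant \<open>1\<close> drops out and only the Gaussian with its negative sign is left.
\<close>
lemma norm_powr_cond_neg_def:
  fixes x :: "'i \<Rightarrow> 'a::euclidean_space" and c :: "'i \<Rightarrow> real"
  assumes q: "0 < q" "q < 2" and c: "(\<Sum>i\<in>I. c i) = 0"
  shows "(\<Sum>i\<in>I. \<Sum>j\<in>I. c i * c j * norm (x i - x j) powr q) \<le> 0"
proof -
  define g where "g r s = indicator {0<..} s * ((1 - exp (- s * r\<^sup>2)) * s powr (- 1 - q / 2))" for r s :: real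
  obtain K where K: "K > 0" "\<And>r. 0 \<le> r \<Longrightarrow> integrable lborel (g r)"
    "\<And>r. 0 \<le> r \<Longrightarrow> (\<integral>s. g r s \<partial>lborel) = K * r powr q"
    using powr_subordination[OF q] unfolding g_def by blast
  have "K * (\<Sum>i\<in>I. \<Sum>j\<in>I. c i * c j * norm (x i - x j) powr q)
      = (\<Sum>i\<in>I. \<Sum>j\<in>I. c i * c j * (\<integral>s. g (norm (x i - x j)) s \<partial>lborel))"
    using K(3) by (simp add: sum_distrib_left mult_ac)
  also have "\<dots> = (\<integral>s. (\<Sum>i\<in>I. \<Sum>j\<in>I. c i * c j * g (norm (x i - x j)) s) \<partial>lborel)"
    using K(2) by simp
  also have "\<dots> \<le> 0"
  proof -
    have "(\<Sum>i\<in>I. \<Sum>j\<in>I. c i * c j * g (norm (x i - x j)) s) \<le> 0" for s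
    proof (cases "0 < s")
      case True
      have cc: "(\<Sum>i\<in>I. \<Sum>j\<in>I. c i * c j) = 0"
        using c by (simp flip: sum_product)
      have "(\<Sum>i\<in>I. \<Sum>j\<in>I. c i * c j * g (norm (x i - x j)) s)
        = s powr (- 1 - q / 2) * ((\<Sum>i\<in>I. \<Sum>j\<in>I. c i * c j) - (\<Sum>i\<in>I. \<Sum>j\<in>I. c i * c j * exp (- s * (norm (x i - x j))\<^sup>2)))"
        using True
        by (simp add: g_def sum_distrib_left right_diff_distrib left_diff_distrib sum_distrib_right sum_subtractf mult_ac)
      also have "\<dots> \<le> 0"
        using gaussian_psd[of s c x I] True by (simp add: cc mult_nonneg_nonneg)
      finally show ?thesis .
    qed (simp add: g_def)
    hence "0 \<le> (\<integral>s. - (\<Sum>i\<in>I. \<Sum>j\<in>I. c i * c j * g (norm (x i - x j)) s) \<partial>lborel)"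
      by (intro integral_nonneg_AE AE_I2) simp
    thus ?thesis by simp
  qed
  finally show ?thesis using K(1) by (simp add: mult_le_0_iff)
qed


lemma tendsto_norm_powr:
  fixes f :: "'b \<Rightarrow> 'a::real_normed_vector"
  assumes "(f \<longlongrightarrow> l) F" "0 < q"
  shows "((\<lambda>x. norm (f x) powr q) \<longlongrightarrow> norm l powr q) F"
  using assms by (intro tendsto_powr' tendsto_norm tendsto_const) auto

text \<open>
  The inequality passes from point masses to \<open>\<mu>\<close> because \<open>\<mu>\<close> is the law of a limit of
  simple functions.
\<close>
lemma energy_distance_nonneg:
  fixes \<mu> :: "'a::euclidean_space measure" and y :: "'i \<Rightarrow> 'a"
  assumes q: "0 < q" "q < 2"
    and \<mu>: "prob_space \<mu>" "sets \<mu> = sets borel" and moment: "integrable \<mu> (\<lambda>v. norm v powr q)"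
    and I: "finite I" and c: "(\<Sum>i\<in>I. c i) = 1"
  shows "(\<Sum>i\<in>I. \<Sum>j\<in>I. c i * c j * norm (y i - y j) powr q)
           + (\<integral>u. \<integral>v. norm (u - v) powr q \<partial>\<mu> \<partial>\<mu>)
         \<le> 2 * (\<Sum>i\<in>I. c i * (\<integral>v. norm (y i - v) powr q \<partial>\<mu>))"
proof -
  interpret prob_space \<mu> by fact
  note [measurable_cong] = \<mu>(2)
  have [simp]: "space \<mu> = UNIV" using sets_eq_imp_space_eq[OF \<mu>(2)] by simp
  have [simp]: "prob UNIV = 1" using prob_space by simp
  have id_meas: "(\<lambda>x. x) \<in> borel_measurable \<mu>" by measurable
  obtain T where T: "\<And>n. simple_function \<mu> (T n)" "\<And>x. (\<lambda>n. T n x) \<longlonglongrightarrow> x"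
      "\<And>n x. norm (T n x) \<le> 2 * norm x"
    using borel_measurable_implies_sequence_metric[OF id_meas, of 0] by (force simp: dist_norm)
  have T_meas [measurable]: "T n \<in> borel_measurable \<mu>" for n
    using T(1) by (rule borel_measurable_simple_function)
  define A where "A = (\<Sum>i\<in>I. \<Sum>j\<in>I. c i * c j * norm (y i - y j) powr q)"
  have discrete: "A + (\<integral>u. \<integral>v. norm (T n u - T n v) powr q \<partial>\<mu> \<partial>\<mu>)
      \<le> 2 * (\<Sum>i\<in>I. c i * (\<integral>v. norm (y i - T n v) powr q \<partial>\<mu>))" for n
  proof -
    define V where "V = range (T n)"
    define p where "p v = prob (T n -` {v})" for v
    have V: "finite V" using simple_functionD(1)[OF T(1)] by (simp add: V_def)
    have ev: "T n -` {v} \<in> sets \<mu>" for v using simple_functionD(2)[OF T(1), of n "{v}"] by simp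
    have avg: "(\<integral>x. h (T n x) \<partial>\<mu>) = (\<Sum>v\<in>V. p v * h v)" for h :: "'a \<Rightarrow> real"
    proof -
      have "h (T n x) = (\<Sum>v\<in>V. indicator (T n -` {v}) x * h v)" for x
      proof -
        have "(\<Sum>v\<in>V. indicator (T n -` {v}) x * h v) = (\<Sum>v\<in>V. if v = T n x then h v else 0)"
          by (intro sum.cong) (auto simp: indicator_def)
        also have "\<dots> = h (T n x)" using V by (simp add: V_def)
        finally show ?thesis by simp
      qed
      hence "(\<integral>x. h (T n x) \<partial>\<mu>) = (\<integral>x. (\<Sum>v\<in>V. indicator (T n -` {v}) x * h v) \<partial>\<mu>)" by simp
      also have "\<dots> = (\<Sum>v\<in>V. (\<integral>x. indicator (T n -` {v}) x * h v \<partial>\<mu>))"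
        using ev by (intro Bochner_Integration.integral_sum) (auto simp: emeasure_eq_measure)
      also have "\<dots> = (\<Sum>v\<in>V. p v * h v)" using ev by (simp add: p_def)
      finally show ?thesis .
    qed
    \<comment> \<open>The given points together with the values of the simple function, weighted by \<open>c\<close> and by minus its law.\<close>
    define c' where "c' = case_sum c (\<lambda>v. - p v)"
    define y' where "y' = case_sum y (\<lambda>v. v)"
    have "(\<Sum>v\<in>V. p v) = 1" using avg[of "\<lambda>_. 1"] by simp
    hence "(\<Sum>k\<in>I <+> V. c' k) = 0"
      using I V c by (simp add: sum.Plus c'_def sum_negf)
    from norm_powr_cond_neg_def[OF q this, of y']
    have "A - 2 * (\<Sum>i\<in>I. \<Sum>v\<in>V. c i * p v * norm (y i - v) powr q)
        + (\<Sum>u\<in>V. \<Sum>v\<in>V. p u * p v * norm (u - v) powr q) \<le> 0"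
    proof -
      have "(\<Sum>u\<in>V. \<Sum>i\<in>I. p u * c i * norm (u - y i) powr q) = (\<Sum>i\<in>I. \<Sum>v\<in>V. c i * p v * norm (y i - v) powr q)"
        by (subst sum.swap) (simp add: norm_minus_commute mult_ac)
      moreover have "(\<Sum>k\<in>I <+> V. \<Sum>l\<in>I <+> V. c' k * c' l * norm (y' k - y' l) powr q)
        = A - (\<Sum>i\<in>I. \<Sum>v\<in>V. c i * p v * norm (y i - v) powr q)
          - (\<Sum>u\<in>V. \<Sum>i\<in>I. p u * c i * norm (u - y i) powr q)
          + (\<Sum>u\<in>V. \<Sum>v\<in>V. p u * p v * norm (u - v) powr q)"
        using I V by (simp add: sum.Plus c'_def y'_def A_def sum.distrib sum_negf sum_subtractf)
      ultimately show ?thesis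
        using norm_powr_cond_neg_def[OF q \<open>(\<Sum>k\<in>I <+> V. c' k) = 0\<close>, of y'] by simp
    qed
    moreover have "(\<integral>u. \<integral>v. norm (T n u - T n v) powr q \<partial>\<mu> \<partial>\<mu>) = (\<Sum>u\<in>V. \<Sum>v\<in>V. p u * p v * norm (u - v) powr q)"
      by (simp add: avg[of "\<lambda>v. norm (z - v) powr q" for z]
          avg[of "\<lambda>u. \<Sum>v\<in>V. p v * norm (u - v) powr q"] sum_distrib_left mult_ac)
    moreover have "(\<Sum>i\<in>I. c i * (\<integral>v. norm (y i - T n v) powr q \<partial>\<mu>)) = (\<Sum>i\<in>I. \<Sum>v\<in>V. c i * p v * norm (y i - v) powr q)"
      by (simp add: avg[of "\<lambda>v. norm (z - v) powr q" for z] sum_distrib_left mult_ac)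
    ultimately show ?thesis by simp
  qed
  have T_le: "norm (T n v) powr q \<le> 4 * norm v powr q" for n v
  proof -
    have "norm (T n v) powr q \<le> (2 * norm v) powr q" using T(3)[of n v] q by (intro powr_mono2) auto
    also have "\<dots> = 2 powr q * norm v powr q" by (rule powr_mult)
    also have "\<dots> \<le> 2 powr 2 * norm v powr q" using q by (intro mult_right_mono powr_mono) auto
    finally show ?thesis by simp
  qed
  have bound: "norm (a - T n v) powr q \<le> 4 * (norm a powr q + 4 * norm v powr q)" for a v n
    using norm_diff_powr_le[of q a "T n v"] q T_le[of n v] by simp
  have bound2: "norm (T n u - T n v) powr q \<le> 4 * (4 * norm u powr q + 4 * norm v powr q)" for u v n
    using bound[of "T n u" n v] T_le[of n u] by simp
  define M where "M = (\<integral>v. norm v powr q \<partial>\<mu>)"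
  have dom: "integrable \<mu> (\<lambda>v. 4 * (r + 4 * norm v powr q))" for r
    using moment by simp
  have dom_val: "(\<integral>v. 4 * (r + 4 * norm v powr q) \<partial>\<mu>) = 4 * (r + 4 * M)" for r
    using moment by (simp add: M_def prob_space)
  have lim1: "(\<lambda>n. \<integral>v. norm (a - T n v) powr q \<partial>\<mu>) \<longlonglongrightarrow> (\<integral>v. norm (a - v) powr q \<partial>\<mu>)" for a
    by (rule integral_dominated_convergence[OF _ _ dom[of "norm a powr q"]])
       (use q T(2) bound in \<open>auto intro!: AE_I2 tendsto_norm_powr tendsto_intros\<close>)
  have lim2: "(\<lambda>n. \<integral>v. norm (T n u - T n v) powr q \<partial>\<mu>) \<longlonglongrightarrow> (\<integral>v. norm (u - v) powr q \<partial>\<mu>)" for u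
    by (rule integral_dominated_convergence[OF _ _ dom[of "4 * norm u powr q"]])
       (use q T(2) bound2 in \<open>auto intro!: AE_I2 tendsto_norm_powr tendsto_intros\<close>)
  have "(\<lambda>n. \<integral>u. \<integral>v. norm (T n u - T n v) powr q \<partial>\<mu> \<partial>\<mu>) \<longlonglongrightarrow> (\<integral>u. \<integral>v. norm (u - v) powr q \<partial>\<mu> \<partial>\<mu>)"
  proof (rule integral_dominated_convergence[where w = "\<lambda>u. 4 * (4 * M + 4 * norm u powr q)"])
    show "AE u in \<mu>. norm (\<integral>v. norm (T n u - T n v) powr q \<partial>\<mu>) \<le> 4 * (4 * M + 4 * norm u powr q)" for n
    proof (rule AE_I2)
      fix u
      have "(\<integral>v. norm (T n u - T n v) powr q \<partial>\<mu>) \<le> (\<integral>v. 4 * (4 * norm u powr q + 4 * norm v powr q) \<partial>\<mu>)"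
        using bound2 by (intro integral_mono' dom) auto
      also have "\<dots> = 4 * (4 * M + 4 * norm u powr q)" by (simp only: dom_val) simp
      finally show "norm (\<integral>v. norm (T n u - T n v) powr q \<partial>\<mu>) \<le> 4 * (4 * M + 4 * norm u powr q)"
        by (simp add: integral_nonneg_AE)
    qed
    show "integrable \<mu> (\<lambda>u. 4 * (4 * M + 4 * norm u powr q))" by (rule dom)
  qed (use lim2 in auto)
  hence "(\<lambda>n. A + (\<integral>u. \<integral>v. norm (T n u - T n v) powr q \<partial>\<mu> \<partial>\<mu>))
      \<longlonglongrightarrow> A + (\<integral>u. \<integral>v. norm (u - v) powr q \<partial>\<mu> \<partial>\<mu>)"
    by (intro tendsto_intros)
  moreover have "(\<lambda>n. 2 * (\<Sum>i\<in>I. c i * (\<integral>v. norm (y i - T n v) powr q \<partial>\<mu>)))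
      \<longlonglongrightarrow> 2 * (\<Sum>i\<in>I. c i * (\<integral>v. norm (y i - v) powr q \<partial>\<mu>))"
    using lim1 by (intro tendsto_intros)
  ultimately show ?thesis
    unfolding A_def[symmetric] by (rule LIMSEQ_le) (use discrete in blast)
qed


section \<open>Integrals with bounded higher moments\<close>

lemma nn_integral_limit_le:
  fixes h :: "nat \<Rightarrow> 'b \<Rightarrow> real"
  assumes [measurable]: "\<And>n. h n \<in> borel_measurable M"
    and lim: "AE x in M. (\<lambda>n. h n x) \<longlonglongrightarrow> g x"
    and bound: "\<And>n. (\<integral>\<^sup>+x. ennreal (h n x) \<partial>M) \<le> C"
  shows "(\<integral>\<^sup>+x. ennreal (g x) \<partial>M) \<le> C"
proof -
  have "(\<integral>\<^sup>+x. ennreal (g x) \<partial>M) = (\<integral>\<^sup>+x. liminf (\<lambda>n. ennreal (h n x)) \<partial>M)"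
  proof (intro nn_integral_cong_AE)
    show "AE x in M. ennreal (g x) = liminf (\<lambda>n. ennreal (h n x))"
      using lim by eventually_elim (auto intro!: lim_imp_Liminf[symmetric] tendsto_ennrealI)
  qed
  also have "\<dots> \<le> liminf (\<lambda>n. \<integral>\<^sup>+x. ennreal (h n x) \<partial>M)"
    by (intro nn_integral_liminf) auto
  also have "\<dots> \<le> liminf (\<lambda>n. C)"
    by (intro Liminf_mono always_eventually allI bound)
  finally show ?thesis by (simp add: Liminf_const)
qed

text \<open>
  A bound in \<open>L\<^sup>r\<close> with \<open>r > 1\<close> entails uniform integrability: where a function exceeds the
  level \<open>K\<close>, it is at most \<open>K powr (1 - r)\<close> times its \<open>r\<close>-th power.
\<close>
lemma bounded_moment_convergence:
  fixes f :: "nat \<Rightarrow> 'b \<Rightarrow> 'c::{banach, second_countable_topology}"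
  assumes M: "prob_space M" and r: "1 < r"
    and f [measurable]: "\<And>n. f n \<in> borel_measurable M" and g [measurable]: "g \<in> borel_measurable M"
    and lim: "AE x in M. (\<lambda>n. f n x) \<longlonglongrightarrow> g x"
    and bound: "\<And>n. (\<integral>\<^sup>+x. ennreal (norm (f n x) powr r) \<partial>M) \<le> ennreal C"
  shows "integrable M (f n)" "integrable M g" "(\<lambda>n. \<integral>x. f n x \<partial>M) \<longlonglongrightarrow> (\<integral>x. g x \<partial>M)"
proof -
  interpret prob_space M by fact
  have int: "integrable M u" "integrable M (\<lambda>x. norm (u x) powr r)" "(\<integral>x. norm (u x) powr r \<partial>M) \<le> max 0 C"
    if [measurable]: "u \<in> borel_measurable M" and u: "(\<integral>\<^sup>+x. ennreal (norm (u x) powr r) \<partial>M) \<le> ennreal C"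
    for u :: "'b \<Rightarrow> 'c"
  proof -
    show i: "integrable M (\<lambda>x. norm (u x) powr r)"
      using u by (intro integrableI_bounded) (auto intro: order.strict_trans1)
    have u_le: "norm (u x) \<le> 1 + norm (u x) powr r" for x
    proof (cases "norm (u x) \<le> 1")
      case False
      hence "norm (u x) powr 1 \<le> norm (u x) powr r" using r by (intro powr_mono) auto
      thus ?thesis using False by simp
    qed (simp add: add_increasing2)
    show "integrable M u"
    proof (rule Bochner_Integration.integrable_bound[of M "\<lambda>x. 1 + norm (u x) powr r"])
      show "AE x in M. norm (u x) \<le> norm (1 + norm (u x) powr r)"
        using u_le by (intro AE_I2) (simp add: add_nonneg_nonneg)
    qed (use i in auto)
    have "ennreal (\<integral>x. norm (u x) powr r \<partial>M) = (\<integral>\<^sup>+x. ennreal (norm (u x) powr r) \<partial>M)"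
      using i by (intro nn_integral_eq_integral[symmetric]) auto
    also have "\<dots> \<le> ennreal C" by (rule u)
    also have "\<dots> \<le> ennreal (max 0 C)" by (intro ennreal_leI) simp
    finally show "(\<integral>x. norm (u x) powr r \<partial>M) \<le> max 0 C"
      by (subst (asm) ennreal_le_iff) auto
  qed
  have gb: "(\<integral>\<^sup>+x. ennreal (norm (g x) powr r) \<partial>M) \<le> ennreal C"
  proof (rule nn_integral_limit_le[where h = "\<lambda>n x. norm (f n x) powr r"])
    show "AE x in M. (\<lambda>n. norm (f n x) powr r) \<longlonglongrightarrow> norm (g x) powr r"
      using lim r by (auto elim!: eventually_mono intro!: tendsto_norm_powr)
  qed (use bound in auto)
  show fi: "integrable M (f n)" for n using int(1)[OF f bound] .
  show gi: "integrable M g" using int(1)[OF g gb] .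
  define D where "D = 2 powr r * (max 0 C + max 0 C)"
  have D: "0 \<le> D" by (simp add: D_def)
  have diff: "(\<integral>x. norm (f n x - g x) powr r \<partial>M) \<le> D" "integrable M (\<lambda>x. norm (f n x - g x) powr r)" for n
  proof -
    have le: "norm (f n x - g x) powr r \<le> 2 powr r * (norm (f n x) powr r + norm (g x) powr r)" for x
    proof -
      have "norm (f n x - g x) powr r \<le> (2 * max (norm (f n x)) (norm (g x))) powr r"
        using norm_triangle_ineq4[of "f n x" "g x"] r by (intro powr_mono2) auto
      also have "\<dots> = 2 powr r * max (norm (f n x)) (norm (g x)) powr r" by (rule powr_mult)
      also have "\<dots> \<le> 2 powr r * (norm (f n x) powr r + norm (g x) powr r)"
        by (intro mult_left_mono) (auto simp: max_def)
      finally show ?thesis .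
    qed
    have i: "integrable M (\<lambda>x. 2 powr r * (norm (f n x) powr r + norm (g x) powr r))"
      using int(2)[OF f bound] int(2)[OF g gb] by simp
    show i': "integrable M (\<lambda>x. norm (f n x - g x) powr r)"
      by (rule Bochner_Integration.integrable_bound[OF i]) (use le in \<open>auto intro: order_trans\<close>)
    have "(\<integral>x. norm (f n x - g x) powr r \<partial>M) \<le> (\<integral>x. 2 powr r * (norm (f n x) powr r + norm (g x) powr r) \<partial>M)"
      by (intro integral_mono i i' le)
    also have "\<dots> \<le> D"
      unfolding D_def using int(2,3)[OF f[of n] bound] int(2,3)[OF g gb] by simp
    finally show "(\<integral>x. norm (f n x - g x) powr r \<partial>M) \<le> D" .
  qed
  have lim0: "(\<lambda>n. \<integral>x. norm (f n x - g x) \<partial>M) \<longlonglongrightarrow> 0"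
  proof (rule LIMSEQ_I)
    fix e :: real assume e: "0 < e"
    \<comment> \<open>The level above which the bound on the \<open>r\<close>-th moments makes the contribution less than \<open>e / 2\<close>.\<close>
    define K where "K = (e / (2 * (D + 1))) powr (1 / (1 - r))"
    have K: "0 < K" using e D by (simp add: K_def)
    have KD: "D * K powr (1 - r) < e / 2"
    proof -
      have "K powr (1 - r) = e / (2 * (D + 1))" using r e D by (simp add: K_def powr_powr)
      moreover have "D * (e / (2 * (D + 1))) < e / 2" using e D by (simp add: field_simps)
      ultimately show ?thesis by simp
    qed
    have "(\<lambda>n. \<integral>x. min (norm (f n x - g x)) K \<partial>M) \<longlonglongrightarrow> (\<integral>x. 0 \<partial>M)"
    proof (rule integral_dominated_convergence[where w = "\<lambda>_. K"])
      show "AE x in M. (\<lambda>n. min (norm (f n x - g x)) K) \<longlonglongrightarrow> 0"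
      proof -
        have "(\<lambda>n. min (norm (f n x - g x)) K) \<longlonglongrightarrow> min (norm (g x - g x)) K"
          if "(\<lambda>n. f n x) \<longlonglongrightarrow> g x" for x
          using that by (intro tendsto_intros)
        thus ?thesis using lim K by (auto elim!: eventually_mono)
      qed
    qed (use K in auto)
    then obtain N where N: "\<And>n. n \<ge> N \<Longrightarrow> norm (\<integral>x. min (norm (f n x - g x)) K \<partial>M) < e / 2"
      using LIMSEQ_D[of _ "0::real" "e / 2"] e by fastforce
    have "norm ((\<integral>x. norm (f n x - g x) \<partial>M) - 0) < e" if "n \<ge> N" for n
    proof -
      have le: "z \<le> min z K + K powr (1 - r) * z powr r" if "0 \<le> z" for z
      proof (cases "z \<le> K")
        case False
        have "z = z powr (1 - r) * z powr r" using False K by (simp flip: powr_add)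
        also have "\<dots> \<le> K powr (1 - r) * z powr r"
          using False K r by (intro mult_right_mono powr_mono2') auto
        finally show ?thesis using False K by simp
      qed simp
      have i1: "integrable M (\<lambda>x. norm (f n x - g x))" using fi gi by simp
      have i2: "integrable M (\<lambda>x. min (norm (f n x - g x)) K)"
        by (rule Bochner_Integration.integrable_bound[OF i1]) (use K in auto)
      have "(\<integral>x. norm (f n x - g x) \<partial>M)
          \<le> (\<integral>x. min (norm (f n x - g x)) K + K powr (1 - r) * norm (f n x - g x) powr r \<partial>M)"
        using i1 i2 diff(2) le by (intro integral_mono) auto
      also have "\<dots> = (\<integral>x. min (norm (f n x - g x)) K \<partial>M) + K powr (1 - r) * (\<integral>x. norm (f n x - g x) powr r \<partial>M)"
        using i2 diff(2) by simp
      also have "\<dots> < e / 2 + e / 2"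
      proof (rule add_strict_mono)
        show "(\<integral>x. min (norm (f n x - g x)) K \<partial>M) < e / 2" using N[OF that] by simp
        have "K powr (1 - r) * (\<integral>x. norm (f n x - g x) powr r \<partial>M) \<le> K powr (1 - r) * D"
          using diff(1) by (intro mult_left_mono) auto
        thus "K powr (1 - r) * (\<integral>x. norm (f n x - g x) powr r \<partial>M) < e / 2" using KD by (simp add: mult.commute)
      qed
      finally show ?thesis by (simp add: integral_nonneg_AE)
    qed
    thus "\<exists>N. \<forall>n\<ge>N. norm ((\<integral>x. norm (f n x - g x) \<partial>M) - 0) < e" by blast
  qed
  have "\<forall>\<^sub>F n in sequentially. norm ((\<integral>x. f n x \<partial>M) - (\<integral>x. g x \<partial>M)) \<le> (\<integral>x. norm (f n x - g x) \<partial>M)"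
  proof (intro always_eventually allI)
    fix n
    have "(\<integral>x. f n x \<partial>M) - (\<integral>x. g x \<partial>M) = (\<integral>x. f n x - g x \<partial>M)"
      using fi gi by simp
    thus "norm ((\<integral>x. f n x \<partial>M) - (\<integral>x. g x \<partial>M)) \<le> (\<integral>x. norm (f n x - g x) \<partial>M)"
      by simp
  qed
  from Lim_null_comparison[OF this lim0]
  have "(\<lambda>n. (\<integral>x. f n x \<partial>M) - (\<integral>x. g x \<partial>M)) \<longlonglongrightarrow> 0" .
  thus "(\<lambda>n. \<integral>x. f n x \<partial>M) \<longlonglongrightarrow> (\<integral>x. g x \<partial>M)" by (rule LIM_zero_cancel)
qed

text \<open>
  The sum over the dyadic layers \<open>2\<^sup>n \<le> w < 2\<^sup>n\<^sup>+\<^sup>1\<close> is geometric with ratio \<open>2 powr (s - b)\<close>.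
\<close>
lemma moment_from_tail:
  fixes w :: "'b \<Rightarrow> real"
  assumes M: "prob_space M" and [measurable]: "w \<in> borel_measurable M" and w: "\<And>x. 0 \<le> w x"
    and s: "0 < s" "s < b" and C: "0 \<le> C"
    and tail: "\<And>n. measure M {x \<in> space M. 2 ^ n \<le> w x} \<le> C * 2 powr (- b * real n)"
  shows "(\<integral>\<^sup>+x. ennreal (w x powr s) \<partial>M) \<le> ennreal (1 + C * 2 powr s / (1 - 2 powr (s - b)))"
proof -
  interpret prob_space M by fact
  define A where "A n = {x \<in> space M. 2 ^ n \<le> w x}" for n :: nat
  have [measurable]: "A n \<in> sets M" for n unfolding A_def by measurable
  define a where "a n = 2 powr (s * (real n + 1))" for n :: nat
  have pt: "ennreal (w x powr s) \<le> 1 + (\<Sum>n. ennreal (a n) * indicator (A n) x)" if x: "x \<in> space M" for x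
  proof (cases "w x < 1")
    case True
    hence "w x powr s \<le> 1" using w s by (intro powr_le1) auto
    hence "ennreal (w x powr s) \<le> 1" by simp
    thus ?thesis by (rule order_trans) simp
  next
    case False
    define n where "n = nat \<lfloor>log 2 (w x)\<rfloor>"
    have n: "real n \<le> log 2 (w x)" "log 2 (w x) < real n + 1" using False by (auto simp: n_def of_nat_nat)
    have "2 ^ n \<le> w x" using n(1) False by (simp add: le_log_iff powr_realpow)
    hence "x \<in> A n" using x by (simp add: A_def)
    have "w x < 2 powr (real n + 1)" using n(2) False by (simp add: log_less_iff)
    hence "w x powr s \<le> (2 powr (real n + 1)) powr s" using False s by (intro powr_mono2) auto
    also have "\<dots> = a n" by (simp add: a_def powr_powr mult.commute)
    finally have "ennreal (w x powr s) \<le> ennreal (a n) * indicator (A n) x"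
      using \<open>x \<in> A n\<close> by (simp add: ennreal_leI)
    also have "\<dots> = (\<Sum>k\<in>{n}. ennreal (a k) * indicator (A k) x)"
      by (simp only: sum.insert[OF finite.emptyI] empty_iff sum.empty add_0_right not_False_eq_True)
    also have "\<dots> \<le> (\<Sum>n. ennreal (a n) * indicator (A n) x)"
      by (rule sum_le_suminf) auto
    finally show ?thesis by (rule order_trans) simp
  qed
  define t where "t = 2 powr (s - b)"
  have t: "0 < t" "t < 1" using s powr_less_mono[of "s - b" 0 2] by (auto simp: t_def)
  have "(\<Sum>n. ennreal (a n) * emeasure M (A n)) \<le> (\<Sum>n. ennreal (C * 2 powr s * t ^ n))"
  proof (intro suminf_le)
    fix n
    have "a n * prob (A n) \<le> a n * (C * 2 powr (- b * real n))"
      using tail[of n] unfolding A_def by (intro mult_left_mono) (auto simp: a_def)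
    also have "\<dots> = C * 2 powr s * t ^ n"
      by (simp add: a_def t_def algebra_simps flip: powr_add powr_realpow powr_powr)
         (simp add: powr_powr algebra_simps flip: powr_add)
    finally show "ennreal (a n) * emeasure M (A n) \<le> ennreal (C * 2 powr s * t ^ n)"
      by (simp add: emeasure_eq_measure a_def ennreal_leI flip: ennreal_mult)
  qed auto
  also have "(\<Sum>n. ennreal (C * 2 powr s * t ^ n)) = ennreal (C * 2 powr s / (1 - t))"
  proof (rule suminf_ennreal_eq)
    show "(\<lambda>n. C * 2 powr s * t ^ n) sums (C * 2 powr s / (1 - t))"
      using sums_mult[OF geometric_sums[of t], of "C * 2 powr s"] t by simp
  qed (use C t in auto)
  finally have tail_sum: "(\<Sum>n. ennreal (a n) * emeasure M (A n)) \<le> ennreal (C * 2 powr s / (1 - t))" .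
  have "(\<integral>\<^sup>+x. ennreal (w x powr s) \<partial>M) \<le> (\<integral>\<^sup>+x. 1 + (\<Sum>n. ennreal (a n) * indicator (A n) x) \<partial>M)"
    by (intro nn_integral_mono pt)
  also have "\<dots> = 1 + (\<Sum>n. ennreal (a n) * emeasure M (A n))"
    by (simp add: nn_integral_add nn_integral_suminf nn_integral_cmult_indicator emeasure_space_1)
  also have "\<dots> \<le> 1 + ennreal (C * 2 powr s / (1 - t))"
    by (intro add_left_mono tail_sum)
  also have "1 + ennreal (C * 2 powr s / (1 - t)) = ennreal (1 + C * 2 powr s / (1 - t))"
    using C t by (subst ennreal_plus) auto
  finally show ?thesis unfolding t_def .
qed

section \<open>Regularity of the target\<close>

text \<open>
  On a ball of radius \<open>r\<close> compare \<open>f\<close> with \<open>\<lambda> + \<lambda> powr (1 - p) * f powr p\<close>; the level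
  \<open>\<lambda> = r powr (- d / p)\<close> balances the two terms.
\<close>
lemma Lp_density_ball_growth:
  fixes f :: "'a::euclidean_space \<Rightarrow> real"
  assumes [measurable]: "f \<in> borel_measurable borel" and f: "\<And>x. 0 \<le> f x"
    and p: "1 < p" and Lp: "integrable lborel (\<lambda>x. f x powr p)"
    and prob: "prob_space (density lborel (\<lambda>x. ennreal (f x)))"
  obtains C where "0 \<le> C" "\<And>x r. 0 < r \<Longrightarrow>
    measure (density lborel (\<lambda>x. ennreal (f x))) (cball x r) \<le> C * r powr (real DIM('a) * (1 - 1 / p))"
proof -
  define d where "d = real DIM('a)"
  define F where "F = (\<integral>x. f x powr p \<partial>lborel)"
  define om where "om = unit_ball_vol d"
  have F: "0 \<le> F" by (simp add: F_def)
  have om: "0 \<le> om" by (simp add: om_def d_def unit_ball_vol_nonneg)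
  interpret prob_space "density lborel (\<lambda>x. ennreal (f x))" by fact
  have "prob (cball x r) \<le> (om + F) * r powr (d * (1 - 1 / p))" if r: "0 < r" for x r
  proof -
    define l where "l = r powr (- d / p)"
    have l: "0 < l" using r by (simp add: l_def)
    have le: "f y \<le> l + l powr (1 - p) * f y powr p" for y
    proof (cases "f y \<le> l")
      case False
      have "f y = f y powr (1 - p) * f y powr p" using False l by (simp flip: powr_add)
      also have "\<dots> \<le> l powr (1 - p) * f y powr p"
        using False l p by (intro mult_right_mono powr_mono2') auto
      finally show ?thesis using l by simp
    qed (simp add: add_increasing2)
    have "emeasure (density lborel (\<lambda>x. ennreal (f x))) (cball x r)
        = (\<integral>\<^sup>+y. ennreal (f y) * indicator (cball x r) y \<partial>lborel)"
      by (simp add: emeasure_density)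
    also have "\<dots> \<le> (\<integral>\<^sup>+y. ennreal l * indicator (cball x r) y + ennreal (l powr (1 - p)) * ennreal (f y powr p) \<partial>lborel)"
    proof (intro nn_integral_mono)
      fix y
      have "ennreal (f y) \<le> ennreal l + ennreal (l powr (1 - p)) * ennreal (f y powr p)"
        using le[of y] l by (simp flip: ennreal_mult ennreal_plus)
      thus "ennreal (f y) * indicator (cball x r) y \<le> ennreal l * indicator (cball x r) y + ennreal (l powr (1 - p)) * ennreal (f y powr p)"
        by (auto simp: indicator_def)
    qed
    also have "\<dots> = ennreal l * ennreal (om * r ^ DIM('a)) + ennreal (l powr (1 - p)) * ennreal F"
    proof -
      have "(\<integral>\<^sup>+y. ennreal (f y powr p) \<partial>lborel) = ennreal F"
        unfolding F_def using Lp by (intro nn_integral_eq_integral) auto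
      moreover have "emeasure lborel (cball x r) = ennreal (om * r ^ DIM('a))"
        using r by (simp add: emeasure_cball om_def d_def)
      ultimately show ?thesis
        by (subst nn_integral_add) (auto simp: nn_integral_cmult nn_integral_cmult_indicator
            intro!: borel_measurable_times_ennreal borel_measurable_indicator)
    qed
    also have "\<dots> = ennreal (l * (om * r ^ DIM('a)) + l powr (1 - p) * F)"
      using l om r F by (simp flip: ennreal_mult ennreal_plus)
    also have "l * (om * r ^ DIM('a)) + l powr (1 - p) * F = (om + F) * r powr (d * (1 - 1 / p))"
    proof -
      have "l * r ^ DIM('a) = r powr (d * (1 - 1 / p))"
        using r by (simp add: l_def d_def right_diff_distrib add.commute flip: powr_realpow powr_add)
      moreover have "l powr (1 - p) = r powr (d * (1 - 1 / p))"
      proof -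
        have "- d / p * (1 - p) = d * (1 - 1 / p)" using p by (simp add: field_simps)
        thus ?thesis by (simp add: l_def powr_powr)
      qed
      ultimately show ?thesis by (simp add: algebra_simps)
    qed
    finally show ?thesis
      using om F by (simp add: emeasure_eq_measure)
  qed
  thus ?thesis using that[of "om + F"] om F by (simp add: d_def)
qed

lemma bounded_density_powr_integrable:
  fixes f :: "'a::euclidean_space \<Rightarrow> real"
  assumes [measurable]: "f \<in> borel_measurable borel" and f: "\<And>x. 0 \<le> f x"
    and prob: "prob_space (density lborel (\<lambda>x. ennreal (f x)))"
    and C: "AE x in lborel. \<bar>f x\<bar> \<le> C" and p: "1 < p"
  shows "integrable lborel (\<lambda>x. f x powr p)"
proof -
  interpret prob_space "density lborel (\<lambda>x. ennreal (f x))" by fact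
  have "(\<integral>\<^sup>+x. ennreal (f x) \<partial>lborel) = 1"
    using emeasure_space_1 by (simp add: emeasure_density)
  hence i: "integrable lborel f"
    using f by (intro integrableI_nonneg) auto
  show ?thesis
  proof (rule Bochner_Integration.integrable_bound[of lborel "\<lambda>x. C powr (p - 1) * f x"])
    show "AE x in lborel. norm (f x powr p) \<le> norm (C powr (p - 1) * f x)"
      using C
    proof eventually_elim
      case (elim x)
      have "f x powr p = f x * f x powr (p - 1)" using powr_mult_base[OF f, of x "p - 1"] by simp
      also have "\<dots> \<le> f x * C powr (p - 1)" using elim f[of x] p by (intro mult_left_mono powr_mono2) auto
      finally show ?case using f[of x] by (simp add: mult.commute)
    qed
  qed (use i in auto)
qed

text \<open>
  The consequences of the hypotheses on the target that the argument rests on. The last one says that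
  \<open>\<nabla>K (x - \<cdot>)\<close> is bounded in some \<open>L\<^sup>r(\<mu>)\<close>, \<open>r > 1\<close>, locally uniformly in \<open>x\<close>; for \<open>q < 1\<close>
  this is where the integrability exponent of the density enters.
\<close>
locale regular_target = prob_space \<mu> for \<mu> :: "'a::euclidean_space measure" +
  fixes q :: real
  assumes q: "0 < q" "q < 2"
    and sets_target [measurable_cong]: "sets \<mu> = sets borel"
    and moment: "integrable \<mu> (\<lambda>v. norm v powr q)"
    and no_atoms: "measure \<mu> {x} = 0"
    and kernel_moment: "\<exists>r>1. \<forall>R. \<exists>C. \<forall>x. norm x \<le> R \<longrightarrow>
      (\<integral>\<^sup>+v. ennreal (norm (x - v) powr ((q - 1) * r)) \<partial>\<mu>) \<le> ennreal C"

text \<open>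
  If \<open>q < 1\<close>, the exponent \<open>d (1 - 1 / p)\<close> of the ball growth exceeds \<open>1 - q\<close> in each of the admissible
  ranges of \<open>p\<close>, so some power of \<open>1 / \<bar>x - v\<bar>\<close> with exponent above \<open>1 - q\<close> has a \<open>\<mu>\<close>-integral bounded uniformly in \<open>x\<close>.
  If \<open>q \<ge> 1\<close>, the kernel grows of order \<open>q - 1 < q\<close> and the \<open>q\<close>-th moment of \<open>\<mu>\<close> leaves room.
\<close>
lemma regular_target_Lp_density:
  fixes \<mu> :: "'a::euclidean_space measure"
  assumes q: "0 < q" "q < 2"
    and p: "(real DIM('a) + q - 2 > 0 \<and> ereal (real DIM('a) / (real DIM('a) + q - 2)) < p)
       \<or> (DIM('a) = 1 \<and> q = 1 \<and> p = \<infinity>)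
       \<or> (DIM('a) = 1 \<and> q < 1 \<and> ereal (1 / q) < p)"
    and \<mu>: "\<mu> \<in> prob_moment (max 1 q) \<inter> Lp_density_measures p"
  shows "regular_target \<mu> q"
proof -
  have \<mu>': "prob_space \<mu>" "sets \<mu> = sets borel" "integrable \<mu> (\<lambda>x. norm x powr max 1 q)"
    using \<mu> by (auto simp: prob_moment_def borel_prob_def)
  note [measurable_cong] = \<mu>'(2)
  interpret prob_space \<mu> by fact
  obtain f where f: "in_Lp p f" "\<And>x. 0 \<le> f x" "\<mu> = density lborel (\<lambda>x. ennreal (f x))"
    using \<mu> by (auto simp: Lp_density_measures_def)
  have [measurable]: "f \<in> borel_measurable borel" using f(1) by (simp add: in_Lp_def)
  have mom: "integrable \<mu> (\<lambda>v. norm v powr q)"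
  proof (rule Bochner_Integration.integrable_bound[of \<mu> "\<lambda>v. 1 + norm v powr max 1 q"])
    have "norm v powr q \<le> 1 + norm v powr max 1 q" for v :: 'a
    proof (cases "norm v \<le> 1")
      case True
      hence "norm v powr q \<le> 1" using q by (intro powr_le1) auto
      thus ?thesis by (simp add: add_increasing2)
    next
      case False
      hence "norm v powr q \<le> norm v powr max 1 q" by (intro powr_mono) auto
      thus ?thesis by simp
    qed
    thus "AE v in \<mu>. norm (norm v powr q) \<le> norm (1 + norm v powr max 1 q)" by auto
  qed (use \<mu>' in auto)
  have atoms: "measure \<mu> {x} = 0" for x
  proof -
    have "emeasure \<mu> {x} = 0"
      unfolding f(3) by (subst emeasure_density) (auto intro!: nn_integral_0_iff_AE[THEN iffD2] AE_lborel_singleton[THEN eventually_mono] simp: indicator_def)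
    thus ?thesis by (simp add: measure_def)
  qed
  have "\<exists>r>1. \<forall>R. \<exists>C. \<forall>x. norm x \<le> R \<longrightarrow>
      (\<integral>\<^sup>+v. ennreal (norm (x - v) powr ((q - 1) * r)) \<partial>\<mu>) \<le> ennreal C"
  proof -
    consider "q < 1" | "q = 1" | "1 < q" by linarith
    thus ?thesis
    proof cases
      case 1
      define d where "d = real DIM('a)"
      have d: "1 \<le> d" by (simp add: d_def DIM_positive Suc_le_eq)
      have "\<exists>p'. 1 < p' \<and> 1 - q < d * (1 - 1 / p') \<and> integrable lborel (\<lambda>x. f x powr p')"
      proof -
        have "\<exists>pc. 1 < pc \<and> ereal pc < p \<and> (\<forall>p'>pc. 1 - q < d * (1 - 1 / p'))"
          using p
        proof (elim disjE conjE)
          assume a: "real DIM('a) + q - 2 > 0" "ereal (real DIM('a) / (real DIM('a) + q - 2)) < p"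
          have "1 - q < d * (1 - 1 / p')" if "p' > d / (d + q - 2)" for p'
          proof -
            have "p' > 0" using that a d by (auto simp: d_def intro: order.strict_trans1[rotated])
            moreover have "d < p' * (d + q - 2)" using that a by (simp add: d_def pos_divide_less_eq)
            hence "d / p' < d + q - 2" using \<open>p' > 0\<close> by (simp add: pos_divide_less_eq mult.commute)
            ultimately show ?thesis by (simp add: algebra_simps)
          qed
          moreover have "1 < d / (d + q - 2)" using a q by (simp add: d_def)
          ultimately show ?thesis using a by (intro exI[of _ "d / (d + q - 2)"]) (auto simp: d_def)
        next
          assume a: "DIM('a) = 1" "q < 1" "ereal (1 / q) < p"
          have "1 - q < d * (1 - 1 / p')" if "p' > 1 / q" for p'
          proof -
            have "1 / p' < q" using that q
              by (smt (verit) divide_less_eq mult.commute zero_less_divide_1_iff)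
            thus ?thesis using a by (simp add: d_def)
          qed
          thus ?thesis using a q by (intro exI[of _ "1 / q"]) auto
        qed (use 1 in auto)
        then obtain pc where pc: "1 < pc" "ereal pc < p" "\<And>p'. p' > pc \<Longrightarrow> 1 - q < d * (1 - 1 / p')" by blast
        show ?thesis
        proof (cases p)
          case (real p')
          thus ?thesis using pc f(1,2) by (intro exI[of _ p']) (auto simp: in_Lp_def)
        next
          case PInf
          then obtain C where "AE x in lborel. \<bar>f x\<bar> \<le> C" using f(1) by (auto simp: in_Lp_def)
          hence "integrable lborel (\<lambda>x. f x powr (pc + 1))"
            using f \<mu>'(1) pc by (intro bounded_density_powr_integrable) auto
          thus ?thesis using pc by (intro exI[of _ "pc + 1"]) auto
        qed (use pc in auto)
      qed
      then obtain p' where p': "1 < p'" "1 - q < d * (1 - 1 / p')" "integrable lborel (\<lambda>x. f x powr p')" by blast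
      define b where "b = d * (1 - 1 / p')"
      obtain C where C: "0 \<le> C" "\<And>x r. 0 < r \<Longrightarrow> prob (cball x r) \<le> C * r powr b"
        using Lp_density_ball_growth[of f p'] f p' \<mu>'(1) unfolding b_def d_def f(3) by auto
      define r where "r = (1 + b / (1 - q)) / 2"
      have r: "1 < r" "(1 - q) * r < b"
      proof -
        have b: "1 - q < b" using p'(2) by (simp add: b_def)
        show "1 < r" using 1 b by (simp add: r_def field_simps)
        have "(1 - q) * r = ((1 - q) + b) / 2" using 1 by (simp add: r_def field_simps)
        thus "(1 - q) * r < b" using b by simp
      qed
      have "(\<integral>\<^sup>+v. ennreal (norm (x - v) powr ((q - 1) * r)) \<partial>\<mu>)
          \<le> ennreal (1 + C * 2 powr ((1 - q) * r) / (1 - 2 powr ((1 - q) * r - b)))" for x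
      proof -
        have "(\<integral>\<^sup>+v. ennreal (inverse (norm (x - v)) powr ((1 - q) * r)) \<partial>\<mu>)
          \<le> ennreal (1 + C * 2 powr ((1 - q) * r) / (1 - 2 powr ((1 - q) * r - b)))"
        proof (rule moment_from_tail[OF \<mu>'(1)])
          fix n :: nat
          have "{v \<in> space \<mu>. 2 ^ n \<le> inverse (norm (x - v))} \<subseteq> cball x (2 powr (- real n))"
          proof
            fix v assume v: "v \<in> {v \<in> space \<mu>. 2 ^ n \<le> inverse (norm (x - v))}"
            hence "inverse (inverse (norm (x - v))) \<le> inverse (2 ^ n)" by (intro le_imp_inverse_le) auto
            thus "v \<in> cball x (2 powr (- real n))"
              by (simp add: dist_norm powr_minus powr_realpow)
          qed
          hence "prob {v \<in> space \<mu>. 2 ^ n \<le> inverse (norm (x - v))} \<le> prob (cball x (2 powr (- real n)))"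
            by (intro finite_measure_mono) auto
          also have "\<dots> \<le> C * (2 powr (- real n)) powr b" by (rule C(2)) simp
          also have "\<dots> = C * 2 powr (- b * real n)" by (simp add: powr_powr mult.commute)
          finally show "prob {v \<in> space \<mu>. 2 ^ n \<le> inverse (norm (x - v))} \<le> C * 2 powr (- b * real n)" .
        qed (use 1 r C in auto)
        moreover have "inverse (norm (x - v)) powr ((1 - q) * r) = norm (x - v) powr ((q - 1) * r)" for v
        proof -
          have "(q - 1) * r = - ((1 - q) * r)" by (simp add: algebra_simps)
          thus ?thesis by (simp only: powr_minus inverse_powr[symmetric] norm_ge_zero)
        qed
        ultimately show ?thesis by simp
      qed
      thus ?thesis using r by blast
    next
      case 2
      have "(\<integral>\<^sup>+v. ennreal (norm (x - v) powr ((q - 1) * 2)) \<partial>\<mu>) \<le> (\<integral>\<^sup>+v. 1 \<partial>\<mu>)" for x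
        using 2 by (intro nn_integral_mono) (auto)
      thus ?thesis using emeasure_space_1 by (intro exI[of _ "2::real"]) (auto intro!: exI[of _ "1::real"])
    next
      case 3
      have "\<exists>C. \<forall>x. norm x \<le> R \<longrightarrow> (\<integral>\<^sup>+v. ennreal (norm (x - v) powr ((q - 1) * (q / (q - 1)))) \<partial>\<mu>) \<le> ennreal C" for R
      proof (intro exI allI impI)
        fix x :: 'a assume x: "norm x \<le> R"
        have "(\<integral>\<^sup>+v. ennreal (norm (x - v) powr q) \<partial>\<mu>) \<le> (\<integral>\<^sup>+v. ennreal (4 * (R powr q + norm v powr q)) \<partial>\<mu>)"
        proof (intro nn_integral_mono ennreal_leI)
          fix v
          have "norm (x - v) powr q \<le> 4 * (norm x powr q + norm v powr q)"
            using q by (intro norm_diff_powr_le) auto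
          also have "norm x powr q \<le> R powr q" using q x by (intro powr_mono2) auto
          finally show "norm (x - v) powr q \<le> 4 * (R powr q + norm v powr q)" by simp
        qed
        also have "\<dots> = ennreal (\<integral>v. 4 * (R powr q + norm v powr q) \<partial>\<mu>)"
          using mom by (intro nn_integral_eq_integral) auto
        finally show "(\<integral>\<^sup>+v. ennreal (norm (x - v) powr ((q - 1) * (q / (q - 1)))) \<partial>\<mu>) \<le> ennreal (\<integral>v. 4 * (R powr q + norm v powr q) \<partial>\<mu>)"
          using 3 by simp
      qed
      thus ?thesis using 3 by (intro exI[of _ "q / (q - 1)"]) auto
    qed
  qed
  thus ?thesis using q \<mu>' mom atoms by unfold_locales auto
qed


section \<open>The field generated by the target\<close>

text \<open>
  For \<open>q \<le> 1\<close> the factor \<open>\<bar>a - b\<bar> powr (q - 1)\<close> is at least \<open>1\<close> nearby, so this is only continuity.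
\<close>
lemma isCont_modulus:
  fixes f :: "'a::real_normed_vector \<Rightarrow> 'b::real_normed_vector"
  assumes f: "isCont f x" and q: "q \<le> 1" and e: "0 < e"
  obtains d where "0 < d" "\<And>a b. dist a x < d \<Longrightarrow> dist b x < d \<Longrightarrow> a \<noteq> b \<Longrightarrow>
    norm (f a - f b) \<le> e * norm (a - b) powr (q - 1)"
proof -
  obtain d where d: "0 < d" "\<And>a. dist a x < d \<Longrightarrow> dist (f a) (f x) < e / 2"
    using f unfolding continuous_at_eps_delta using e half_gt_zero by blast
  have "norm (f a - f b) \<le> e * norm (a - b) powr (q - 1)"
    if ab: "dist a x < min d (1/2)" "dist b x < min d (1/2)" "a \<noteq> b" for a b
  proof -
    have "norm (a - b) \<le> 1" using ab dist_triangle2[of a b x] by (simp add: dist_norm)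
    hence "1 powr (q - 1) \<le> norm (a - b) powr (q - 1)" using q ab by (intro powr_mono2') auto
    hence "e * 1 \<le> e * norm (a - b) powr (q - 1)" using e by (intro mult_left_mono) auto
    moreover have "norm (f a - f b) < e"
      using d(2)[of a] d(2)[of b] ab dist_triangle2[of "f a" "f b" "f x"] by (simp add: dist_norm)
    ultimately show ?thesis by simp
  qed
  thus ?thesis using that[of "min d (1/2)"] d(1) by auto
qed

text \<open>
  Away from the origin the gradient varies by \<open>o(\<bar>a - b\<bar> powr (q - 1))\<close>, hence by less than the
  repulsion between particles at \<open>a\<close> and \<open>b\<close>.
\<close>
lemma grad_ker_modulus:
  fixes a0 :: "'a::euclidean_space"
  assumes q: "0 < q" "q < 2" and a0: "a0 \<noteq> 0" and e: "0 < e"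
  obtains d where "0 < d" "\<And>a b. dist a a0 < d \<Longrightarrow> dist b a0 < d \<Longrightarrow> a \<noteq> b \<Longrightarrow>
    norm (grad_ker q a - grad_ker q b) \<le> e * norm (a - b) powr (q - 1)"
proof (cases "q \<le> 1")
  case True
  show ?thesis
    by (rule isCont_modulus[OF isCont_grad_ker[OF a0] True e]) (rule that)
next
  case False
  define s where "s = norm a0 / 2"
  have s: "0 < s" using a0 by (simp add: s_def)
  define L where "L = 2 * q * s powr (q - 2)"
  have L: "0 < L" using q s by (simp add: L_def)
  define d where "d = min s ((e / L) powr (1 / (2 - q)) / 2)"
  have d: "0 < d" using s e L by (simp add: d_def)
  have "norm (grad_ker q a - grad_ker q b) \<le> e * norm (a - b) powr (q - 1)"
    if ab: "dist a a0 < d" "dist b a0 < d" "a \<noteq> b" for a b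
  proof -
    have "s \<le> norm a" using ab(1) norm_triangle_ineq2[of a0 "a0 - a"]
      by (simp add: dist_norm d_def s_def norm_minus_commute)
    hence m: "max (norm a) (norm b) powr (q - 2) \<le> s powr (q - 2)"
      using s q by (intro powr_mono2') auto
    have h: "0 < norm (a - b)" using ab by simp
    have "norm (a - b) < 2 * d" using ab dist_triangle2[of a b a0] by (simp add: dist_norm)
    also have "2 * d \<le> (e / L) powr (1 / (2 - q))" by (simp add: d_def)
    finally have "norm (a - b) powr (2 - q) \<le> ((e / L) powr (1 / (2 - q))) powr (2 - q)"
      using q by (intro powr_mono2) auto
    also have "\<dots> = e / L" using q e L by (simp add: powr_powr)
    finally have small: "L * norm (a - b) powr (2 - q) \<le> e" using L by (simp add: field_simps)
    have "norm (grad_ker q a - grad_ker q b) \<le> 2 * q * max (norm a) (norm b) powr (q - 2) * norm (a - b)"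
      using False q by (intro grad_ker_diff_le) auto
    also have "\<dots> \<le> L * norm (a - b)"
      unfolding L_def using m q by (intro mult_right_mono mult_left_mono) auto
    also have "\<dots> = L * norm (a - b) powr (2 - q) * norm (a - b) powr (q - 1)"
      using h by (simp flip: powr_add)
    also have "\<dots> \<le> e * norm (a - b) powr (q - 1)"
      using small by (intro mult_right_mono) auto
    finally show ?thesis .
  qed
  thus ?thesis using that[OF d] by blast
qed

lemma LIMSEQ_of_dist_less:
  fixes S :: "nat \<Rightarrow> 'a::metric_space"
  assumes "\<And>n. dist (S n) x < 1 / real (Suc n)"
  shows "S \<longlonglongrightarrow> x"
  by (rule metric_tendsto_imp_tendsto[OF LIMSEQ_inverse_real_of_nat])
     (use assms in \<open>auto intro!: always_eventually less_imp_le simp: inverse_eq_divide\<close>)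

context regular_target
begin

lemma space_target [simp]: "space \<mu> = UNIV"
  using sets_eq_imp_space_eq[OF sets_target] by simp

lemma prob_UNIV [simp]: "prob UNIV = 1"
  using prob_space by simp

lemma AE_target_neq: "AE v in \<mu>. v \<noteq> x"
proof (rule AE_I[of _ _ "{x}"])
  show "emeasure \<mu> {x} = 0" using no_atoms by (simp add: emeasure_eq_measure)
qed auto

definition potential :: "'a \<Rightarrow> real" where
  "potential x = (\<integral>v. norm (x - v) powr q \<partial>\<mu>)"

definition drift :: "'a \<Rightarrow> 'a" where
  "drift x = (\<integral>v. grad_ker q (x - v) \<partial>\<mu>)"

lemma integrable_norm_powr: "integrable \<mu> (\<lambda>v. norm (x - v) powr q)"
proof (rule Bochner_Integration.integrable_bound[of \<mu> "\<lambda>v. 4 * (norm x powr q + norm v powr q)"])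
  show "AE v in \<mu>. norm (norm (x - v) powr q) \<le> norm (4 * (norm x powr q + norm v powr q))"
    using norm_diff_powr_le[of q x] q by (intro AE_I2) simp
qed (use moment in auto)

lemma potential_bound:
  "potential x \<le> 4 * (norm x powr q + (\<integral>v. norm v powr q \<partial>\<mu>))"
proof -
  have "potential x \<le> (\<integral>v. 4 * (norm x powr q + norm v powr q) \<partial>\<mu>)"
    unfolding potential_def
    using norm_diff_powr_le[of q x] q moment by (intro integral_mono integrable_norm_powr) auto
  also have "\<dots> = 4 * (norm x powr q + (\<integral>v. norm v powr q \<partial>\<mu>))"
    using moment by simp
  finally show ?thesis .
qed

lemma potential_nonneg: "0 \<le> potential x"
  by (simp add: potential_def)

lemma potential_measurable [measurable]: "potential \<in> borel_measurable borel"
  unfolding potential_def by measurable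

lemma drift_measurable [measurable]: "drift \<in> borel_measurable borel"
  unfolding drift_def by measurable

lemma integrable_potential: "integrable \<mu> potential"
proof (rule Bochner_Integration.integrable_bound[of \<mu> "\<lambda>x. 4 * (norm x powr q + (\<integral>v. norm v powr q \<partial>\<mu>))"])
  show "AE x in \<mu>. norm (potential x) \<le> norm (4 * (norm x powr q + (\<integral>v. norm v powr q \<partial>\<mu>)))"
  proof (rule AE_I2)
    fix x
    show "norm (potential x) \<le> norm (4 * (norm x powr q + (\<integral>v. norm v powr q \<partial>\<mu>)))"
      using potential_bound[of x] potential_nonneg[of x] by simp
  qed
qed (use moment in auto)

lemma kernel_moment_bound:
  obtains r C where "1 < r" "0 \<le> C" "\<And>x. norm x \<le> R \<Longrightarrow>
    (\<integral>\<^sup>+v. ennreal ((norm (x - v) powr (q - 1)) powr r) \<partial>\<mu>) \<le> ennreal C"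
proof -
  obtain r C where r: "1 < r" and C: "\<And>x. norm x \<le> R \<Longrightarrow>
      (\<integral>\<^sup>+v. ennreal (norm (x - v) powr ((q - 1) * r)) \<partial>\<mu>) \<le> ennreal C"
    using kernel_moment by blast
  have "(\<integral>\<^sup>+v. ennreal ((norm (x - v) powr (q - 1)) powr r) \<partial>\<mu>) \<le> ennreal (max C 0)" if "norm x \<le> R" for x
    using C[OF that] by (simp add: powr_powr)
  thus ?thesis using that[OF r, of "max C 0"] by auto
qed

lemma integrable_norm_powr_minus_1: "integrable \<mu> (\<lambda>v. norm (x - v) powr (q - 1))"
proof -
  obtain r C where r: "1 < r" and "\<And>z. norm z \<le> norm x \<Longrightarrow>
    (\<integral>\<^sup>+v. ennreal ((norm (z - v) powr (q - 1)) powr r) \<partial>\<mu>) \<le> ennreal C"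
    using kernel_moment_bound by blast
  thus ?thesis
    using bounded_moment_convergence(1)[OF prob_space_axioms r, of "\<lambda>_ v. norm (x - v) powr (q - 1)"
        "\<lambda>v. norm (x - v) powr (q - 1)" C]
    by simp
qed

lemma integrable_grad_ker: "integrable \<mu> (\<lambda>v. grad_ker q (x - v))"
proof (rule Bochner_Integration.integrable_bound)
  show "integrable \<mu> (\<lambda>v. q * norm (x - v) powr (q - 1))"
    using integrable_norm_powr_minus_1 by simp
qed (use q in \<open>auto simp: norm_grad_ker\<close>)

lemma norm_powr_minus_1_integral_bound:
  obtains C where "0 \<le> C" "\<And>x. norm x \<le> R \<Longrightarrow> (\<integral>v. norm (x - v) powr (q - 1) \<partial>\<mu>) \<le> C"
proof -
  obtain r C where r: "1 < r" and C: "0 \<le> C" "\<And>x. norm x \<le> R \<Longrightarrow>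
    (\<integral>\<^sup>+v. ennreal ((norm (x - v) powr (q - 1)) powr r) \<partial>\<mu>) \<le> ennreal C"
      using kernel_moment_bound by blast
  have "(\<integral>v. norm (x - v) powr (q - 1) \<partial>\<mu>) \<le> 1 + C" if "norm x \<le> R" for x
  proof -
    have le: "z \<le> 1 + z powr r" if "0 \<le> z" for z :: real
    proof (cases "z \<le> 1")
      case False
      hence "z powr 1 \<le> z powr r" using r by (intro powr_mono) auto
      thus ?thesis using False by simp
    qed (simp add: add_increasing2)
    have "ennreal (\<integral>v. norm (x - v) powr (q - 1) \<partial>\<mu>) = (\<integral>\<^sup>+v. ennreal (norm (x - v) powr (q - 1)) \<partial>\<mu>)"
      using integrable_norm_powr_minus_1 by (intro nn_integral_eq_integral[symmetric]) auto
    also have "\<dots> \<le> (\<integral>\<^sup>+v. 1 + ennreal ((norm (x - v) powr (q - 1)) powr r) \<partial>\<mu>)"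
    proof (intro nn_integral_mono)
      fix v
      have "ennreal (norm (x - v) powr (q - 1)) \<le> ennreal (1 + (norm (x - v) powr (q - 1)) powr r)"
        by (intro ennreal_leI le) auto
      thus "ennreal (norm (x - v) powr (q - 1)) \<le> 1 + ennreal ((norm (x - v) powr (q - 1)) powr r)"
        by simp
    qed
    also have "\<dots> = 1 + (\<integral>\<^sup>+v. ennreal ((norm (x - v) powr (q - 1)) powr r) \<partial>\<mu>)"
      using emeasure_space_1 by (subst nn_integral_add) auto
    also have "\<dots> \<le> 1 + ennreal C" by (intro add_left_mono C(2) that)
    also have "\<dots> = ennreal (1 + C)" using C(1) by simp
    finally show ?thesis using C(1) by (subst (asm) ennreal_le_iff) auto
  qed
  thus ?thesis using that[of "1 + C"] C(1) by auto
qed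

text \<open>
  The kernels converge pointwise except at \<open>v = x\<close>, which is no atom, and are bounded in some \<open>L\<^sup>r\<close> with \<open>r > 1\<close>.
\<close>
lemma continuous_drift: "isCont drift x"
proof -
  have "(\<lambda>n. drift (S n)) \<longlonglongrightarrow> drift x" if S: "S \<longlonglongrightarrow> x" for S
  proof -
    obtain R where R: "\<And>n. norm (S n) \<le> R"
      using convergent_imp_Bseq[OF convergentI[OF S]] unfolding Bseq_def by blast
    obtain r C where r: "1 < r" and C: "0 \<le> C" "\<And>x. norm x \<le> R \<Longrightarrow>
      (\<integral>\<^sup>+v. ennreal ((norm (x - v) powr (q - 1)) powr r) \<partial>\<mu>) \<le> ennreal C"
      using kernel_moment_bound by blast
    show ?thesis unfolding drift_def
    proof (rule bounded_moment_convergence(3)[OF prob_space_axioms r])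
      show "AE v in \<mu>. (\<lambda>n. grad_ker q (S n - v)) \<longlonglongrightarrow> grad_ker q (x - v)"
        using AE_target_neq[of x]
      proof eventually_elim
        case (elim v)
        hence "isCont (grad_ker q) (x - v)" by (intro isCont_grad_ker) auto
        thus ?case by (rule isCont_tendsto_compose) (intro tendsto_intros S)
      qed
      fix n
      have "(\<integral>\<^sup>+v. ennreal (norm (grad_ker q (S n - v)) powr r) \<partial>\<mu>)
          = (\<integral>\<^sup>+v. ennreal (q powr r) * ennreal ((norm (S n - v) powr (q - 1)) powr r) \<partial>\<mu>)"
        using q by (simp add: norm_grad_ker powr_mult ennreal_mult)
      also have "\<dots> = ennreal (q powr r) * (\<integral>\<^sup>+v. ennreal ((norm (S n - v) powr (q - 1)) powr r) \<partial>\<mu>)"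
        by (rule nn_integral_cmult) measurable
      also have "\<dots> \<le> ennreal (q powr r) * ennreal C"
        by (intro mult_left_mono C(2) R) auto
      also have "\<dots> = ennreal (q powr r * C)" using C(1) by (simp add: ennreal_mult)
      finally show "(\<integral>\<^sup>+v. ennreal (norm (grad_ker q (S n - v)) powr r) \<partial>\<mu>) \<le> ennreal (q powr r * C)" .
    qed measurable
  qed
  thus ?thesis by (simp add: continuous_at_sequentially comp_def)
qed

text \<open>
  The difference quotients are bounded by a multiple of the kernel at the two points,
  hence bounded in some \<open>L\<^sup>r\<close> with \<open>r > 1\<close>, and converge at every point other than \<open>x\<close>.
\<close>
lemma has_derivative_potential: "(potential has_derivative (\<lambda>h. - (drift x \<bullet> h))) (at x)"
  unfolding has_derivative_at
proof
  show "bounded_linear (\<lambda>h. - (drift x \<bullet> h))"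
    by (intro bounded_linear_minus bounded_linear_inner_right)
  show "(\<lambda>h. norm (potential (x + h) - potential x - - (drift x \<bullet> h)) / norm h) \<midarrow>0\<rightarrow> 0"
    unfolding LIMSEQ_SEQ_conv[symmetric]
  proof (intro allI impI, elim conjE)
    fix S :: "nat \<Rightarrow> 'a" assume S: "\<forall>n. S n \<noteq> 0" "S \<longlonglongrightarrow> 0"
    define f where "f n v = (norm (x + S n - v) powr q - norm (x - v) powr q + grad_ker q (x - v) \<bullet> S n) / norm (S n)" for n v
    obtain R where R: "\<And>n. norm (S n) \<le> R"
      using convergent_imp_Bseq[OF convergentI[OF S(2)]] unfolding Bseq_def by blast
    obtain r C where r: "1 < r" and C: "0 \<le> C" "\<And>z. norm z \<le> norm x + R \<Longrightarrow>
      (\<integral>\<^sup>+v. ennreal ((norm (z - v) powr (q - 1)) powr r) \<partial>\<mu>) \<le> ennreal C"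
      using kernel_moment_bound by blast
    have RR: "norm x \<le> norm x + R" "norm (x + S n) \<le> norm x + R" for n
      using order_trans[OF norm_ge_zero R[of n]] R[of n] norm_triangle_ineq[of x "S n"] by linarith+
    have f_le: "\<bar>f n v\<bar> powr r \<le> 8 powr r * ((norm (x + S n - v) powr (q - 1)) powr r + (norm (x - v) powr (q - 1)) powr r)" for n v
    proof -
      define A where "A = norm (x + S n - v) powr (q - 1)"
      define B where "B = norm (x - v) powr (q - 1)"
      have AB: "0 \<le> A" "0 \<le> B" by (auto simp: A_def B_def)
      have h: "0 < norm (S n)" using S by simp
      have "\<bar>norm (x + S n - v) powr q - norm (x - v) powr q\<bar> \<le> 2 * \<bar>norm (x + S n - v) - norm (x - v)\<bar> * (A + B)"
        unfolding A_def B_def using q by (intro powr_diff_le) auto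
      also have "\<dots> \<le> 2 * norm (S n) * (A + B)"
        using norm_triangle_ineq3[of "x + S n - v" "x - v"] AB
        by (intro mult_right_mono mult_left_mono) (auto simp: algebra_simps)
      finally have 1: "\<bar>norm (x + S n - v) powr q - norm (x - v) powr q\<bar> \<le> 2 * norm (S n) * (A + B)" .
      have "\<bar>grad_ker q (x - v) \<bullet> S n\<bar> \<le> q * B * norm (S n)"
        using Cauchy_Schwarz_ineq2[of "grad_ker q (x - v)" "S n"] q by (simp add: norm_grad_ker B_def)
      also have "\<dots> \<le> 2 * B * norm (S n)" using q AB by (intro mult_right_mono) auto
      finally have "\<bar>grad_ker q (x - v) \<bullet> S n\<bar> \<le> 2 * B * norm (S n)" .
      with 1 have "\<bar>norm (x + S n - v) powr q - norm (x - v) powr q + grad_ker q (x - v) \<bullet> S n\<bar> \<le> (2 * A + 4 * B) * norm (S n)"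
        by (simp add: algebra_simps)
      hence "\<bar>f n v\<bar> \<le> 2 * A + 4 * B"
        using h by (simp add: f_def pos_divide_le_eq)
      also have "\<dots> \<le> 8 * max A B" using AB by (simp add: max_def)
      finally have "\<bar>f n v\<bar> powr r \<le> (8 * max A B) powr r" using r by (intro powr_mono2) auto
      also have "\<dots> = 8 powr r * max A B powr r" by (rule powr_mult)
      also have "\<dots> \<le> 8 powr r * (A powr r + B powr r)" by (intro mult_left_mono) (auto simp: max_def)
      finally show ?thesis by (simp add: A_def B_def)
    qed
    have f_meas [measurable]: "f n \<in> borel_measurable \<mu>" for n
      unfolding f_def by measurable
    have "(\<lambda>n. \<integral>v. f n v \<partial>\<mu>) \<longlonglongrightarrow> (\<integral>v. 0 \<partial>\<mu>)"
    proof (rule bounded_moment_convergence(3)[OF prob_space_axioms r])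
      show "AE v in \<mu>. (\<lambda>n. f n v) \<longlonglongrightarrow> 0"
        using AE_target_neq[of x]
      proof eventually_elim
        case (elim v)
        hence "((\<lambda>z. norm z powr q) has_derivative (\<lambda>h. - (grad_ker q (x - v) \<bullet> h))) (at (x - v))"
          by (intro has_derivative_norm_powr) auto
        hence "(\<lambda>h. norm (norm (x - v + h) powr q - norm (x - v) powr q - - (grad_ker q (x - v) \<bullet> h)) / norm h) \<midarrow>0\<rightarrow> 0"
          by (simp add: has_derivative_at)
        hence "(\<lambda>n. norm (norm (x - v + S n) powr q - norm (x - v) powr q - - (grad_ker q (x - v) \<bullet> S n)) / norm (S n)) \<longlonglongrightarrow> 0"
          unfolding LIMSEQ_SEQ_conv[symmetric] using S by blast
        hence "(\<lambda>n. norm (f n v)) \<longlonglongrightarrow> 0"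
          by (simp add: f_def algebra_simps)
        thus ?case by (rule tendsto_norm_zero_cancel)
      qed
      fix n
      have "(\<integral>\<^sup>+v. ennreal (norm (f n v) powr r) \<partial>\<mu>)
          \<le> (\<integral>\<^sup>+v. ennreal (8 powr r) * (ennreal ((norm (x + S n - v) powr (q - 1)) powr r) + ennreal ((norm (x - v) powr (q - 1)) powr r)) \<partial>\<mu>)"
        using f_le by (intro nn_integral_mono) (auto simp: ennreal_leI simp flip: ennreal_plus ennreal_mult)
      also have "\<dots> = ennreal (8 powr r) * ((\<integral>\<^sup>+v. ennreal ((norm (x + S n - v) powr (q - 1)) powr r) \<partial>\<mu>)
            + (\<integral>\<^sup>+v. ennreal ((norm (x - v) powr (q - 1)) powr r) \<partial>\<mu>))"
        by (simp add: nn_integral_cmult nn_integral_add)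
      also have "\<dots> \<le> ennreal (8 powr r) * (ennreal C + ennreal C)"
        by (intro mult_left_mono add_mono C(2) RR) auto
      also have "\<dots> = ennreal (8 powr r * (C + C))"
        using C(1) by (subst ennreal_mult) (auto simp only: ennreal_plus powr_ge_zero add_nonneg_nonneg)
      finally show "(\<integral>\<^sup>+v. ennreal (norm (f n v) powr r) \<partial>\<mu>) \<le> ennreal (8 powr r * (C + C))" .
    qed auto
    moreover have "(\<integral>v. f n v \<partial>\<mu>) = (potential (x + S n) - potential x - - (drift x \<bullet> S n)) / norm (S n)" for n
    proof -
      have "(\<integral>v. grad_ker q (x - v) \<bullet> S n \<partial>\<mu>) = drift x \<bullet> S n"
        unfolding drift_def using integrable_grad_ker by (rule integral_inner_left)
      thus ?thesis
        unfolding f_def potential_def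
        using integrable_norm_powr integrable_grad_ker by (simp add: integrable_inner_left)
    qed
    ultimately have "(\<lambda>n. (potential (x + S n) - potential x - - (drift x \<bullet> S n)) / norm (S n)) \<longlonglongrightarrow> 0"
      by simp
    from tendsto_norm_zero[OF this]
    show "(\<lambda>n. norm (potential (x + S n) - potential x - - (drift x \<bullet> S n)) / norm (S n)) \<longlonglongrightarrow> 0"
      by simp
  qed
qed

lemma continuous_potential: "isCont potential x"
  using has_derivative_potential has_derivative_continuous by blast

text \<open>
  For \<open>q > 1\<close> the quotients of kernel differences by \<open>\<bar>a - b\<bar> powr (q - 1)\<close> are bounded by Hoelder continuity, and tend to zero
  except at \<open>v = x\<close>, which is no atom.
\<close>
lemma drift_modulus:
  assumes e: "0 < e"
  obtains d where "0 < d" "\<And>a b. dist a x < d \<Longrightarrow> dist b x < d \<Longrightarrow> a \<noteq> b \<Longrightarrow>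
    norm (drift a - drift b) \<le> e * norm (a - b) powr (q - 1)"
proof (cases "q \<le> 1")
  case True
  show ?thesis
    by (rule isCont_modulus[OF continuous_drift True e]) (rule that)
next
  case False
  have "\<exists>d>0. \<forall>a b. dist a x < d \<longrightarrow> dist b x < d \<longrightarrow> a \<noteq> b \<longrightarrow>
    norm (drift a - drift b) \<le> e * norm (a - b) powr (q - 1)"
  proof (rule ccontr)
    assume neg: "\<not> ?thesis"
    have "\<exists>a b. dist a x < 1 / real (Suc n) \<and> dist b x < 1 / real (Suc n) \<and> a \<noteq> b \<and>
        \<not> norm (drift a - drift b) \<le> e * norm (a - b) powr (q - 1)" for n
      using neg by (metis of_nat_0_less_iff zero_less_Suc zero_less_divide_1_iff)
    then obtain a b where ab: "\<And>n. dist (a n) x < 1 / real (Suc n)" "\<And>n. dist (b n) x < 1 / real (Suc n)"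
      "\<And>n. a n \<noteq> b n" "\<And>n. e * norm (a n - b n) powr (q - 1) < norm (drift (a n) - drift (b n))"
      by (metis not_le)
    have a: "a \<longlonglongrightarrow> x" and b: "b \<longlonglongrightarrow> x" using ab(1,2) by (auto intro: LIMSEQ_of_dist_less)
    define h where "h n = norm (a n - b n)" for n
    have h: "0 < h n" for n using ab(3) by (simp add: h_def)
    have h_lim: "h \<longlonglongrightarrow> 0"
      unfolding h_def using tendsto_diff[OF a b] by (intro tendsto_norm_zero) simp
    define f where "f n v = (1 / h n powr (q - 1)) *\<^sub>R (grad_ker q (a n - v) - grad_ker q (b n - v))" for n v
    have "(\<lambda>n. \<integral>v. f n v \<partial>\<mu>) \<longlonglongrightarrow> (\<integral>v. 0 \<partial>\<mu>)"
    proof (rule integral_dominated_convergence[where w = "\<lambda>_. 8"])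
      show "AE v in \<mu>. norm (f n v) \<le> 8" for n
      proof (rule AE_I2)
        fix v
        have "norm (grad_ker q (a n - v) - grad_ker q (b n - v)) \<le> 8 * h n powr (q - 1)"
          using grad_ker_holder[of q "a n - v" "b n - v"] False q by (simp add: h_def)
        thus "norm (f n v) \<le> 8" unfolding f_def norm_scaleR using h[of n] by (simp add: field_simps)
      qed
      show "AE v in \<mu>. (\<lambda>n. f n v) \<longlonglongrightarrow> 0"
        using AE_target_neq[of x]
      proof eventually_elim
        case (elim v)
        have bound: "norm (f n v) \<le> 2 * q * max (norm (a n - v)) (norm (b n - v)) powr (q - 2) * h n powr (2 - q)" for n
        proof -
          have "norm (f n v) \<le> (1 / h n powr (q - 1)) * (2 * q * max (norm (a n - v)) (norm (b n - v)) powr (q - 2) * h n)"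
            unfolding f_def norm_scaleR using grad_ker_diff_le[of q "a n - v" "b n - v"] False q
            by (intro mult_mono) (auto simp: h_def)
          also have "\<dots> = 2 * q * max (norm (a n - v)) (norm (b n - v)) powr (q - 2) * (h n / h n powr (q - 1))"
            by simp
          also have "h n / h n powr (q - 1) = h n powr (2 - q)"
            using powr_diff[of "h n" 1 "q - 1"] h[of n] by simp
          finally show ?thesis .
        qed
        have "(\<lambda>n. 2 * q * max (norm (a n - v)) (norm (b n - v)) powr (q - 2) * h n powr (2 - q))
            \<longlonglongrightarrow> 2 * q * max (norm (x - v)) (norm (x - v)) powr (q - 2) * 0 powr (2 - q)"
          using elim q h
          by (intro tendsto_intros a b h_lim tendsto_powr'[OF h_lim]) (auto intro: always_eventually less_imp_le)
        hence lim: "(\<lambda>n. 2 * q * max (norm (a n - v)) (norm (b n - v)) powr (q - 2) * h n powr (2 - q)) \<longlonglongrightarrow> 0"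
          using q by simp
        show ?case
          by (rule Lim_null_comparison[OF _ lim]) (use bound in simp)
      qed
    qed (auto simp: f_def)
    moreover have "(\<integral>v. f n v \<partial>\<mu>) = (1 / h n powr (q - 1)) *\<^sub>R (drift (a n) - drift (b n))" for n
      unfolding f_def drift_def using integrable_grad_ker by simp
    ultimately have "(\<lambda>n. (1 / h n powr (q - 1)) *\<^sub>R (drift (a n) - drift (b n))) \<longlonglongrightarrow> 0"
      by simp
    then obtain n where "norm ((1 / h n powr (q - 1)) *\<^sub>R (drift (a n) - drift (b n))) < e"
      using LIMSEQ_D[of _ 0 e] e by force
    hence "norm (drift (a n) - drift (b n)) < e * h n powr (q - 1)"
      using h[of n] unfolding norm_scaleR by (simp add: field_simps)
    thus False using ab(4)[of n] by (simp add: h_def)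
  qed
  thus ?thesis using that by blast
qed

end

section \<open>The particle energy\<close>

lemma integral_empirical:
  fixes h :: "'a::euclidean_space \<Rightarrow> 'b::{banach, second_countable_topology}"
  assumes [measurable]: "h \<in> borel_measurable borel"
  shows "(\<integral>v. h v \<partial>empirical N x) = (1 / real N) *\<^sub>R (\<Sum>i\<in>{1..N}. h (x i))"
proof -
  have "x \<in> measurable (uniform_count_measure {1..N}) borel"
    by (auto simp: measurable_def space_uniform_count_measure sets_uniform_count_measure)
  thus ?thesis
    unfolding empirical_def
    by (subst integral_distr)
       (auto simp: uniform_count_measure_def lebesgue_integral_point_measure_finite scaleR_sum_right)
qed

lemma prob_space_empirical:
  assumes "0 < N"
  shows "prob_space (empirical N x)"
  unfolding empirical_def
  using assms by (intro prob_space.prob_space_distr prob_space_uniform_count_measure)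
    (auto simp: measurable_def space_uniform_count_measure sets_uniform_count_measure)

lemma sets_empirical [simp, measurable_cong]: "sets (empirical N x) = sets borel"
  by (simp add: empirical_def)

definition pair_sum :: "real \<Rightarrow> nat \<Rightarrow> (nat \<Rightarrow> 'a::real_normed_vector) \<Rightarrow> real" where
  "pair_sum s N x = (\<Sum>i\<in>{1..N}. \<Sum>j\<in>{1..N}. norm (x i - x j) powr s)"

context regular_target
begin

lemma particle_energy_eq:
  assumes N: "0 < N"
  shows "particle_energy q \<mu> N x =
    (- (1 / real N ^ 2) * pair_sum q N x + (2 / real N) * (\<Sum>i\<in>{1..N}. potential (x i))
      - (\<integral>u. potential u \<partial>\<mu>)) / 2"
proof -
  define P where "P = (\<Sum>i\<in>{1..N}. potential (x i))"
  have inner: "integral_diff (empirical N x) \<mu> (\<lambda>v. ker q (u - v))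
      = - (1 / real N) * (\<Sum>j\<in>{1..N}. norm (u - x j) powr q) + potential u" for u
  proof -
    have "(\<lambda>v. ker q (u - v)) \<in> borel_measurable borel" unfolding ker_def by measurable
    from integral_empirical[OF this, of N x] show ?thesis
      by (simp add: integral_diff_def ker_def potential_def sum_negf)
  qed
  have "(\<lambda>u. - (1 / real N) * (\<Sum>j\<in>{1..N}. norm (u - x j) powr q) + potential u) \<in> borel_measurable borel"
    by measurable
  from integral_empirical[OF this, of N x]
  have 1: "(\<integral>u. - (1 / real N) * (\<Sum>j\<in>{1..N}. norm (u - x j) powr q) + potential u \<partial>empirical N x)
    = (1 / real N) * (- (1 / real N) * pair_sum q N x + P)"
    unfolding pair_sum_def P_def real_scaleR_def by (simp only: sum.distrib sum_distrib_left)
  have comm: "(\<integral>u. norm (u - z) powr q \<partial>\<mu>) = potential z" for z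
    by (simp add: potential_def norm_minus_commute)
  have 2: "(\<integral>u. - (1 / real N) * (\<Sum>j\<in>{1..N}. norm (u - x j) powr q) + potential u \<partial>\<mu>)
      = - (1 / real N) * P + (\<integral>u. potential u \<partial>\<mu>)"
  proof -
    have i: "integrable \<mu> (\<lambda>u. norm (u - x j) powr q)" for j
      using integrable_norm_powr[of "x j"] by (simp add: norm_minus_commute)
    thus ?thesis using integrable_potential by (simp add: P_def comm)
  qed
  show ?thesis
    unfolding particle_energy_def inner
    unfolding integral_diff_def 1 2 P_def[symmetric]
    using N by (simp add: field_simps power2_eq_square)
qed

text \<open>
  Up to sign, twice the energy is the conditionally negative definite form at the neutral measure
  \<open>\<rho> - \<mu>\<close>, where \<open>\<rho>\<close> is the empirical measure.
\<close>
lemma particle_energy_nonneg: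
  assumes N: "0 < N"
  shows "0 \<le> particle_energy q \<mu> N x"
proof -
  have "(\<Sum>i\<in>{1..N}. 1 / real N) = 1" using N by simp
  from energy_distance_nonneg[OF q prob_space_axioms sets_target moment _ this, of x]
  have "(1 / real N ^ 2) * pair_sum q N x + (\<integral>u. potential u \<partial>\<mu>) \<le> (2 / real N) * (\<Sum>i\<in>{1..N}. potential (x i))"
    by (simp add: pair_sum_def potential_def sum_distrib_left power2_eq_square sum_divide_distrib)
  thus ?thesis using particle_energy_eq[OF N, of x] by simp
qed

end


section \<open>Dissipation and omega-limits\<close>

lemma sum_grad_ker_antisym:
  fixes x :: "'i \<Rightarrow> 'a::euclidean_space"
  shows "(\<Sum>i\<in>S. \<Sum>j\<in>S. grad_ker q (x i - x j)) = 0"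
proof -
  have "(\<Sum>i\<in>S. \<Sum>j\<in>S. grad_ker q (x i - x j)) = (\<Sum>j\<in>S. \<Sum>i\<in>S. grad_ker q (x i - x j))"
    by (rule sum.swap)
  also have "\<dots> = - (\<Sum>i\<in>S. \<Sum>j\<in>S. grad_ker q (x i - x j))"
    by (subst grad_ker_commute) (simp add: sum_negf)
  finally have "2 *\<^sub>R (\<Sum>i\<in>S. \<Sum>j\<in>S. grad_ker q (x i - x j)) = 0"
    by (simp only: scaleR_2 eq_neg_iff_add_eq_0)
  thus ?thesis by simp
qed

lemma sum_grad_ker_symmetrize:
  fixes x w :: "'i \<Rightarrow> 'a::euclidean_space"
  shows "(\<Sum>i\<in>S. \<Sum>j\<in>S. grad_ker q (x i - x j) \<bullet> (w i - w j))
    = 2 * (\<Sum>i\<in>S. (\<Sum>j\<in>S. grad_ker q (x i - x j)) \<bullet> w i)"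
proof -
  have "(\<Sum>i\<in>S. \<Sum>j\<in>S. grad_ker q (x i - x j) \<bullet> w j) = (\<Sum>j\<in>S. \<Sum>i\<in>S. grad_ker q (x i - x j) \<bullet> w j)"
    by (rule sum.swap)
  also have "\<dots> = - (\<Sum>i\<in>S. \<Sum>j\<in>S. grad_ker q (x i - x j) \<bullet> w i)"
    by (subst grad_ker_commute) (simp add: sum_negf)
  finally show ?thesis
    by (simp add: inner_diff_right sum_subtractf inner_sum_left)
qed

lemma sum_grad_ker_virial:
  fixes x :: "'i \<Rightarrow> 'a::euclidean_space"
  shows "(\<Sum>i\<in>S. (\<Sum>j\<in>S. grad_ker q (x i - x j)) \<bullet> x i)
    = - (q / 2) * (\<Sum>i\<in>S. \<Sum>j\<in>S. norm (x i - x j) powr q)"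
proof -
  have "- q * (\<Sum>i\<in>S. \<Sum>j\<in>S. norm (x i - x j) powr q) = 2 * (\<Sum>i\<in>S. (\<Sum>j\<in>S. grad_ker q (x i - x j)) \<bullet> x i)"
    using sum_grad_ker_symmetrize[of q x x S]
    by (simp only: grad_ker_inner sum_distrib_left[symmetric])
  thus ?thesis by simp
qed

lemma has_real_derivative_along:
  fixes f :: "'a::real_normed_vector \<Rightarrow> real"
  assumes f: "(f has_derivative D) (at (g t))" and g: "(g has_vector_derivative v) (at t within S)"
  shows "((\<lambda>s. f (g s)) has_real_derivative D v) (at t within S)"
proof -
  have "((\<lambda>s. f (g s)) has_derivative (\<lambda>h. D (h *\<^sub>R v))) (at t within S)"
    using g f unfolding has_vector_derivative_def by (rule has_derivative_compose)
  moreover have "D (h *\<^sub>R v) = D v * h" for h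
    using linear_scale[OF has_derivative_linear[OF f]] by simp
  ultimately show ?thesis by (simp add: has_field_derivative_def)
qed

lemma mean_value_nonneg_axis:
  fixes f :: "real \<Rightarrow> real"
  assumes "0 \<le> a" "a \<le> b"
    and f: "\<And>t. 0 \<le> t \<Longrightarrow> (f has_real_derivative f' t) (at t within {0..})"
  obtains c where "a \<le> c" "c \<le> b" "f b - f a = f' c * (b - a)"
proof -
  have "(f has_derivative (*) (f' t)) (at t within {a..b})" if "a \<le> t" "t \<le> b" for t
    using has_field_derivative_subset[OF f[of t], of "{a..b}"] assms that
    by (auto simp: has_field_derivative_def)
  from mvt_very_simple[OF assms(2) this] that show ?thesis by auto
qed

context regular_target
begin

lemma particle_velocity_eq:
  assumes "i \<in> {1..N}"
  shows "particle_velocity q \<mu> N x i = - (1 / real N) *\<^sub>R (\<Sum>j\<in>{1..N}. grad_ker q (x i - x j)) + drift (x i)"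
proof -
  have "(\<Sum>j\<in>{1..N}. grad_ker q (x i - x j)) = grad_ker q (x i - x i) + (\<Sum>j\<in>{1..N} - {i}. grad_ker q (x i - x j))"
    using assms by (intro sum.remove) auto
  thus ?thesis by (simp add: particle_velocity_def drift_def)
qed

lemma tendsto_particle_velocity:
  assumes Y: "Y \<in> collision_free N" and i: "i \<in> {1..N}"
    and z: "\<And>j. j \<in> {1..N} \<Longrightarrow> ((\<lambda>n. z n j) \<longlongrightarrow> Y j) F"
  shows "((\<lambda>n. particle_velocity q \<mu> N (z n) i) \<longlongrightarrow> particle_velocity q \<mu> N Y i) F"
proof -
  have "((\<lambda>n. grad_ker q (z n i - z n j)) \<longlongrightarrow> grad_ker q (Y i - Y j)) F" if "j \<in> {1..N} - {i}" for j
  proof (rule isCont_tendsto_compose[where g = "grad_ker q"])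
    show "isCont (grad_ker q) (Y i - Y j)"
      using Y i that by (intro isCont_grad_ker) (auto simp: collision_free_def)
  qed (use that i z in \<open>auto intro!: tendsto_intros\<close>)
  moreover have "((\<lambda>n. drift (z n i)) \<longlongrightarrow> drift (Y i)) F"
    using continuous_drift z[OF i] by (rule isCont_tendsto_compose)
  ultimately show ?thesis
    unfolding particle_velocity_def drift_def[symmetric]
    by (intro tendsto_intros) auto
qed

lemma tendsto_particle_energy:
  assumes N: "0 < N" and z: "\<And>j. j \<in> {1..N} \<Longrightarrow> ((\<lambda>n. z n j) \<longlongrightarrow> Y j) F"
  shows "((\<lambda>n. particle_energy q \<mu> N (z n)) \<longlongrightarrow> particle_energy q \<mu> N Y) F"
  unfolding particle_energy_eq[OF N] pair_sum_def using z q(1) N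
  by (auto intro!: tendsto_intros tendsto_norm_powr isCont_tendsto_compose[OF continuous_potential])

end

locale particle_flow = regular_target +
  fixes N :: nat and X0 :: "nat \<Rightarrow> 'a" and X :: "real \<Rightarrow> nat \<Rightarrow> 'a"
  assumes N: "2 \<le> N" and solution: "global_solution q \<mu> N X0 X"
begin

abbreviation vel :: "real \<Rightarrow> nat \<Rightarrow> 'a" where
  "vel t i \<equiv> particle_velocity q \<mu> N (X t) i"

abbreviation energy :: "real \<Rightarrow> real" where
  "energy t \<equiv> particle_energy q \<mu> N (X t)"

lemma N_pos: "0 < N" using N by simp

lemma X_derivative:
  assumes "i \<in> {1..N}" "0 \<le> t"
  shows "((\<lambda>s. X s i) has_vector_derivative vel t i) (at t within {0..})"
  using solution assms by (auto simp: global_solution_def)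

lemma X_collision_free: "0 \<le> t \<Longrightarrow> X t \<in> collision_free N"
  using solution by (auto simp: global_solution_def)

text \<open>
  The system is a gradient flow: the derivative of the energy in the position of the \<open>i\<close>-th particle is
  \<open>- 1 / N\<close> times the velocity of that particle.
\<close>
lemma energy_dissipation:
  assumes t: "0 \<le> t"
  shows "(energy has_real_derivative (- (1 / real N) * (\<Sum>i\<in>{1..N}. (norm (vel t i))\<^sup>2))) (at t within {0..})"
proof -
  define G where "G i = (\<Sum>j\<in>{1..N}. grad_ker q (X t i - X t j))" for i
  have pair: "((\<lambda>s. norm (X s i - X s j) powr q) has_real_derivative - (grad_ker q (X t i - X t j) \<bullet> (vel t i - vel t j))) (at t within {0..})"
    if ij: "i \<in> {1..N}" "j \<in> {1..N}" for i j
  proof (cases "i = j")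
    case False
    hence "X t i - X t j \<noteq> 0" using X_collision_free[OF t] ij by (auto simp: collision_free_def)
    from has_derivative_norm_powr[OF this, of q]
    show ?thesis
      by (rule has_real_derivative_along) (intro has_vector_derivative_diff X_derivative ij t)
  qed simp
  have pot: "((\<lambda>s. potential (X s i)) has_real_derivative - (drift (X t i) \<bullet> vel t i)) (at t within {0..})"
    if "i \<in> {1..N}" for i
    using has_derivative_potential X_derivative[OF that t] by (rule has_real_derivative_along)
  have "((\<lambda>s. pair_sum q N (X s)) has_real_derivative (\<Sum>i\<in>{1..N}. \<Sum>j\<in>{1..N}. - (grad_ker q (X t i - X t j) \<bullet> (vel t i - vel t j)))) (at t within {0..})"
    unfolding pair_sum_def by (intro DERIV_sum pair)
  also have "(\<Sum>i\<in>{1..N}. \<Sum>j\<in>{1..N}. - (grad_ker q (X t i - X t j) \<bullet> (vel t i - vel t j))) = - 2 * (\<Sum>i\<in>{1..N}. G i \<bullet> vel t i)"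
    using sum_grad_ker_symmetrize[of q "X t" "vel t" "{1..N}"] by (simp add: sum_negf G_def)
  finally have P: "((\<lambda>s. pair_sum q N (X s)) has_real_derivative - 2 * (\<Sum>i\<in>{1..N}. G i \<bullet> vel t i)) (at t within {0..})" .
  have Q: "((\<lambda>s. \<Sum>i\<in>{1..N}. potential (X s i)) has_real_derivative (\<Sum>i\<in>{1..N}. - (drift (X t i) \<bullet> vel t i))) (at t within {0..})"
    by (intro DERIV_sum pot)
  have "((\<lambda>s. (- (1 / real N ^ 2) * pair_sum q N (X s) + (2 / real N) * (\<Sum>i\<in>{1..N}. potential (X s i))
      - (\<integral>u. potential u \<partial>\<mu>)) / 2) has_real_derivative
      (- (1 / real N ^ 2) * (- 2 * (\<Sum>i\<in>{1..N}. G i \<bullet> vel t i)) + (2 / real N) * (\<Sum>i\<in>{1..N}. - (drift (X t i) \<bullet> vel t i)) - 0) / 2) (at t within {0..})"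
    by (intro DERIV_cdivide DERIV_diff DERIV_add DERIV_cmult P Q DERIV_const)
  moreover have "(- (1 / real N ^ 2) * (- 2 * (\<Sum>i\<in>{1..N}. G i \<bullet> vel t i)) + (2 / real N) * (\<Sum>i\<in>{1..N}. - (drift (X t i) \<bullet> vel t i)) - 0) / 2
      = - (1 / real N) * (\<Sum>i\<in>{1..N}. (norm (vel t i))\<^sup>2)"
  proof -
    have "(norm (vel t i))\<^sup>2 = - (1 / real N) * (G i \<bullet> vel t i) + drift (X t i) \<bullet> vel t i" if "i \<in> {1..N}" for i
    proof -
      have "(norm (vel t i))\<^sup>2 = (- (1 / real N) *\<^sub>R G i + drift (X t i)) \<bullet> vel t i"
        unfolding power2_norm_eq_inner G_def by (simp only: particle_velocity_eq[OF that, symmetric])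
      thus ?thesis by (simp add: inner_add_left inner_diff_left)
    qed
    hence S: "(\<Sum>i\<in>{1..N}. (norm (vel t i))\<^sup>2) = - (1 / real N) * (\<Sum>i\<in>{1..N}. G i \<bullet> vel t i) + (\<Sum>i\<in>{1..N}. drift (X t i) \<bullet> vel t i)"
      by (simp add: sum.distrib sum_distrib_left sum_negf sum_subtractf)
    show ?thesis unfolding S sum_negf using N_pos by (simp add: field_simps power2_eq_square)
  qed
  ultimately show ?thesis by (simp add: particle_energy_eq[OF N_pos])
qed

lemma energy_decreasing:
  assumes "0 \<le> s" "s \<le> t"
  shows "energy t \<le> energy s"
proof -
  obtain c where c: "s \<le> c" "energy t - energy s = - (1 / real N) * (\<Sum>i\<in>{1..N}. (norm (vel c i))\<^sup>2) * (t - s)"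
    using mean_value_nonneg_axis[OF assms energy_dissipation] by blast
  have "0 \<le> (1 / real N) * (\<Sum>i\<in>{1..N}. (norm (vel c i))\<^sup>2) * (t - s)"
    using assms by (intro mult_nonneg_nonneg sum_nonneg) auto
  with c show ?thesis by simp
qed

text \<open>
  With \<open>u = X t i - X s i\<close> the quantity \<open>u \<bullet> X \<tau> i + l * energy \<tau> - N \<bar>u\<bar>\<^sup>2 \<tau> / (4 l)\<close> is nonincreasing
  in \<open>\<tau>\<close>; \<open>l = (t - s) N / 2\<close> is the best weight. This replaces the Cauchy-Schwarz
  inequality for the integral of the velocity.
\<close>
lemma displacement_le_energy_drop:
  assumes st: "0 \<le> s" "s \<le> t" and i: "i \<in> {1..N}"
  shows "(norm (X t i - X s i))\<^sup>2 \<le> real N * (t - s) * (energy s - energy t)"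
proof (cases "s = t")
  case False
  define u where "u = X t i - X s i"
  define dt where "dt = t - s"
  have dt: "0 < dt" using st False by (simp add: dt_def)
  define l where "l = dt * real N / 2"
  have l: "0 < l" using dt N_pos by (simp add: l_def)
  define c0 where "c0 = real N * (norm u)\<^sup>2 / (4 * l)"
  define H where "H r = u \<bullet> X r i + l * energy r - c0 * r" for r
  have H: "(H has_real_derivative (u \<bullet> vel r i + l * (- (1 / real N) * (\<Sum>i\<in>{1..N}. (norm (vel r i))\<^sup>2))
      - c0 * 1)) (at r within {0..})" if "0 \<le> r" for r
  proof -
    have "((\<lambda>r. u \<bullet> X r i) has_real_derivative u \<bullet> vel r i) (at r within {0..})"
      by (rule has_real_derivative_along[OF bounded_linear.has_derivative[OF bounded_linear_inner_right has_derivative_ident]])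
        (rule X_derivative[OF i that])
    thus ?thesis unfolding H_def
      by (intro DERIV_add DERIV_diff DERIV_cmult energy_dissipation that DERIV_ident)
  qed
  obtain c where c: "s \<le> c" "H t - H s = (u \<bullet> vel c i + l * (- (1 / real N) * (\<Sum>i\<in>{1..N}. (norm (vel c i))\<^sup>2))
      - c0 * 1) * (t - s)"
    using mean_value_nonneg_axis[OF st H] by blast
  have "u \<bullet> vel c i + l * (- (1 / real N) * (\<Sum>i\<in>{1..N}. (norm (vel c i))\<^sup>2)) - c0 * 1 \<le> 0"
  proof -
    define a where "a = l / real N"
    have a: "0 < a" using l N_pos by (simp add: a_def)
    have "(norm (vel c i))\<^sup>2 \<le> (\<Sum>i\<in>{1..N}. (norm (vel c i))\<^sup>2)"
      using i by (intro member_le_sum) auto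
    hence "a * (norm (vel c i))\<^sup>2 \<le> a * (\<Sum>i\<in>{1..N}. (norm (vel c i))\<^sup>2)"
      using a by (intro mult_left_mono) auto
    moreover have "u \<bullet> vel c i \<le> norm u * norm (vel c i)" by (rule norm_cauchy_schwarz)
    moreover have "norm u * norm (vel c i) \<le> a * (norm (vel c i))\<^sup>2 + (norm u)\<^sup>2 / (4 * a)"
    proof -
      have "0 \<le> (2 * a * norm (vel c i) - norm u)\<^sup>2 / (4 * a)" using a by simp
      also have "\<dots> = a * (norm (vel c i))\<^sup>2 - norm u * norm (vel c i) + (norm u)\<^sup>2 / (4 * a)"
        using a by (simp add: field_simps power2_eq_square)
      finally show ?thesis by simp
    qed
    moreover have "c0 * 1 = (norm u)\<^sup>2 / (4 * a)"
      using l N_pos by (simp add: a_def c0_def)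
    moreover have "l * (- (1 / real N) * (\<Sum>i\<in>{1..N}. (norm (vel c i))\<^sup>2)) = - (a * (\<Sum>i\<in>{1..N}. (norm (vel c i))\<^sup>2))"
      by (simp add: a_def)
    ultimately show ?thesis by linarith
  qed
  hence "H t - H s \<le> 0" unfolding c(2) using st by (intro mult_nonpos_nonneg) auto
  moreover have "H t - H s = u \<bullet> (X t i - X s i) - l * (energy s - energy t) - c0 * dt"
    by (simp add: H_def dt_def inner_diff_right right_diff_distrib)
  moreover have "c0 * dt = (norm u)\<^sup>2 / 2"
    using dt N_pos by (simp add: c0_def l_def)
  moreover have "u \<bullet> (X t i - X s i) = (norm u)\<^sup>2" by (simp add: u_def power2_norm_eq_inner)
  moreover have "real N * (t - s) * (energy s - energy t) = 2 * (l * (energy s - energy t))"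
    by (simp add: l_def dt_def)
  ultimately show ?thesis unfolding u_def by linarith
qed simp

text \<open>
  The energy drop over a window of fixed length tends to zero, so near an omega-limit point the
  solution is eventually trapped for arbitrarily long windows.
\<close>
lemma omega_limit_trapping:
  assumes Y: "Y \<in> omega_limit N X" and d: "0 < d" and T: "0 \<le> T"
  obtains s where "S0 \<le> s" "0 \<le> s" "\<And>t i. s \<le> t \<Longrightarrow> t \<le> s + T \<Longrightarrow> i \<in> {1..N} \<Longrightarrow> dist (X t i) (Y i) < d"
proof -
  define K where "K = real N * (T + 1)"
  have K: "0 < K" using T N_pos by (simp add: K_def)
  \<comment> \<open>An energy drop of at most \<open>e\<close> confines each particle to a displacement less than \<open>d / 2\<close>.\<close>
  define e where "e = (d / 2)\<^sup>2 / 2 / K"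
  have e: "0 < e" using d K by (simp add: e_def)
  define L where "L = (INF t\<in>{0..}. energy t)"
  have bdd: "bdd_below (energy ` {0..})"
    using particle_energy_nonneg[OF N_pos] by (intro bdd_belowI[of _ 0]) auto
  obtain s1 where s1: "0 \<le> s1" "energy s1 < L + e"
    using cINF_less_iff[OF _ bdd, of "L + e"] e by (auto simp: L_def)
  have drop: "energy s - energy t \<le> e" if "s1 \<le> s" "s \<le> t" for s t
  proof -
    have "L \<le> energy t" unfolding L_def using that s1 by (intro cINF_lower bdd) auto
    moreover have "energy s \<le> energy s1" using that s1 by (intro energy_decreasing) auto
    ultimately show ?thesis using s1 by linarith
  qed
  define U where "U = (\<Pi>\<^sub>E i\<in>{1..N}. ball (Y i) (d / 2))"
  have "openin (product_topology (\<lambda>_. euclidean) {1..N}) U"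
    unfolding U_def by (subst openin_PiE) auto
  have "Y \<in> (product_topology (\<lambda>_. euclidean) {1..N}) closure_of (X ` {max s1 (max S0 0)..})"
    using Y by (auto simp: omega_limit_def)
  moreover from this have "Y \<in> U" using d by (auto simp: in_closure_of U_def PiE_def)
  ultimately obtain s where s: "max s1 (max S0 0) \<le> s" "X s \<in> U"
    using \<open>openin _ U\<close> by (auto simp: in_closure_of)
  have "dist (X t i) (Y i) < d" if t: "s \<le> t" "t \<le> s + T" and i: "i \<in> {1..N}" for t i
  proof -
    have "(norm (X t i - X s i))\<^sup>2 \<le> real N * (t - s) * (energy s - energy t)"
      using s t by (intro displacement_le_energy_drop i) auto
    also have "\<dots> \<le> real N * (T + 1) * e"
      using s t drop[of s t] energy_decreasing[of s t] T by (intro mult_mono) auto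
    also have "\<dots> = (d / 2)\<^sup>2 / 2"
      using K unfolding K_def[symmetric] e_def by simp
    also have "\<dots> < (d / 2)\<^sup>2" using d by simp
    finally have "norm (X t i - X s i) < d / 2"
      by (rule power_less_imp_less_base) (use d in simp)
    moreover have "dist (Y i) (X s i) < d / 2" using s(2) i by (auto simp: U_def)
    ultimately show ?thesis
      using dist_triangle[of "X t i" "Y i" "X s i"] by (simp add: dist_norm norm_minus_commute)
  qed
  thus ?thesis using that[of s] s by auto
qed

lemma omega_limit_extensional:
  assumes "Y \<in> omega_limit N X"
  shows "Y \<in> {1..N} \<rightarrow>\<^sub>E UNIV"
proof -
  have "Y \<in> (product_topology (\<lambda>_. euclidean) {1..N}) closure_of (X ` {0..})"
    using assms by (auto simp: omega_limit_def)
  thus ?thesis by (simp add: in_closure_of)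
qed

lemma omega_limit_energy_le:
  assumes Y: "Y \<in> omega_limit N X"
  shows "particle_energy q \<mu> N Y \<le> particle_energy q \<mu> N X0"
proof -
  have "\<exists>s. 0 \<le> s \<and> (\<forall>i\<in>{1..N}. dist (X s i) (Y i) < 1 / real (Suc n))" for n
    using omega_limit_trapping[OF Y, of "1 / real (Suc n)" 0 0] by (metis add.right_neutral order_refl of_nat_0_less_iff zero_less_Suc zero_less_divide_1_iff)
  then obtain s where s: "\<And>n. 0 \<le> s n" "\<And>n i. i \<in> {1..N} \<Longrightarrow> dist (X (s n) i) (Y i) < 1 / real (Suc n)" by metis
  have "(\<lambda>n. X (s n) i) \<longlonglongrightarrow> Y i" if "i \<in> {1..N}" for i
    using s(2)[OF that] by (rule LIMSEQ_of_dist_less)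
  hence "(\<lambda>n. energy (s n)) \<longlonglongrightarrow> particle_energy q \<mu> N Y"
    by (intro tendsto_particle_energy N_pos)
  moreover have "energy (s n) \<le> particle_energy q \<mu> N X0" for n
    using energy_decreasing[of 0 "s n"] s(1)[of n] solution by (simp add: global_solution_def)
  ultimately show ?thesis by (intro LIMSEQ_le_const2) auto
qed

text \<open>
  Otherwise some cluster \<open>S\<close> of particles would come together at \<open>Y\<close>. While the solution stays
  near \<open>Y\<close>, the squared spread \<open>V\<close> of the cluster satisfies \<open>V' \<ge> (q / N) V powr (q / 2)\<close>: the mutual
  repulsion dominates, because the field of \<open>\<mu>\<close> and of the other particles varies by
  \<open>o(\<bar>x - x'\<bar> powr (q - 1))\<close> only. As \<open>q / 2 < 1\<close>, the spread becomes large within a time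
  that does not depend on how small it was, contradicting the trapping.
\<close>
lemma omega_limit_collision_free:
  assumes Y: "Y \<in> omega_limit N X"
  shows "Y \<in> collision_free N"
proof (rule ccontr)
  assume "Y \<notin> collision_free N"
  then obtain a b where ab: "a \<in> {1..N}" "b \<in> {1..N}" "a \<noteq> b" "Y a = Y b"
    using omega_limit_extensional[OF Y] by (auto simp: collision_free_def)
  define S where "S = {i \<in> {1..N}. Y i = Y a}"
  define J where "J = {1..N} - S"
  have S: "finite S" "S \<subseteq> {1..N}" "a \<in> S" "b \<in> S" using ab by (auto simp: S_def)
  have J: "finite J" "J \<subseteq> {1..N}" by (auto simp: J_def)
  \<comment> \<open>The fields of \<open>\<mu>\<close> and of the other particles then each cancel at most a quarter of the internal repulsion.\<close>
  define e where "e = q / (4 * real N)"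
  have e: "0 < e" using q N_pos by (simp add: e_def)
  define P1 where "P1 d \<longleftrightarrow> (\<forall>u v. dist u (Y a) < d \<longrightarrow> dist v (Y a) < d \<longrightarrow> u \<noteq> v \<longrightarrow>
      norm (drift u - drift v) \<le> e * norm (u - v) powr (q - 1))" for d
  define P2 where "P2 j d \<longleftrightarrow> (\<forall>u v. dist u (Y a - Y j) < 2 * d \<longrightarrow> dist v (Y a - Y j) < 2 * d \<longrightarrow> u \<noteq> v \<longrightarrow>
      norm (grad_ker q u - grad_ker q v) \<le> e * norm (u - v) powr (q - 1))" for j d
  have ev1: "\<forall>\<^sub>F d in at_right 0. P1 d"
  proof -
    obtain d where d: "0 < d" "\<And>u v. dist u (Y a) < d \<Longrightarrow> dist v (Y a) < d \<Longrightarrow> u \<noteq> v \<Longrightarrow>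
      norm (drift u - drift v) \<le> e * norm (u - v) powr (q - 1)"
      using drift_modulus[OF e, of "Y a"] by blast
    thus ?thesis by (intro eventually_at_rightI[of 0 d]) (auto simp: P1_def)
  qed
  have ev2: "\<forall>\<^sub>F d in at_right 0. \<forall>j\<in>J. P2 j d"
  proof (intro eventually_ball_finite J ballI)
    fix j assume "j \<in> J"
    hence "Y a - Y j \<noteq> 0" by (auto simp: J_def S_def)
    then obtain d where d: "0 < d" "\<And>u v. dist u (Y a - Y j) < d \<Longrightarrow> dist v (Y a - Y j) < d \<Longrightarrow> u \<noteq> v \<Longrightarrow>
      norm (grad_ker q u - grad_ker q v) \<le> e * norm (u - v) powr (q - 1)"
      using grad_ker_modulus[OF q _ e] by blast
    thus "\<forall>\<^sub>F d in at_right 0. P2 j d"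
      by (intro eventually_at_rightI[of 0 "d / 2"]) (auto simp: P2_def)
  qed
  have "\<forall>\<^sub>F d::real in at_right 0. 0 < d" by (rule eventually_at_right_less)
  hence "\<forall>\<^sub>F d in at_right 0. 0 < d \<and> P1 d \<and> (\<forall>j\<in>J. P2 j d)"
    using ev1 ev2 by (intro eventually_conj)
  then obtain d where d: "0 < d" and Pd: "P1 d" "\<forall>j\<in>J. P2 j d"
    using eventually_happens'[OF trivial_limit_at_right_real] by blast
  from Pd have mod1: "\<And>u v. dist u (Y a) < d \<Longrightarrow> dist v (Y a) < d \<Longrightarrow> u \<noteq> v \<Longrightarrow>
      norm (drift u - drift v) \<le> e * norm (u - v) powr (q - 1)"
    and mod2: "\<And>j u v. j \<in> J \<Longrightarrow> dist u (Y a - Y j) < 2 * d \<Longrightarrow> dist v (Y a - Y j) < 2 * d \<Longrightarrow> u \<noteq> v \<Longrightarrow>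
      norm (grad_ker q u - grad_ker q v) \<le> e * norm (u - v) powr (q - 1)"
    unfolding P1_def P2_def by auto
  define k where "k = (1 - q / 2) * (q / real N)"
  have k: "0 < k" using q N_pos by (simp add: k_def)
  define B where "B = (real (card S))\<^sup>2 * (2 * d)\<^sup>2"
  \<comment> \<open>While trapped, \<open>V powr (1 - q / 2)\<close> grows at least at the rate \<open>k\<close>, but \<open>V\<close> is at most \<open>B\<close>.\<close>
  define T where "T = (B powr (1 - q / 2) + 1) / k"
  have T: "0 \<le> T" using k by (simp add: T_def)
  obtain s where s: "0 \<le> s" "\<And>t i. s \<le> t \<Longrightarrow> t \<le> s + T \<Longrightarrow> i \<in> {1..N} \<Longrightarrow> dist (X t i) (Y i) < d"
    by (rule omega_limit_trapping[OF Y d T, of 0]) (rule that)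
  define V where "V t = (\<Sum>i\<in>S. \<Sum>j\<in>S. (norm (X t i - X t j))\<^sup>2)" for t
  define V' where "V' t = (\<Sum>i\<in>S. \<Sum>j\<in>S. 2 * ((X t i - X t j) \<bullet> (vel t i - vel t j)))" for t
  have V_deriv: "(V has_real_derivative V' t) (at t within {0..})" if t: "0 \<le> t" for t
  proof -
    have "((\<lambda>s. (norm (X s i - X s j))\<^sup>2) has_real_derivative 2 * ((X t i - X t j) \<bullet> (vel t i - vel t j))) (at t within {0..})"
      if "i \<in> S" "j \<in> S" for i j
    proof (rule has_real_derivative_along[where f = "\<lambda>z. (norm z)\<^sup>2"])
      show "((\<lambda>z. (norm z)\<^sup>2) has_derivative (\<lambda>h. 2 * ((X t i - X t j) \<bullet> h))) (at (X t i - X t j))"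
        unfolding power2_norm_eq_inner by (auto intro!: derivative_eq_intros simp: inner_commute)
      show "((\<lambda>s. X s i - X s j) has_vector_derivative vel t i - vel t j) (at t within {0..})"
        using that S t by (intro has_vector_derivative_diff X_derivative) auto
    qed
    thus ?thesis unfolding V_def V'_def by (intro DERIV_sum)
  qed
  have V_pos: "0 < V t" if "0 \<le> t" for t
  proof -
    have "0 < (norm (X t a - X t b))\<^sup>2"
      using X_collision_free[OF that] ab by (auto simp: collision_free_def)
    also have "\<dots> \<le> (\<Sum>j\<in>S. (norm (X t a - X t j))\<^sup>2)"
      using S by (intro member_le_sum[where f = "\<lambda>j. (norm (X t a - X t j))\<^sup>2"]) auto
    also have "\<dots> \<le> V t" unfolding V_def
      using S by (intro member_le_sum[where f = "\<lambda>i. \<Sum>j\<in>S. (norm (X t i - X t j))\<^sup>2"] sum_nonneg) auto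
    finally show ?thesis .
  qed
  have growth: "(q / real N) * V t powr (q / 2) \<le> V' t" if t: "s \<le> t" "t \<le> s + T" for t
  proof -
    have t0: "0 \<le> t" using t s by simp
    define x where "x = X t"
    define A where "A i = - (1 / real N) *\<^sub>R (\<Sum>j\<in>S. grad_ker q (x i - x j))" for i
    define R where "R i = - (1 / real N) *\<^sub>R (\<Sum>j\<in>J. grad_ker q (x i - x j)) + drift (x i)" for i
    define W where "W = (\<Sum>i\<in>S. \<Sum>j\<in>S. norm (x i - x j) powr q)"
    have W: "0 \<le> W" by (simp add: W_def sum_nonneg)
    have vel_eq: "vel t i = A i + R i" if "i \<in> S" for i
    proof -
      have "(\<Sum>j\<in>{1..N}. grad_ker q (x i - x j)) = (\<Sum>j\<in>J. grad_ker q (x i - x j)) + (\<Sum>j\<in>S. grad_ker q (x i - x j))"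
        unfolding J_def using S by (intro sum.subset_diff) auto
      thus ?thesis using that S by (subst particle_velocity_eq) (auto simp: A_def R_def x_def algebra_simps)
    qed
    have internal: "(\<Sum>i\<in>S. \<Sum>j\<in>S. (x i - x j) \<bullet> (A i - A j)) = real (card S) * (q / real N) * W"
    proof -
      have "(\<Sum>i\<in>S. A i) = 0"
        using sum_grad_ker_antisym[of q x S] by (simp add: A_def sum_negf flip: scaleR_sum_right)
      moreover have "(\<Sum>i\<in>S. \<Sum>j\<in>S. (x i - x j) \<bullet> (A i - A j))
          = 2 * (real (card S) * (\<Sum>i\<in>S. x i \<bullet> A i)) - 2 * ((\<Sum>i\<in>S. x i) \<bullet> (\<Sum>i\<in>S. A i))"
      proof -
        have "(\<Sum>i\<in>S. \<Sum>j\<in>S. x i \<bullet> A j) = (\<Sum>i\<in>S. x i) \<bullet> (\<Sum>i\<in>S. A i)"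
          "(\<Sum>i\<in>S. \<Sum>j\<in>S. x j \<bullet> A i) = (\<Sum>i\<in>S. x i) \<bullet> (\<Sum>i\<in>S. A i)"
          by (simp_all add: inner_sum_left inner_sum_right) (rule sum.swap)
        thus ?thesis
          by (simp add: inner_diff sum_subtractf sum.distrib sum_distrib_left algebra_simps)
      qed
      moreover have "(\<Sum>i\<in>S. x i \<bullet> A i) = (q / (2 * real N)) * W"
      proof -
        have "(\<Sum>i\<in>S. x i \<bullet> A i) = - (1 / real N) * (\<Sum>i\<in>S. (\<Sum>j\<in>S. grad_ker q (x i - x j)) \<bullet> x i)"
          by (simp add: A_def inner_commute sum_distrib_left sum_negf)
        also have "\<dots> = (q / (2 * real N)) * W"
          unfolding sum_grad_ker_virial W_def by simp
        finally show ?thesis .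
      qed
      ultimately show ?thesis using N_pos by simp
    qed
    have external: "- ((q / (2 * real N)) * norm (x i - x j) powr q) \<le> (x i - x j) \<bullet> (R i - R j)"
      if ij: "i \<in> S" "j \<in> S" for i j
    proof (cases "x i = x j")
      case False
      define h where "h = norm (x i - x j) powr (q - 1)"
      have near: "dist (x l) (Y l) < d" if "l \<in> {1..N}" for l
        using s(2)[OF t that] by (simp add: x_def)
      have nearS: "dist (x l) (Y a) < d" if "l \<in> S" for l
        using near[of l] that S by (auto simp: S_def)
      have "norm (grad_ker q (x i - x l) - grad_ker q (x j - x l)) \<le> e * h" if l: "l \<in> J" for l
      proof -
        have "dist (x m - x l) (Y a - Y l) < 2 * d" if "m \<in> S" for m
        proof -
          have "dist (x m - x l) (Y a - Y l) \<le> dist (x m) (Y a) + dist (x l) (Y l)"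
            unfolding dist_norm using norm_triangle_ineq4[of "x m - Y a" "x l - Y l"] by (simp add: algebra_simps)
          thus ?thesis using nearS[OF that] near[of l] l J by fastforce
        qed
        from mod2[OF l this[OF ij(1)] this[OF ij(2)]] False show ?thesis by (simp add: h_def)
      qed
      hence "norm (\<Sum>l\<in>J. grad_ker q (x i - x l) - grad_ker q (x j - x l)) \<le> real (card J) * (e * h)"
        by (rule sum_norm_bound)
      also have "\<dots> \<le> real N * (e * h)"
        using card_mono[OF _ J(2)] e by (intro mult_right_mono) (auto simp: h_def)
      finally have J_bound: "(1 / real N) * norm (\<Sum>l\<in>J. grad_ker q (x i - x l) - grad_ker q (x j - x l)) \<le> e * h"
        using N_pos by (simp add: field_simps)
      have "R i - R j = (drift (x i) - drift (x j)) - (1 / real N) *\<^sub>R (\<Sum>l\<in>J. grad_ker q (x i - x l) - grad_ker q (x j - x l))"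
        by (simp add: R_def sum_subtractf algebra_simps)
      hence "norm (R i - R j) \<le> norm (drift (x i) - drift (x j)) + (1 / real N) * norm (\<Sum>l\<in>J. grad_ker q (x i - x l) - grad_ker q (x j - x l))"
        using norm_triangle_ineq4[of "drift (x i) - drift (x j)"
            "(1 / real N) *\<^sub>R (\<Sum>l\<in>J. grad_ker q (x i - x l) - grad_ker q (x j - x l))"] by simp
      also have "\<dots> \<le> e * h + e * h"
        using mod1[OF nearS[OF ij(1)] nearS[OF ij(2)] False] J_bound by (intro add_mono) (auto simp: h_def)
      finally have "norm (R i - R j) \<le> 2 * e * h" by simp
      hence "norm (x i - x j) * norm (R i - R j) \<le> norm (x i - x j) * (2 * e * h)"
        by (intro mult_left_mono) auto
      also have "\<dots> = (q / (2 * real N)) * norm (x i - x j) powr q"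
        using powr_mult_base[of "norm (x i - x j)" "q - 1"] by (simp add: e_def h_def)
      finally show ?thesis
        using Cauchy_Schwarz_ineq2[of "x i - x j" "R i - R j"] by linarith
    qed simp
    have "V' t = 2 * (\<Sum>i\<in>S. \<Sum>j\<in>S. (x i - x j) \<bullet> (A i - A j)) + 2 * (\<Sum>i\<in>S. \<Sum>j\<in>S. (x i - x j) \<bullet> (R i - R j))"
    proof -
      have "2 * ((X t i - X t j) \<bullet> (vel t i - vel t j)) = 2 * ((x i - x j) \<bullet> (A i - A j)) + 2 * ((x i - x j) \<bullet> (R i - R j))"
        if "i \<in> S" "j \<in> S" for i j
        using vel_eq[OF that(1)] vel_eq[OF that(2)] by (simp add: x_def algebra_simps inner_add_right inner_diff_right)
      thus ?thesis by (simp add: V'_def sum.distrib sum_distrib_left)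
    qed
    also have "\<dots> \<ge> 2 * (q / real N * W) + 2 * (- (q / (2 * real N)) * W)"
    proof (intro add_mono mult_left_mono)
      have "1 \<le> card S" using S by (simp add: Suc_le_eq card_gt_0_iff) blast
      hence "1 * (q / real N * W) \<le> real (card S) * (q / real N * W)"
        using q W by (intro mult_right_mono) auto
      thus "q / real N * W \<le> (\<Sum>i\<in>S. \<Sum>j\<in>S. (x i - x j) \<bullet> (A i - A j))" unfolding internal by simp
      have "(\<Sum>i\<in>S. \<Sum>j\<in>S. - ((q / (2 * real N)) * norm (x i - x j) powr q)) \<le> (\<Sum>i\<in>S. \<Sum>j\<in>S. (x i - x j) \<bullet> (R i - R j))"
        by (intro sum_mono external)
      thus "- (q / (2 * real N)) * W \<le> (\<Sum>i\<in>S. \<Sum>j\<in>S. (x i - x j) \<bullet> (R i - R j))"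
        by (simp add: W_def sum_distrib_left sum_negf)
    qed auto
    finally have "q / real N * W \<le> V' t" using N_pos by (simp add: field_simps)
    moreover have "V t powr (q / 2) \<le> W"
    proof -
      have "V t powr (q / 2) \<le> (\<Sum>i\<in>S. (\<Sum>j\<in>S. (norm (X t i - X t j))\<^sup>2) powr (q / 2))"
        unfolding V_def using q S by (intro powr_sum_subadditive sum_nonneg) auto
      also have "\<dots> \<le> (\<Sum>i\<in>S. \<Sum>j\<in>S. ((norm (X t i - X t j))\<^sup>2) powr (q / 2))"
        using q S by (intro sum_mono powr_sum_subadditive) auto
      also have "\<dots> = W"
      proof -
        have "((norm z)\<^sup>2) powr (q / 2) = norm z powr q" for z :: 'a
          by (cases "z = 0") (simp_all add: powr_powr flip: powr_numeral)
        thus ?thesis by (simp add: W_def x_def)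
      qed
      finally show ?thesis .
    qed
    hence "q / real N * V t powr (q / 2) \<le> q / real N * W" using q by (intro mult_left_mono) auto
    ultimately show ?thesis by linarith
  qed
  define p where "p = 1 - q / 2"
  have p: "0 < p" using q by (simp add: p_def)
  have "((\<lambda>t. V t powr p) has_real_derivative p * V t powr (p - 1) * V' t) (at t within {0..})" if "0 \<le> t" for t
    using DERIV_chain2[OF has_real_derivative_powr[OF V_pos[OF that]] V_deriv[OF that]] .
  from mean_value_nonneg_axis[OF s(1) _ this, of "s + T"] T
  obtain c where c: "s \<le> c" "c \<le> s + T" "V (s + T) powr p - V s powr p = p * V c powr (p - 1) * V' c * T"
    by auto
  have "k \<le> p * V c powr (p - 1) * V' c"
  proof -
    have "0 < V c" using V_pos[of c] c s by auto
    have "V c powr (p - 1) * V c powr (q / 2) = 1"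
      using \<open>0 < V c\<close> by (simp add: p_def flip: powr_add)
    hence "k = p * V c powr (p - 1) * ((q / real N) * V c powr (q / 2))"
      by (simp add: k_def p_def mult_ac)
    also have "\<dots> \<le> p * V c powr (p - 1) * V' c"
      using p by (intro mult_left_mono growth c) auto
    finally show ?thesis .
  qed
  hence "k * T \<le> V (s + T) powr p"
    using c(3) T mult_right_mono[of k "p * V c powr (p - 1) * V' c" T] by (smt (verit) powr_ge_zero)
  moreover have "V (s + T) \<le> B"
  proof -
    have "(norm (X (s + T) i - X (s + T) j))\<^sup>2 \<le> (2 * d)\<^sup>2" if "i \<in> S" "j \<in> S" for i j
    proof (rule power_mono)
      have "dist (X (s + T) l) (Y a) < d" if "l \<in> S" for l
        using s(2)[of "s + T" l] T that by (auto simp: S_def)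
      from this[OF that(1)] this[OF that(2)]
      show "norm (X (s + T) i - X (s + T) j) \<le> 2 * d"
        using dist_triangle2[of "X (s + T) i" "X (s + T) j" "Y a"] by (simp add: dist_norm)
    qed simp
    hence "V (s + T) \<le> (\<Sum>i\<in>S. \<Sum>j\<in>S. (2 * d)\<^sup>2)"
      unfolding V_def by (intro sum_mono)
    thus ?thesis by (simp add: B_def power2_eq_square mult_ac)
  qed
  hence "V (s + T) powr p \<le> B powr p"
    using V_pos[of "s + T"] s T p by (intro powr_mono2) auto
  moreover have "k * T = B powr p + 1" using k by (simp add: T_def p_def)
  ultimately show False by simp
qed

text \<open>
  Over a window of length one near \<open>Y\<close> the displacement is small, so by the mean value theorem the
  velocity in the direction of its limit is small at some time; at these times it converges to the velocity at \<open>Y\<close>.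
\<close>
lemma omega_limit_stationary:
  assumes Y: "Y \<in> omega_limit N X" and i: "i \<in> {1..N}"
  shows "particle_velocity q \<mu> N Y i = 0"
proof -
  define w where "w = particle_velocity q \<mu> N Y i"
  have "\<exists>c. (\<forall>j\<in>{1..N}. dist (X c j) (Y j) < 1 / real (Suc n)) \<and> \<bar>w \<bullet> vel c i\<bar> \<le> norm w * (2 / real (Suc n))" for n
  proof -
    obtain s where s: "0 \<le> s" "\<And>t j. s \<le> t \<Longrightarrow> t \<le> s + 1 \<Longrightarrow> j \<in> {1..N} \<Longrightarrow> dist (X t j) (Y j) < 1 / real (Suc n)"
      using omega_limit_trapping[OF Y, of "1 / real (Suc n)" 1 0] by (auto simp del: of_nat_Suc)
    have "((\<lambda>r. w \<bullet> X r i) has_real_derivative w \<bullet> vel r i) (at r within {0..})" if "0 \<le> r" for r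
      by (rule has_real_derivative_along[OF bounded_linear.has_derivative[OF bounded_linear_inner_right has_derivative_ident]])
        (rule X_derivative[OF i that])
    from mean_value_nonneg_axis[OF s(1) _ this, of "s + 1"]
    obtain c where c: "s \<le> c" "c \<le> s + 1" "w \<bullet> X (s + 1) i - w \<bullet> X s i = w \<bullet> vel c i" by auto
    have "\<bar>w \<bullet> vel c i\<bar> \<le> norm w * norm (X (s + 1) i - X s i)"
      unfolding c(3)[symmetric] inner_diff_right[symmetric] by (rule Cauchy_Schwarz_ineq2)
    also have "norm (X (s + 1) i - X s i) \<le> 2 / real (Suc n)"
      using dist_triangle2[of "X (s + 1) i" "X s i" "Y i"] s(2)[of "s + 1" i] s(2)[of s i] i
      by (simp add: dist_norm del: of_nat_Suc)
    finally have "\<bar>w \<bullet> vel c i\<bar> \<le> norm w * (2 / real (Suc n))" by (simp add: mult_left_mono)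
    thus ?thesis using c s(2) by blast
  qed
  then obtain c where c: "\<And>n j. j \<in> {1..N} \<Longrightarrow> dist (X (c n) j) (Y j) < 1 / real (Suc n)"
    "\<And>n. \<bar>w \<bullet> vel (c n) i\<bar> \<le> norm w * (2 / real (Suc n))" by metis
  have "(\<lambda>n. X (c n) j) \<longlonglongrightarrow> Y j" if "j \<in> {1..N}" for j
    using c(1)[OF that] by (rule LIMSEQ_of_dist_less)
  hence "(\<lambda>n. vel (c n) i) \<longlonglongrightarrow> w"
    unfolding w_def by (intro tendsto_particle_velocity omega_limit_collision_free[OF Y] i)
  hence "(\<lambda>n. w \<bullet> vel (c n) i) \<longlonglongrightarrow> w \<bullet> w" by (intro tendsto_intros)
  moreover have "(\<lambda>n. w \<bullet> vel (c n) i) \<longlonglongrightarrow> 0"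
  proof (rule Lim_null_comparison)
    show "\<forall>\<^sub>F n in sequentially. norm (w \<bullet> vel (c n) i) \<le> norm w * (2 / real (Suc n))"
      using c(2) by (simp del: of_nat_Suc)
    have "(\<lambda>n. norm w * (2 * inverse (real (Suc n)))) \<longlonglongrightarrow> norm w * (2 * 0)"
      by (intro tendsto_intros LIMSEQ_inverse_real_of_nat)
    thus "(\<lambda>n. norm w * (2 / real (Suc n))) \<longlonglongrightarrow> 0" by (simp add: divide_inverse)
  qed
  ultimately have "w \<bullet> w = 0" using LIMSEQ_unique by blast
  thus ?thesis by (simp add: w_def)
qed

end


section \<open>Stationary configurations have bounded energy if the target is compactly supported\<close>

context regular_target
begin

lemma stationary_force_balance:
  assumes N: "0 < N" and stat: "\<And>i. i \<in> {1..N} \<Longrightarrow> particle_velocity q \<mu> N Y i = 0" and i: "i \<in> {1..N}"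
  shows "(\<Sum>j\<in>{1..N}. grad_ker q (Y i - Y j)) = real N *\<^sub>R drift (Y i)"
proof -
  have "(1 / real N) *\<^sub>R (\<Sum>j\<in>{1..N}. grad_ker q (Y i - Y j)) = drift (Y i)"
    using stat[OF i] by (simp add: particle_velocity_eq[OF i])
  hence "real N *\<^sub>R ((1 / real N) *\<^sub>R (\<Sum>j\<in>{1..N}. grad_ker q (Y i - Y j))) = real N *\<^sub>R drift (Y i)"
    by simp
  thus ?thesis using N by simp
qed

lemma integrable_grad_ker_inner:
  assumes supp: "AE v in \<mu>. norm v \<le> R"
  shows "integrable \<mu> (\<lambda>v. grad_ker q (x - v) \<bullet> v)"
proof (rule Bochner_Integration.integrable_bound[of \<mu> "\<lambda>v. norm (grad_ker q (x - v)) * R"])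
  show "AE v in \<mu>. norm (grad_ker q (x - v) \<bullet> v) \<le> norm (norm (grad_ker q (x - v)) * R)"
    using supp
  proof eventually_elim
    case (elim v)
    have "\<bar>grad_ker q (x - v) \<bullet> v\<bar> \<le> norm (grad_ker q (x - v)) * norm v" by (rule Cauchy_Schwarz_ineq2)
    also have "\<dots> \<le> norm (grad_ker q (x - v)) * R" using elim by (intro mult_left_mono) auto
    finally show ?case by simp
  qed
qed (use integrable_grad_ker in auto)

text \<open>
  Testing the force balance with the positions gives a virial identity, which expresses the
  energy of a stationary configuration through the first moment of the force that \<open>\<mu>\<close> exerts.
\<close>
lemma stationary_energy_le:
  assumes N: "0 < N" and stat: "\<And>i. i \<in> {1..N} \<Longrightarrow> particle_velocity q \<mu> N Y i = 0"
    and supp: "AE v in \<mu>. norm v \<le> R"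
  shows "particle_energy q \<mu> N Y \<le> 1 / (q * real N) * (\<Sum>i\<in>{1..N}. \<integral>v. grad_ker q (Y i - v) \<bullet> v \<partial>\<mu>)"
proof -
  define \<tau> where "\<tau> i = (\<integral>v. grad_ker q (Y i - v) \<bullet> v \<partial>\<mu>)" for i
  note int = integrable_grad_ker_inner[OF supp]
  have "drift (Y i) \<bullet> Y i = - q * potential (Y i) + \<tau> i" for i
  proof -
    have "drift (Y i) \<bullet> Y i = (\<integral>v. grad_ker q (Y i - v) \<bullet> Y i \<partial>\<mu>)"
      unfolding drift_def using integrable_grad_ker by (rule integral_inner_left[symmetric])
    also have "\<dots> = (\<integral>v. - q * norm (Y i - v) powr q + grad_ker q (Y i - v) \<bullet> v \<partial>\<mu>)"
    proof (intro Bochner_Integration.integral_cong refl)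
      fix v
      show "grad_ker q (Y i - v) \<bullet> Y i = - q * norm (Y i - v) powr q + grad_ker q (Y i - v) \<bullet> v"
        using grad_ker_inner[of q "Y i - v"] by (simp add: inner_diff_right)
    qed
    also have "\<dots> = - q * potential (Y i) + \<tau> i"
      using integrable_norm_powr int by (simp add: potential_def \<tau>_def)
    finally show ?thesis .
  qed
  hence "(\<Sum>i\<in>{1..N}. real N * (drift (Y i) \<bullet> Y i)) = real N * (- q * (\<Sum>i\<in>{1..N}. potential (Y i)) + (\<Sum>i\<in>{1..N}. \<tau> i))"
    by (simp only: sum.distrib sum_distrib_left[symmetric])
  moreover have "(\<Sum>i\<in>{1..N}. real N * (drift (Y i) \<bullet> Y i)) = (\<Sum>i\<in>{1..N}. (\<Sum>j\<in>{1..N}. grad_ker q (Y i - Y j)) \<bullet> Y i)"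
    using stationary_force_balance[OF N stat] by (intro sum.cong) auto
  moreover have "\<dots> = - (q / 2) * pair_sum q N Y"
    unfolding pair_sum_def by (rule sum_grad_ker_virial)
  ultimately have "(q / 2) * pair_sum q N Y = real N * (q * (\<Sum>i\<in>{1..N}. potential (Y i)) - (\<Sum>i\<in>{1..N}. \<tau> i))"
    by (simp add: algebra_simps)
  hence A: "pair_sum q N Y = 2 / q * (real N * (q * (\<Sum>i\<in>{1..N}. potential (Y i)) - (\<Sum>i\<in>{1..N}. \<tau> i)))"
    using q(1) by (simp add: field_simps)
  define D where "D = 1 / (q * real N) * (\<Sum>i\<in>{1..N}. \<tau> i)"
  have M0: "0 \<le> (\<integral>u. potential u \<partial>\<mu>)" by (simp add: potential_nonneg)
  have ZD: "- (1 / real N ^ 2) * pair_sum q N Y + 2 / real N * (\<Sum>i\<in>{1..N}. potential (Y i))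
      = 2 * D"
    unfolding A D_def using q(1) N by (simp add: field_simps power2_eq_square)
  show ?thesis
    unfolding particle_energy_eq[OF N] ZD \<tau>_def[symmetric] D_def[symmetric] using M0 by simp
qed

text \<open>
  For \<open>q < 1\<close> the force is bounded. For \<open>q \<ge> 1\<close> it may grow like \<open>\<bar>x\<bar> powr (q - 1)\<close>; but the forces of \<open>\<mu>\<close> on a
  stationary configuration sum to zero, because the interaction is antisymmetric, so the mean
  force may be subtracted, and what remains is bounded by Hoelder continuity.
\<close>
lemma stationary_energy_bounded:
  assumes supp: "AE v in \<mu>. norm v \<le> R"
  obtains B where "\<And>N Y. 0 < N \<Longrightarrow> (\<And>i. i \<in> {1..N} \<Longrightarrow> particle_velocity q \<mu> N Y i = 0)
    \<Longrightarrow> particle_energy q \<mu> N Y \<le> B"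
proof -
  have R: "0 \<le> R"
  proof (rule ccontr)
    assume "\<not> 0 \<le> R"
    hence "\<not> norm v \<le> R" for v :: 'a using norm_ge_zero[of v] by linarith
    thus False using supp by simp
  qed
  have "\<exists>B. \<forall>N Y. 0 < N \<longrightarrow> (\<forall>i\<in>{1..N}. particle_velocity q \<mu> N Y i = 0) \<longrightarrow>
      (\<Sum>i\<in>{1..N}. \<integral>v. grad_ker q (Y i - v) \<bullet> v \<partial>\<mu>) \<le> real N * B"
  proof (cases "q < 1")
    case True
    obtain C where C: "0 \<le> C" "\<And>x. norm x \<le> R + 1 \<Longrightarrow> (\<integral>v. norm (x - v) powr (q - 1) \<partial>\<mu>) \<le> C"
      using norm_powr_minus_1_integral_bound by blast
    have C': "(\<integral>v. norm (x - v) powr (q - 1) \<partial>\<mu>) \<le> max C 1" for x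
    proof (cases "norm x \<le> R + 1")
      case False
      have "(\<integral>v. norm (x - v) powr (q - 1) \<partial>\<mu>) \<le> (\<integral>v. 1 \<partial>\<mu>)"
      proof (intro integral_mono_AE integrable_norm_powr_minus_1)
        show "AE v in \<mu>. norm (x - v) powr (q - 1) \<le> 1"
          using supp
        proof eventually_elim
          case (elim v)
          have "1 \<le> norm (x - v)" using norm_triangle_ineq2[of x v] elim False by simp
          hence "norm (x - v) powr (q - 1) \<le> 1 powr (q - 1)" using True by (intro powr_mono2') auto
          thus ?case by simp
        qed
      qed auto
      thus ?thesis by simp
    qed (use C in \<open>auto simp: le_max_iff_disj\<close>)
    have "(\<integral>v. grad_ker q (x - v) \<bullet> v \<partial>\<mu>) \<le> q * max C 1 * R" for x
    proof -
      have "(\<integral>v. grad_ker q (x - v) \<bullet> v \<partial>\<mu>) \<le> (\<integral>v. (q * R) * norm (x - v) powr (q - 1) \<partial>\<mu>)"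
      proof (rule integral_mono_AE')
        show "AE v in \<mu>. grad_ker q (x - v) \<bullet> v \<le> (q * R) * norm (x - v) powr (q - 1)"
          using supp
        proof eventually_elim
          case (elim v)
          have "grad_ker q (x - v) \<bullet> v \<le> norm (grad_ker q (x - v)) * norm v" by (rule norm_cauchy_schwarz)
          also have "\<dots> \<le> norm (grad_ker q (x - v)) * R" using elim by (intro mult_left_mono) auto
          finally show ?case using q by (simp add: norm_grad_ker mult_ac)
        qed
      qed (use integrable_norm_powr_minus_1 q R in auto)
      also have "\<dots> = (q * R) * (\<integral>v. norm (x - v) powr (q - 1) \<partial>\<mu>)" by simp
      also have "\<dots> \<le> (q * R) * max C 1" using C' q R by (intro mult_left_mono) auto
      finally show ?thesis by (simp add: mult_ac)
    qed
    hence "(\<Sum>i\<in>{1..N}. \<integral>v. grad_ker q (Y i - v) \<bullet> v \<partial>\<mu>) \<le> (\<Sum>i\<in>{1..N}. q * max C 1 * R)" for N :: nat and Y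
      by (intro sum_mono)
    thus ?thesis by (intro exI[of _ "q * max C 1 * R"]) simp
  next
    case False
    define B where "B = 8 * (2 * R) powr (q - 1) * R"
    have int_v: "integrable \<mu> (\<lambda>v. v)"
      using supp by (intro integrable_const_bound[of _ R]) auto
    have "(\<Sum>i\<in>{1..N}. \<integral>v. grad_ker q (Y i - v) \<bullet> v \<partial>\<mu>) \<le> real N * B"
      if N: "0 < N" and stat: "\<forall>i\<in>{1..N}. particle_velocity q \<mu> N Y i = 0" for N Y
    proof -
      have "real N *\<^sub>R (\<Sum>i\<in>{1..N}. drift (Y i)) = (\<Sum>i\<in>{1..N}. \<Sum>j\<in>{1..N}. grad_ker q (Y i - Y j))"
        unfolding scaleR_sum_right using stationary_force_balance[OF N] stat by (intro sum.cong) auto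
      also have "\<dots> = 0" by (rule sum_grad_ker_antisym)
      finally have zero: "(\<Sum>i\<in>{1..N}. drift (Y i)) = 0" using N by simp
      have split: "(\<integral>v. grad_ker q (x - v) \<bullet> v \<partial>\<mu>) \<le> B + drift x \<bullet> (\<integral>v. v \<partial>\<mu>)" for x
      proof -
        have "(\<integral>v. grad_ker q (x - v) \<bullet> v \<partial>\<mu>) \<le> (\<integral>v. B + drift x \<bullet> v \<partial>\<mu>)"
        proof (rule integral_mono_AE)
          show "integrable \<mu> (\<lambda>v. grad_ker q (x - v) \<bullet> v)" using supp by (rule integrable_grad_ker_inner)
          show "integrable \<mu> (\<lambda>v. B + drift x \<bullet> v)" using int_v by simp
          show "AE v in \<mu>. grad_ker q (x - v) \<bullet> v \<le> B + drift x \<bullet> v"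
            using supp
          proof eventually_elim
            case (elim v)
            have "grad_ker q (x - v) - drift x = (\<integral>w. grad_ker q (x - v) - grad_ker q (x - w) \<partial>\<mu>)"
              unfolding drift_def using integrable_grad_ker by simp
            also have "norm \<dots> \<le> (\<integral>w. norm (grad_ker q (x - v) - grad_ker q (x - w)) \<partial>\<mu>)"
              by (rule integral_norm_bound)
            also have "\<dots> \<le> (\<integral>w. 8 * (2 * R) powr (q - 1) \<partial>\<mu>)"
            proof (rule integral_mono_AE')
              show "AE w in \<mu>. norm (grad_ker q (x - v) - grad_ker q (x - w)) \<le> 8 * (2 * R) powr (q - 1)"
                using supp
              proof eventually_elim
                case (elim w)
                have "norm (grad_ker q (x - v) - grad_ker q (x - w)) \<le> 8 * norm ((x - v) - (x - w)) powr (q - 1)"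
                  using False q by (intro grad_ker_holder) auto
                also have "norm ((x - v) - (x - w)) powr (q - 1) \<le> (2 * R) powr (q - 1)"
                  using \<open>norm v \<le> R\<close> elim False norm_triangle_ineq4[of w v] by (intro powr_mono2) auto
                finally show ?case by simp
              qed
            qed auto
            finally have "norm (grad_ker q (x - v) - drift x) \<le> 8 * (2 * R) powr (q - 1)" by simp
            hence "norm (grad_ker q (x - v) - drift x) * norm v \<le> B"
              unfolding B_def using elim by (intro mult_mono) auto
            moreover have "(grad_ker q (x - v) - drift x) \<bullet> v \<le> norm (grad_ker q (x - v) - drift x) * norm v"
              by (rule norm_cauchy_schwarz)
            ultimately show ?case by (simp add: inner_diff_left)
          qed
        qed
        also have "\<dots> = B + drift x \<bullet> (\<integral>v. v \<partial>\<mu>)"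
          using int_v by simp
        finally show ?thesis .
      qed
      have "(\<Sum>i\<in>{1..N}. \<integral>v. grad_ker q (Y i - v) \<bullet> v \<partial>\<mu>) \<le> (\<Sum>i\<in>{1..N}. B + drift (Y i) \<bullet> (\<integral>v. v \<partial>\<mu>))"
        by (intro sum_mono split)
      also have "\<dots> = real N * B + (\<Sum>i\<in>{1..N}. drift (Y i)) \<bullet> (\<integral>v. v \<partial>\<mu>)"
        by (simp add: sum.distrib inner_sum_left)
      finally show ?thesis unfolding zero by simp
    qed
    thus ?thesis by blast
  qed
  then obtain B where B: "\<And>N Y. 0 < N \<Longrightarrow> (\<And>i. i \<in> {1..N} \<Longrightarrow> particle_velocity q \<mu> N Y i = 0) \<Longrightarrow>
      (\<Sum>i\<in>{1..N}. \<integral>v. grad_ker q (Y i - v) \<bullet> v \<partial>\<mu>) \<le> real N * B" by blast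
  have "particle_energy q \<mu> N Y \<le> B / q"
    if N: "0 < N" and stat: "\<And>i. i \<in> {1..N} \<Longrightarrow> particle_velocity q \<mu> N Y i = 0" for N Y
  proof -
    have "particle_energy q \<mu> N Y \<le> 1 / (q * real N) * (\<Sum>i\<in>{1..N}. \<integral>v. grad_ker q (Y i - v) \<bullet> v \<partial>\<mu>)"
      using N stat supp by (rule stationary_energy_le)
    also have "\<dots> \<le> 1 / (q * real N) * (real N * B)"
      using B[OF N stat] q by (intro mult_left_mono) auto
    finally show ?thesis using N by simp
  qed
  thus ?thesis using that by blast
qed

end

section \<open>The energy controls the tails\<close>

context regular_target
begin

text \<open>
  The conditionally negative definite form is evaluated at \<open>\<rho> - \<mu> + l \<nu>\<close>, where \<open>\<rho>\<close> is the empirical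
  measure and \<open>\<nu>\<close> has mass \<open>1 / 2\<close> at \<open>z = R e\<close> and at \<open>- z\<close> and mass \<open>- 1\<close> at the origin. The form is of order \<open>R\<^sup>q\<close> at \<open>\<nu>\<close>,
  so with \<open>l = - R powr (- q / 2)\<close> the last part contributes a constant.
\<close>
lemma second_diff_average_le:
  assumes N: "0 < N" and R: "0 < R" and e: "norm e = 1"
  shows "R powr (q / 2) * ((\<integral>v. second_diff q e ((1 / R) *\<^sub>R v) \<partial>\<mu>)
      - (1 / real N) * (\<Sum>i\<in>{1..N}. second_diff q e ((1 / R) *\<^sub>R y i)))
    \<le> particle_energy q \<mu> N y + 1"
proof -
  define z where "z = R *\<^sub>R e"
  have nz: "norm z = R" using R e by (simp add: z_def)
  define s where "s v = (norm (v + z) powr q + norm (v - z) powr q) / 2 - norm v powr q" for v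
  have s_eq: "s v = R powr q * second_diff q e ((1 / R) *\<^sub>R v)" for v
  proof -
    have sc: "norm w powr q = R powr q * norm ((1 / R) *\<^sub>R w) powr q" for w :: 'a
      using R by (simp add: powr_divide)
    have "(1 / R) *\<^sub>R (v + z) = (1 / R) *\<^sub>R v + e" "(1 / R) *\<^sub>R (v - z) = (1 / R) *\<^sub>R v - e"
      using R by (simp_all add: z_def algebra_simps)
    thus ?thesis
      unfolding s_def second_diff_def sc[of "v + z"] sc[of "v - z"] sc[of v] by (simp add: algebra_simps)
  qed
  have comm: "(\<integral>u. norm (u - w) powr q \<partial>\<mu>) = potential w" for w
    by (simp add: potential_def norm_minus_commute)
  have i: "integrable \<mu> (\<lambda>u. norm (u - w) powr q)" for w
    using integrable_norm_powr[of w] by (simp add: norm_minus_commute)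
  have s_int: "(\<integral>v. s v \<partial>\<mu>) = (potential z + potential (- z)) / 2 - potential 0"
    unfolding s_def using i[of z] i[of "- z"] i[of 0] comm[of z] comm[of "- z"] comm[of 0] by simp
  define l where "l = - (R powr (- q / 2))"
  \<comment> \<open>The indices \<open>Inr 0\<close>, \<open>Inr 1\<close> and \<open>Inr 2\<close> stand for the origin, \<open>z\<close> and \<open>- z\<close>.\<close>
  define c :: "nat + nat \<Rightarrow> real" where "c = case_sum (\<lambda>_. 1 / real N) (\<lambda>k. if k = 0 then - l else l / 2)"
  define x :: "nat + nat \<Rightarrow> 'a" where "x = case_sum y (\<lambda>k. if k = 0 then 0 else if k = 1 then z else - z)"
  define I where "I = {1..N} <+> {0, 1, 2 :: nat}"
  have I: "finite I" by (simp add: I_def)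
  have sumI: "(\<Sum>k\<in>I. g k) = (\<Sum>i\<in>{1..N}. g (Inl i)) + (g (Inr 0) + g (Inr 1) + g (Inr 2))" for g :: "_ \<Rightarrow> real"
    unfolding I_def by (subst sum.Plus) auto
  have "(\<Sum>k\<in>I. c k) = 1" unfolding sumI using N by (simp add: c_def)
  from energy_distance_nonneg[OF q prob_space_axioms sets_target moment I this, of x]
  have main: "(\<Sum>k\<in>I. \<Sum>m\<in>I. c k * c m * norm (x k - x m) powr q) + (\<integral>u. potential u \<partial>\<mu>)
      \<le> 2 * (\<Sum>k\<in>I. c k * potential (x k))"
    by (simp add: potential_def)
  define S where "S = (\<Sum>i\<in>{1..N}. s (y i))"
  define P where "P = (\<Sum>i\<in>{1..N}. potential (y i))"
  have right: "(\<Sum>k\<in>I. c k * potential (x k)) = (1 / real N) * P + l * (\<integral>v. s v \<partial>\<mu>)"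
    unfolding sumI s_int P_def by (simp add: c_def x_def sum_distrib_left algebra_simps add_divide_distrib diff_divide_distrib)
  have rows: "(\<Sum>m\<in>I. c m * norm (w - x m) powr q) = (1 / real N) * (\<Sum>i\<in>{1..N}. norm (w - y i) powr q) + l * s w" for w
    unfolding sumI by (simp add: c_def x_def s_def sum_distrib_left algebra_simps add_divide_distrib diff_divide_distrib)
  have s_vals: "s 0 = R powr q" "s z = (2 * R) powr q / 2 - R powr q" "s (- z) = (2 * R) powr q / 2 - R powr q"
  proof -
    have 1: "norm (z + z) = 2 * R" using nz R by (simp flip: scaleR_2)
    have "- z - z = - (z + z)" by simp
    hence "norm (- z - z) = 2 * R" using 1 by (simp only: norm_minus_cancel)
    with 1 show "s 0 = R powr q" "s z = (2 * R) powr q / 2 - R powr q" "s (- z) = (2 * R) powr q / 2 - R powr q"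
      using nz q by (simp_all add: s_def)
  qed
  have left: "(\<Sum>k\<in>I. \<Sum>m\<in>I. c k * c m * norm (x k - x m) powr q)
      = (1 / real N ^ 2) * pair_sum q N y + 2 * (l / real N) * S + l\<^sup>2 * ((2 * R) powr q / 2 - 2 * R powr q)"
  proof -
    have "(\<Sum>k\<in>I. \<Sum>m\<in>I. c k * c m * norm (x k - x m) powr q) = (\<Sum>k\<in>I. c k * (\<Sum>m\<in>I. c m * norm (x k - x m) powr q))"
      by (simp add: sum_distrib_left mult_ac)
    also have "\<dots> = (\<Sum>i\<in>{1..N}. (1 / real N) * ((1 / real N) * (\<Sum>j\<in>{1..N}. norm (y i - y j) powr q) + l * s (y i)))
        + (- l * ((1 / real N) * (\<Sum>i\<in>{1..N}. norm (0 - y i) powr q) + l * s 0)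
        + l / 2 * ((1 / real N) * (\<Sum>i\<in>{1..N}. norm (z - y i) powr q) + l * s z)
        + l / 2 * ((1 / real N) * (\<Sum>i\<in>{1..N}. norm (- z - y i) powr q) + l * s (- z)))"
      unfolding rows unfolding sumI by (simp add: c_def x_def)
    also have "(\<Sum>i\<in>{1..N}. (1 / real N) * ((1 / real N) * (\<Sum>j\<in>{1..N}. norm (y i - y j) powr q) + l * s (y i)))
        = (1 / real N ^ 2) * pair_sum q N y + (l / real N) * S"
      by (simp add: pair_sum_def S_def sum.distrib sum_distrib_left algebra_simps power2_eq_square sum_divide_distrib add_divide_distrib)
    also have "- l * ((1 / real N) * (\<Sum>i\<in>{1..N}. norm (0 - y i) powr q) + l * s 0)
        + l / 2 * ((1 / real N) * (\<Sum>i\<in>{1..N}. norm (z - y i) powr q) + l * s z)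
        + l / 2 * ((1 / real N) * (\<Sum>i\<in>{1..N}. norm (- z - y i) powr q) + l * s (- z))
        = (l / real N) * S + l\<^sup>2 * ((2 * R) powr q / 2 - 2 * R powr q)"
    proof -
      have sw: "norm (z - y i) = norm (y i - z)" "norm (- z - y i) = norm (y i + z)" "norm (0 - y i) = norm (y i)" for i
        using norm_minus_commute norm_minus_cancel[of "y i + z"] by (auto simp: algebra_simps)
      define a b d where "a = (\<Sum>i\<in>{1..N}. norm (y i + z) powr q)"
        and "b = (\<Sum>i\<in>{1..N}. norm (y i - z) powr q)" and "d = (\<Sum>i\<in>{1..N}. norm (y i) powr q)"
      have S_eq: "S = (a + b) / 2 - d"
        by (simp add: S_def s_def a_def b_def d_def sum_subtractf sum.distrib sum_divide_distrib[symmetric])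
      show ?thesis
        unfolding sw s_vals a_def[symmetric] b_def[symmetric] d_def[symmetric] S_eq
        by (simp add: algebra_simps power2_eq_square add_divide_distrib diff_divide_distrib)
    qed
    finally show ?thesis by simp
  qed
  have l2: "l\<^sup>2 * R powr q = 1"
  proof -
    have "l\<^sup>2 = R powr (- q / 2) * R powr (- q / 2)" by (simp add: l_def power2_eq_square)
    hence "l\<^sup>2 * R powr q = R powr (- q / 2 + - q / 2 + q)" by (simp only: powr_add)
    thus ?thesis using R by simp
  qed
  have "l\<^sup>2 * ((2 * R) powr q / 2 - 2 * R powr q) = (l\<^sup>2 * R powr q) * (2 powr q / 2 - 2)"
    by (simp add: powr_mult algebra_simps)
  also have "\<dots> \<ge> - 2" unfolding l2 by simp
  finally have l3: "- 2 \<le> l\<^sup>2 * ((2 * R) powr q / 2 - 2 * R powr q)" .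
  have E: "2 * particle_energy q \<mu> N y = - (1 / real N ^ 2) * pair_sum q N y + (2 / real N) * P - (\<integral>u. potential u \<partial>\<mu>)"
    unfolding particle_energy_eq[OF N] P_def by simp
  have "(1 / real N ^ 2) * pair_sum q N y + 2 * (l / real N) * S + l\<^sup>2 * ((2 * R) powr q / 2 - 2 * R powr q) + (\<integral>u. potential u \<partial>\<mu>)
      \<le> 2 * ((1 / real N) * P + l * (\<integral>v. s v \<partial>\<mu>))"
    using main unfolding left right .
  hence fin: "- l * ((\<integral>v. s v \<partial>\<mu>) - (1 / real N) * S) \<le> particle_energy q \<mu> N y + 1"
    using l3 E by (simp add: algebra_simps)
  have "- l * R powr q = R powr (q / 2)"
    using R by (simp add: l_def flip: powr_add)
  moreover have "(\<integral>v. s v \<partial>\<mu>) - (1 / real N) * S = R powr q * ((\<integral>v. second_diff q e ((1 / R) *\<^sub>R v) \<partial>\<mu>)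
      - (1 / real N) * (\<Sum>i\<in>{1..N}. second_diff q e ((1 / R) *\<^sub>R y i)))"
    by (simp add: S_def s_eq algebra_simps flip: sum_distrib_left)
  ultimately show ?thesis using fin by (metis mult.assoc)
qed

text \<open>
  The function \<open>1 - second_diff q e\<close> is nonnegative, at least \<open>1 / 2\<close> at distance \<open>2 powr (1 / (2 - q))\<close> and beyond, and
  at most \<open>2 \<bar>u\<bar>\<^sup>q\<close>. So its rescaled mean dominates the fraction of particles far out, whereas
  the mean with respect to \<open>\<mu>\<close> is \<open>O(R powr (- q))\<close>.
\<close>
lemma empirical_tail_bound:
  assumes N: "0 < N" and E: "particle_energy q \<mu> N y \<le> E0" and R: "1 \<le> R"
  shows "measure (empirical N y) {x. 2 powr (1 / (2 - q)) * R \<le> norm x}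
    \<le> 2 * (2 * (\<integral>v. norm v powr q \<partial>\<mu>) + E0 + 1) * R powr (- q / 2)"
proof -
  obtain e :: 'a where e: "norm e = 1" using vector_choose_size[of 1] by auto
  define m where "m = (\<integral>v. norm v powr q \<partial>\<mu>)"
  have m: "0 \<le> m" by (simp add: m_def)
  define h where "h u = second_diff q e ((1 / R) *\<^sub>R u)" for u
  have h1: "h u \<le> 1" for u unfolding h_def by (rule second_diff_le_1[OF q e])
  have [measurable]: "h \<in> borel_measurable borel" unfolding h_def second_diff_def by measurable
  have lower: "1 - 2 * R powr (- q) * norm v powr q \<le> h v" for v
  proof -
    have "norm ((1 / R) *\<^sub>R v) powr q = norm v powr q / R powr q"
      using R by (simp add: powr_divide)
    hence "norm ((1 / R) *\<^sub>R v) powr q = R powr (- q) * norm v powr q"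
      by (simp add: powr_minus_divide)
    thus ?thesis using second_diff_lower[OF q e, of "(1 / R) *\<^sub>R v"] by (simp add: h_def)
  qed
  have far: "1 / 2 \<le> 1 - h u" if "2 powr (1 / (2 - q)) * R \<le> norm u" for u
  proof -
    have le: "2 powr (1 / (2 - q)) \<le> norm ((1 / R) *\<^sub>R u)"
      using that R by (simp add: field_simps)
    hence "0 < norm ((1 / R) *\<^sub>R u)" by (rule less_le_trans[rotated]) simp
    hence "h u \<le> norm ((1 / R) *\<^sub>R u) powr (q - 2)"
      unfolding h_def by (intro second_diff_decay[OF q e]) auto
    also have "\<dots> \<le> (2 powr (1 / (2 - q))) powr (q - 2)"
      using le q by (intro powr_mono2') auto
    also have "\<dots> = 2 powr (- 1)"
    proof -
      have "1 / (2 - q) * (q - 2) = - 1" using q by (simp add: field_simps)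
      thus ?thesis by (simp only: powr_powr)
    qed
    finally show ?thesis by (simp add: powr_minus)
  qed
  have h_int: "integrable \<mu> h"
  proof (rule Bochner_Integration.integrable_bound[of \<mu> "\<lambda>v. 1 + 2 * R powr (- q) * norm v powr q"])
    show "AE v in \<mu>. norm (h v) \<le> norm (1 + 2 * R powr (- q) * norm v powr q)"
    proof (rule AE_I2)
      fix v :: 'a
      have "0 \<le> 2 * R powr (- q) * norm v powr q" by simp
      thus "norm (h v) \<le> norm (1 + 2 * R powr (- q) * norm v powr q)"
        using h1[of v] lower[of v] unfolding real_norm_def by linarith
    qed
  qed (use moment in auto)
  have "(\<integral>v. 1 - 2 * R powr (- q) * norm v powr q \<partial>\<mu>) \<le> (\<integral>v. h v \<partial>\<mu>)"
    using moment h_int lower by (intro integral_mono) auto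
  hence mean: "1 - 2 * R powr (- q) * m \<le> (\<integral>v. h v \<partial>\<mu>)"
    using moment by (simp add: m_def)
  have main: "R powr (q / 2) * ((\<integral>v. h v \<partial>\<mu>) - (1 / real N) * (\<Sum>i\<in>{1..N}. h (y i))) \<le> E0 + 1"
    using second_diff_average_le[OF N _ e, of R y] R E by (simp add: h_def)
  have "(1 / real N) * (\<Sum>i\<in>{1..N}. 1 - h (y i)) \<le> 2 * R powr (- q) * m + R powr (- q / 2) * (E0 + 1)"
  proof -
    have "R powr (- q / 2) * (R powr (q / 2) * ((\<integral>v. h v \<partial>\<mu>) - (1 / real N) * (\<Sum>i\<in>{1..N}. h (y i)))) \<le> R powr (- q / 2) * (E0 + 1)"
      using main by (intro mult_left_mono) auto
    moreover have cancel: "R powr (- q / 2) * (R powr (q / 2) * D) = D" for D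
      using R by (simp add: mult.assoc[symmetric] flip: powr_add)
    ultimately have "(\<integral>v. h v \<partial>\<mu>) - (1 / real N) * (\<Sum>i\<in>{1..N}. h (y i)) \<le> R powr (- q / 2) * (E0 + 1)"
      by (simp only: cancel)
    moreover have "(1 / real N) * (\<Sum>i\<in>{1..N}. 1 - h (y i)) = 1 - (1 / real N) * (\<Sum>i\<in>{1..N}. h (y i))"
      using N by (simp add: sum_subtractf field_simps)
    ultimately show ?thesis using mean by linarith
  qed
  also have "2 * R powr (- q) * m \<le> 2 * R powr (- q / 2) * m"
    using R q m by (intro mult_right_mono mult_left_mono powr_mono) auto
  finally have avg: "(1 / real N) * (\<Sum>i\<in>{1..N}. 1 - h (y i)) \<le> (2 * m + E0 + 1) * R powr (- q / 2)"
    by (simp add: algebra_simps)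
  define A where "A = {x :: 'a. 2 powr (1 / (2 - q)) * R \<le> norm x}"
  have [measurable]: "A \<in> sets borel" unfolding A_def by measurable
  interpret em: prob_space "empirical N y" using N by (rule prob_space_empirical)
  have "measure (empirical N y) A = (\<integral>x. indicator A x \<partial>empirical N y)" by simp
  also have "\<dots> = (1 / real N) *\<^sub>R (\<Sum>i\<in>{1..N}. indicator A (y i))" by (rule integral_empirical) measurable
  also have "\<dots> \<le> (1 / real N) * (\<Sum>i\<in>{1..N}. 2 * (1 - h (y i)))"
    unfolding real_scaleR_def
  proof (intro mult_left_mono sum_mono)
    fix i
    show "indicator A (y i) \<le> 2 * (1 - h (y i))"
      using far[of "y i"] h1[of "y i"] by (auto simp: A_def indicator_def)
  qed auto
  also have "\<dots> = 2 * ((1 / real N) * (\<Sum>i\<in>{1..N}. 1 - h (y i)))"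
    unfolding sum_distrib_left[symmetric] by (rule mult.left_commute)
  also have "\<dots> \<le> 2 * ((2 * m + E0 + 1) * R powr (- q / 2))" using avg by simp
  finally show ?thesis by (simp only: A_def m_def mult.assoc)
qed

lemma empirical_moment_bound:
  assumes s: "0 < s" "s < q / 2"
  obtains C where "\<And>N y. 0 < N \<Longrightarrow> particle_energy q \<mu> N y \<le> E0 \<Longrightarrow>
    (\<integral>\<^sup>+x. ennreal (norm x powr s) \<partial>empirical N y) \<le> ennreal C"
proof -
  define L where "L = 2 powr (1 / (2 - q))"
  have L: "0 < L" by (simp add: L_def)
  define K where "K = 2 * (2 * (\<integral>v. norm v powr q \<partial>\<mu>) + max E0 0 + 1)"
  have K: "0 \<le> K" by (simp add: K_def)
  define C where "C = 1 + K * 2 powr s / (1 - 2 powr (s - q / 2))"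
  have "(\<integral>\<^sup>+x. ennreal (norm x powr s) \<partial>empirical N y) \<le> ennreal (L powr s * max C 0)"
    if N: "0 < N" and E: "particle_energy q \<mu> N y \<le> E0" for N y
  proof -
    have "(\<integral>\<^sup>+x. ennreal ((norm x / L) powr s) \<partial>empirical N y) \<le> ennreal C"
      unfolding C_def
    proof (rule moment_from_tail[OF prob_space_empirical[OF N]])
      fix n :: nat
      have "{x \<in> space (empirical N y). 2 ^ n \<le> norm x / L} = {x. L * 2 ^ n \<le> norm x}"
        using L by (auto simp: empirical_def field_simps)
      moreover have "measure (empirical N y) {x. L * 2 ^ n \<le> norm x} \<le> K * (2 ^ n) powr (- q / 2)"
        unfolding L_def K_def using E by (intro empirical_tail_bound N) auto
      moreover have "(2 ^ n) powr (- q / 2) = 2 powr (- (q / 2) * real n)"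
        by (simp add: powr_powr mult.commute flip: powr_realpow)
      ultimately show "measure (empirical N y) {x \<in> space (empirical N y). 2 ^ n \<le> norm x / L} \<le> K * 2 powr (- (q / 2) * real n)"
        by simp
    qed (use s K L in auto)
    moreover have "norm x powr s = L powr s * (norm x / L) powr s" for x :: 'a
      using L by (simp add: powr_divide)
    ultimately have "(\<integral>\<^sup>+x. ennreal (norm x powr s) \<partial>empirical N y) \<le> ennreal (L powr s) * ennreal C"
      by (simp add: ennreal_mult nn_integral_cmult mult_left_mono)
    also have "\<dots> \<le> ennreal (L powr s) * ennreal (max C 0)"
      by (intro mult_left_mono ennreal_leI) auto
    finally show ?thesis by (simp add: ennreal_mult)
  qed
  thus ?thesis using that by blast
qed

end


section \<open>Narrow compactness of empirical measures\<close>

text \<open>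
  The first digit \<open>j\<close> at which the expansions differ contributes \<open>3 powr (- j)\<close>, and all later digits
  together contribute at most half of that.
\<close>
lemma ternary_digits_agree:
  fixes a b :: "nat \<Rightarrow> bool"
  assumes close: "\<bar>(\<Sum>k. of_bool (a k) / 3 ^ k) - (\<Sum>k. of_bool (b k) / 3 ^ k)\<bar> < 1 / (2 * 3 ^ n :: real)"
    and k: "k \<le> n"
  shows "a k = b k"
proof (rule ccontr)
  assume "a k \<noteq> b k"
  define j where "j = (LEAST j. a j \<noteq> b j)"
  have j: "a j \<noteq> b j" unfolding j_def using \<open>a k \<noteq> b k\<close> by (rule LeastI)
  have "j \<le> n" using Least_le[of "\<lambda>j. a j \<noteq> b j", OF \<open>a k \<noteq> b k\<close>] k by (simp add: j_def)
  have before: "a i = b i" if "i < j" for i using not_less_Least[OF that[unfolded j_def]] by simp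
  define d where "d i = (of_bool (a i) - of_bool (b i)) / (3 ^ i :: real)" for i :: nat
  have geo: "(\<lambda>i. 1 / 3 ^ i :: real) sums (3 / 2)"
    using geometric_sums[of "1 / 3 :: real"] by (simp add: power_one_over field_simps)
  have summ: "summable (\<lambda>i. of_bool (c i) / 3 ^ i :: real)" for c :: "nat \<Rightarrow> bool"
    by (rule summable_comparison_test'[OF sums_summable[OF geo], of 0]) auto
  have d_le: "\<bar>d i\<bar> \<le> 1 / 3 ^ i" for i by (auto simp: d_def)
  have d_summ: "summable d"
    by (rule summable_comparison_test'[OF sums_summable[OF geo], of 0]) (use d_le in auto)
  have "(\<Sum>k. of_bool (a k) / 3 ^ k) - (\<Sum>k. of_bool (b k) / 3 ^ k) = (\<Sum>i. d i)"
    unfolding d_def diff_divide_distrib by (rule suminf_diff[OF summ summ])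
  also have "\<dots> = (\<Sum>i. d (i + Suc j)) + (\<Sum>i<Suc j. d i)"
    by (rule suminf_split_initial_segment[OF d_summ])
  also have "(\<Sum>i<Suc j. d i) = d j" using before by (simp add: d_def)
  finally have eq: "(\<Sum>k. of_bool (a k) / 3 ^ k) - (\<Sum>k. of_bool (b k) / 3 ^ k) = (\<Sum>i. d (i + Suc j)) + d j" .
  have tail: "(\<lambda>i. 1 / 3 ^ (i + Suc j) :: real) sums (1 / (2 * 3 ^ j))"
    using sums_divide[OF geo, of "3 ^ Suc j"] by (simp add: power_add field_simps)
  have s: "summable (\<lambda>i. \<bar>d (i + Suc j)\<bar>)"
    by (rule summable_rabs_comparison_test[OF _ sums_summable[OF tail]]) (use d_le in blast)
  have "\<bar>\<Sum>i. d (i + Suc j)\<bar> \<le> (\<Sum>i. 1 / 3 ^ (i + Suc j))"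
    by (rule order_trans[OF summable_rabs[OF s] suminf_le[OF d_le s sums_summable[OF tail]]])
  also have "\<dots> = 1 / (2 * 3 ^ j)" using tail by (rule sums_unique[symmetric])
  finally have t: "\<bar>\<Sum>i. d (i + Suc j)\<bar> \<le> 1 / (2 * 3 ^ j)" .
  have "\<bar>d j\<bar> = 2 * (1 / (2 * 3 ^ j))" using j by (auto simp: d_def)
  hence "1 / (2 * 3 ^ j) \<le> \<bar>(\<Sum>i. d (i + Suc j)) + d j\<bar>"
    using t by linarith
  moreover have "1 / (2 * 3 ^ n) \<le> (1 / (2 * 3 ^ j) :: real)"
    using \<open>j \<le> n\<close> by (intro divide_left_mono mult_left_mono power_increasing) auto
  ultimately show False using close unfolding eq by linarith
qed

text \<open>
  Points of \<open>'a\<close> are encoded as reals: the integer part of \<open>\<kappa> x\<close> records the size of \<open>x\<close> and the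
  ternary digits of the fractional part record which members of a countable basis contain \<open>x\<close>. The encoding is not
  continuous, but it has a locally uniformly continuous inverse, which is what is needed to pull
  convergence back.
\<close>
lemma ex_real_encoding:
  obtains \<kappa> :: "'a::euclidean_space \<Rightarrow> real" where
    "\<And>x. norm x - 1 \<le> \<kappa> x" "\<And>x. \<kappa> x \<le> norm x + 1"
    "\<And>R e. 0 < e \<Longrightarrow> \<exists>d>0. \<forall>x x'. norm x \<le> R \<longrightarrow> \<bar>\<kappa> x - \<kappa> x'\<bar> < d \<longrightarrow> dist x x' < e"
proof -
  obtain \<B> :: "'a set set" where \<B>: "countable \<B>" "topological_basis \<B>"
    using ex_countable_basis by blast
  define A where "A n = from_nat_into \<B> n" for n
  have "\<B> \<noteq> {}" using topological_basisE[OF \<B>(2) open_UNIV UNIV_I] by blast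
  have A_range: "range A = \<B>" unfolding A_def using \<B>(1) \<open>\<B> \<noteq> {}\<close> by (rule range_from_nat_into[rotated])
  have A_open: "open (A n)" for n using A_range \<B>(2) topological_basis_open by blast
  have A_basis: "\<exists>n. x \<in> A n \<and> A n \<subseteq> U" if "open U" "x \<in> U" for x U
    using topological_basisE[OF \<B>(2) that] A_range by (metis imageE)
  define c where "c x = (\<Sum>k. of_bool (x \<in> A k) / 3 ^ k :: real)" for x
  have geo: "(\<lambda>i. 1 / 3 ^ i :: real) sums (3 / 2)"
    using geometric_sums[of "1 / 3 :: real"] by (simp add: power_one_over field_simps)
  have summ: "summable (\<lambda>i. of_bool (x \<in> A i) / 3 ^ i :: real)" for x
    by (rule summable_comparison_test'[OF sums_summable[OF geo], of 0]) auto
  have c: "0 \<le> c x" "c x \<le> 3 / 2" for x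
  proof -
    show "0 \<le> c x" unfolding c_def by (intro suminf_nonneg summ) auto
    have "c x \<le> (\<Sum>i. 1 / 3 ^ i)" unfolding c_def by (intro suminf_le summ sums_summable[OF geo]) auto
    thus "c x \<le> 3 / 2" using sums_unique[OF geo] by simp
  qed
  \<comment> \<open>As \<open>c x / 4 \<le> 3 / 8\<close>, codes with different integer parts are more than \<open>1 / 2\<close> apart.\<close>
  define \<kappa> where "\<kappa> x = of_int \<lfloor>norm x\<rfloor> + c x / 4" for x :: 'a
  have "norm x - 1 \<le> \<kappa> x" "\<kappa> x \<le> norm x + 1" for x
    using c[of x] by (auto simp: \<kappa>_def) linarith+
  moreover have "\<exists>d>0. \<forall>x x'. norm x \<le> R \<longrightarrow> \<bar>\<kappa> x - \<kappa> x'\<bar> < d \<longrightarrow> dist x x' < e" if e: "0 < e" for R e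
  proof -
    define I where "I = {n. \<forall>u\<in>A n. \<forall>v\<in>A n. dist u v < e}"
    have "cball 0 R \<subseteq> (\<Union>n\<in>I. A n)"
    proof
      fix x :: 'a
      obtain n where n: "x \<in> A n" "A n \<subseteq> ball x (e / 2)"
        using A_basis[of "ball x (e / 2)" x] e by auto
      have "n \<in> I" unfolding I_def
      proof (intro CollectI ballI)
        fix u v assume "u \<in> A n" "v \<in> A n"
        with n(2) have "u \<in> ball x (e / 2)" "v \<in> ball x (e / 2)" by auto
        thus "dist u v < e" using dist_triangle[of u v x] by (simp add: dist_commute)
      qed
      thus "x \<in> (\<Union>n\<in>I. A n)" using n(1) by blast
    qed
    then obtain J where J: "J \<subseteq> I" "finite J" "cball 0 R \<subseteq> (\<Union>n\<in>J. A n)"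
      using compactE_image[OF compact_cball, of I A 0 R] A_open by metis
    define m where "m = Max (insert 0 J)"
    have m: "n \<le> m" if "n \<in> J" for n using that J(2) by (simp add: m_def)
    define d where "d = 1 / (8 * 3 ^ m :: real)"
    have d: "0 < d" "d \<le> 1 / 8" by (simp_all add: d_def field_simps)
    have "dist x x' < e" if x: "norm x \<le> R" and close: "\<bar>\<kappa> x - \<kappa> x'\<bar> < d" for x x'
    proof -
      have "\<lfloor>norm x\<rfloor> = \<lfloor>norm x'\<rfloor>"
      proof (rule ccontr)
        assume "\<lfloor>norm x\<rfloor> \<noteq> \<lfloor>norm x'\<rfloor>"
        hence "1 \<le> \<bar>real_of_int \<lfloor>norm x\<rfloor> - real_of_int \<lfloor>norm x'\<rfloor>\<bar>" by linarith
        moreover have "\<bar>c x / 4 - c x' / 4\<bar> \<le> 3 / 8" using c[of x] c[of x'] by (intro abs_leI) linarith+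
        ultimately show False using close d(2) unfolding \<kappa>_def by linarith
      qed
      hence "\<bar>c x - c x'\<bar> < 4 * d" using close unfolding \<kappa>_def by linarith
      hence cc: "\<bar>c x - c x'\<bar> < 1 / (2 * 3 ^ m)" by (simp add: d_def)
      obtain n where n: "n \<in> J" "x \<in> A n" using J(3) x by (auto simp: subset_iff)
      have "(x \<in> A n) = (x' \<in> A n)"
        using ternary_digits_agree[OF cc[unfolded c_def] m[OF n(1)]] .
      thus ?thesis using n J(1) by (auto simp: I_def)
    qed
    thus ?thesis using d(1) by blast
  qed
  ultimately show ?thesis using that by blast
qed

lemma measure_empirical:
  assumes N: "0 < N" and [measurable]: "A \<in> sets borel"
  shows "measure (empirical N x) A = (1 / real N) * (\<Sum>i\<in>{1..N}. indicator A (x i))"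
proof -
  interpret prob_space "empirical N x" using N by (rule prob_space_empirical)
  have "measure (empirical N x) A = (\<integral>z. indicator A z \<partial>empirical N x)" by simp
  also have "\<dots> = (1 / real N) *\<^sub>R (\<Sum>i\<in>{1..N}. indicator A (x i))" by (rule integral_empirical) measurable
  finally show ?thesis by simp
qed

lemma distr_empirical:
  fixes x :: "nat \<Rightarrow> 'a::euclidean_space" and g :: "'a \<Rightarrow> 'b::euclidean_space"
  assumes [measurable]: "g \<in> borel_measurable borel"
  shows "distr (empirical N x) borel g = empirical N (\<lambda>i. g (x i))"
proof -
  have "x \<in> measurable (uniform_count_measure {1..N}) borel"
    by (auto simp: measurable_def space_uniform_count_measure sets_uniform_count_measure)
  thus ?thesis
    unfolding empirical_def by (subst distr_distr) (auto simp: comp_def)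
qed

lemma empirical_cong: "(\<And>i. i \<in> {1..N} \<Longrightarrow> x i = y i) \<Longrightarrow> empirical N x = empirical N y"
  unfolding empirical_def by (intro distr_cong) (auto simp: space_uniform_count_measure)

text \<open>
  Prokhorov's and Skorohod's theorems in one: on the real line they are applied to the encoded
  configurations, and the almost sure limit is decoded.
\<close>
lemma empirical_skorohod:
  fixes y :: "nat \<Rightarrow> nat \<Rightarrow> 'a::euclidean_space"
  assumes N: "\<And>k. 0 < N k"
    and tail: "\<And>e. 0 < e \<Longrightarrow> \<exists>R. \<forall>k. measure (empirical (N k) (y k)) {x. R \<le> norm x} \<le> e"
  obtains r :: "nat \<Rightarrow> nat" and \<Omega> :: "real measure" and V :: "nat \<Rightarrow> real \<Rightarrow> 'a" and W :: "real \<Rightarrow> 'a"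
  where "strict_mono r" "prob_space \<Omega>" "\<And>k. V k \<in> borel_measurable \<Omega>" "W \<in> borel_measurable \<Omega>"
    "\<And>k. distr \<Omega> borel (V k) = empirical (N (r k)) (y (r k))"
    "AE \<omega> in \<Omega>. (\<lambda>k. V k \<omega>) \<longlonglongrightarrow> W \<omega>"
proof -
  obtain \<kappa> :: "'a \<Rightarrow> real" where \<kappa>: "\<And>x. norm x - 1 \<le> \<kappa> x" "\<And>x. \<kappa> x \<le> norm x + 1"
    and inv: "\<And>R e. 0 < e \<Longrightarrow> \<exists>d>0. \<forall>x x'. norm x \<le> R \<longrightarrow> \<bar>\<kappa> x - \<kappa> x'\<bar> < d \<longrightarrow> dist x x' < e"
    using ex_real_encoding by metis
  have inj: "x = x'" if "\<kappa> x = \<kappa> x'" for x x'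
  proof (rule ccontr)
    assume "x \<noteq> x'"
    then obtain d where "0 < d" "\<And>z z'. norm z \<le> norm x \<Longrightarrow> \<bar>\<kappa> z - \<kappa> z'\<bar> < d \<Longrightarrow> dist z z' < dist x x'"
      using inv[of "dist x x'" "norm x"] by auto
    from this(1) this(2)[of x x'] that show False by simp
  qed
  define M where "M k = empirical (N k) (\<lambda>i. \<kappa> (y k i))" for k
  have M: "real_distribution (M k)" for k
    unfolding M_def real_distribution_def real_distribution_axioms_def
    using N by (auto intro: prob_space_empirical)
  have "tight M"
    unfolding tight_def
  proof (intro conjI allI impI M)
    fix e :: real assume e: "0 < e"
    obtain R where R: "\<And>k. measure (empirical (N k) (y k)) {x. R \<le> norm x} \<le> e / 2"
      using tail[of "e / 2"] e by auto
    define b where "b = max R 0 + 1"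
    have "1 - e < measure (M k) {- 2<..b}" for k
    proof -
      interpret em: prob_space "empirical (N k) (y k)" using N by (rule prob_space_empirical)
      have sp: "space (empirical (N k) (y k)) = UNIV" by (simp add: empirical_def)
      have "1 - e < 1 - measure (empirical (N k) (y k)) {x. R \<le> norm x}" using R[of k] e by linarith
      also have "\<dots> = measure (empirical (N k) (y k)) (UNIV - {x. R \<le> norm x})"
        using em.prob_compl[of "{x. R \<le> norm x}"] by (simp add: sp)
      also have "UNIV - {x. R \<le> norm x} = {x :: 'a. norm x < R}" by auto
      also have "measure (empirical (N k) (y k)) {x. norm x < R} \<le> measure (M k) {- 2<..b}"
        unfolding M_def using N[of k]
      proof (subst (1 2) measure_empirical)
        show "1 / real (N k) * (\<Sum>i\<in>{1..N k}. indicator {x. norm x < R} (y k i))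
            \<le> 1 / real (N k) * (\<Sum>i\<in>{1..N k}. indicator {- 2<..b} (\<kappa> (y k i)))"
        proof (intro mult_left_mono sum_mono)
          fix i
          have "\<kappa> (y k i) \<in> {- 2<..b}" if "norm (y k i) < R"
            using that \<kappa>(1)[of "y k i"] \<kappa>(2)[of "y k i"] norm_ge_zero[of "y k i"] unfolding b_def
            by (simp only: greaterThanAtMost_iff) linarith
          thus "indicator {x. norm x < R} (y k i) \<le> (indicator {- 2<..b} (\<kappa> (y k i)) :: real)"
            by (auto simp: indicator_def)
        qed simp
      qed auto
      finally show ?thesis .
    qed
    thus "\<exists>a b. a < b \<and> (\<forall>k. 1 - e < measure (M k) {a<..b})"
      by (intro exI[of _ "- 2"] exI[of _ b]) (auto simp: b_def)
  qed
  from tight_imp_convergent_subsubsequence[OF this strict_mono_id]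
  obtain r L where r: "strict_mono r" "real_distribution L" "weak_conv_m (M \<circ> id \<circ> r) L" by blast
  have Mr: "real_distribution ((M \<circ> id \<circ> r) k)" for k using M by simp
  from Skorohod[OF Mr r(2,3)]
  obtain \<Omega> :: "real measure" and Z :: "nat \<Rightarrow> real \<Rightarrow> real" and Z' :: "real \<Rightarrow> real" where
    sk: "prob_space \<Omega>" "\<forall>k. Z k \<in> borel_measurable \<Omega>" "\<forall>k. distr \<Omega> borel (Z k) = (M \<circ> id \<circ> r) k"
      "\<forall>\<omega>\<in>space \<Omega>. (\<lambda>k. Z k \<omega>) \<longlonglongrightarrow> Z' \<omega>"
    by blast
  hence \<Omega>: "prob_space \<Omega>" "\<And>k. Z k \<in> borel_measurable \<Omega>" "\<And>k. distr \<Omega> borel (Z k) = M (r k)"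
      "\<And>\<omega>. \<omega> \<in> space \<Omega> \<Longrightarrow> (\<lambda>k. Z k \<omega>) \<longlonglongrightarrow> Z' \<omega>"
    by (auto simp: comp_def)
  note [measurable] = \<Omega>(2)
  define P where "P k = y (r k) ` {1..N (r k)}" for k
  have P: "finite (P k)" for k by (simp add: P_def)
  \<comment> \<open>Decodes the codes of the finitely many points of the \<open>k\<close>-th configuration.\<close>
  define g where "g k z = (\<Sum>v\<in>P k. indicator {\<kappa> v} z *\<^sub>R v)" for k z
  have [measurable]: "g k \<in> borel_measurable borel" for k unfolding g_def by measurable
  have g: "g k (\<kappa> v) = v" if "v \<in> P k" for k v
  proof -
    have "g k (\<kappa> v) = (\<Sum>w\<in>P k. if w = v then v else 0)"
      unfolding g_def by (intro sum.cong) (auto simp: indicator_def dest: inj)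
    thus ?thesis using that P by simp
  qed
  define V where "V k \<omega> = g k (Z k \<omega>)" for k \<omega>
  have V_meas [measurable]: "V k \<in> borel_measurable \<Omega>" for k unfolding V_def by measurable
  define W where "W \<omega> = lim (\<lambda>k. V k \<omega>)" for \<omega>
  have W_meas: "W \<in> borel_measurable \<Omega>" unfolding W_def by measurable
  have law: "distr \<Omega> borel (V k) = empirical (N (r k)) (y (r k))" for k
  proof -
    have "distr \<Omega> borel (V k) = distr (distr \<Omega> borel (Z k)) borel (g k)"
      unfolding V_def by (subst distr_distr) (auto simp: comp_def)
    also have "\<dots> = empirical (N (r k)) (\<lambda>i. g k (\<kappa> (y (r k) i)))"
      unfolding \<Omega>(3) M_def by (rule distr_empirical) measurable
    also have "\<dots> = empirical (N (r k)) (y (r k))"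
      by (intro empirical_cong g) (auto simp: P_def)
    finally show ?thesis .
  qed
  have "AE \<omega> in \<Omega>. \<forall>k. Z k \<omega> \<in> \<kappa> ` P k"
    unfolding AE_all_countable
  proof
    fix k
    have [measurable]: "\<kappa> ` P k \<in> sets borel" using P by (intro borel_closed finite_imp_closed) auto
    interpret Mk: prob_space "M (r k)" unfolding M_def using N by (rule prob_space_empirical)
    have "measure (M (r k)) (\<kappa> ` P k) = 1"
    proof -
      have "(\<Sum>i\<in>{1..N (r k)}. indicator (\<kappa> ` P k) (\<kappa> (y (r k) i))) = (\<Sum>i\<in>{1..N (r k)}. 1 :: real)"
        by (intro sum.cong) (auto simp: P_def)
      thus ?thesis unfolding M_def using N[of "r k"] by (subst measure_empirical) auto
    qed
    hence "AE z in M (r k). z \<in> \<kappa> ` P k" by (intro Mk.AE_prob_1)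
    hence "AE z in distr \<Omega> borel (Z k). z \<in> \<kappa> ` P k" by (simp only: \<Omega>(3))
    thus "AE \<omega> in \<Omega>. Z k \<omega> \<in> \<kappa> ` P k" by (subst (asm) AE_distr_iff) auto
  qed
  moreover have "AE \<omega> in \<Omega>. (\<lambda>k. Z k \<omega>) \<longlonglongrightarrow> Z' \<omega>" using \<Omega>(4) by (intro AE_I2)
  ultimately have lim: "AE \<omega> in \<Omega>. (\<lambda>k. V k \<omega>) \<longlonglongrightarrow> W \<omega>"
  proof eventually_elim
    case (elim \<omega>)
    have V: "\<kappa> (V k \<omega>) = Z k \<omega>" for k
    proof -
      obtain v where "v \<in> P k" "Z k \<omega> = \<kappa> v" using elim(1) by blast
      thus ?thesis using g by (simp add: V_def)
    qed
    obtain R where R: "\<And>k. norm (Z k \<omega>) \<le> R"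
      using convergent_imp_Bseq[OF convergentI[OF elim(2)]] unfolding Bseq_def by blast
    have VR: "norm (V k \<omega>) \<le> R + 1" for k using \<kappa>(1)[of "V k \<omega>"] R[of k] unfolding V by simp
    have "Cauchy (\<lambda>k. V k \<omega>)"
    proof (rule metric_CauchyI)
      fix e :: real assume "0 < e"
      then obtain d where d: "0 < d" "\<And>x x'. norm x \<le> R + 1 \<Longrightarrow> \<bar>\<kappa> x - \<kappa> x'\<bar> < d \<Longrightarrow> dist x x' < e"
        using inv by blast
      obtain K where "\<And>m n. m \<ge> K \<Longrightarrow> n \<ge> K \<Longrightarrow> dist (Z m \<omega>) (Z n \<omega>) < d"
        using metric_CauchyD[OF convergent_Cauchy[OF convergentI[OF elim(2)]] d(1)] by blast
      hence "dist (V m \<omega>) (V n \<omega>) < e" if "m \<ge> K" "n \<ge> K" for m n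
        using d(2)[OF VR] that by (simp add: V dist_real_def)
      thus "\<exists>M. \<forall>m\<ge>M. \<forall>n\<ge>M. dist (V m \<omega>) (V n \<omega>) < e" by blast
    qed
    thus ?case unfolding W_def by (simp add: Cauchy_convergent_iff convergent_LIMSEQ_iff)
  qed
  show ?thesis using that[OF r(1) \<Omega>(1) V_meas W_meas law lim] .
qed

section \<open>The fundamental lemma for Lipschitz test functions\<close>

text \<open>
  Lipschitz cutoffs increase to the indicators of bounded open sets, and these generate the Borel sets.
\<close>
lemma AE_zero_of_lipschitz_tests:
  fixes h :: "'a::euclidean_space \<Rightarrow> real"
  assumes \<rho>: "prob_space \<rho>" "sets \<rho> = sets borel"
    and [measurable]: "h \<in> borel_measurable borel"
    and loc: "\<And>R. integrable \<rho> (\<lambda>x. indicator (cball 0 R) x * h x)"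
    and test: "\<And>\<psi> L R. (\<And>x y. \<bar>\<psi> x - \<psi> y\<bar> \<le> L * dist x y) \<Longrightarrow> (\<And>x. \<bar>\<psi> x\<bar> \<le> 1) \<Longrightarrow> (\<And>x. R < norm x \<Longrightarrow> \<psi> x = 0)
      \<Longrightarrow> (\<integral>x. \<psi> x * h x \<partial>\<rho>) = 0"
  shows "AE x in \<rho>. h x = 0"
proof -
  interpret prob_space \<rho> by fact
  note [measurable_cong] = \<rho>(2)
  have [simp]: "space \<rho> = UNIV" using sets_eq_imp_space_eq[OF \<rho>(2)] by simp
  have ae: "AE x in \<rho>. indicator (ball 0 (real n)) x * h x = 0" for n :: nat
  proof -
    define f where "f x = indicator (ball 0 (real n)) x * h x" for x
    have f_int: "integrable \<rho> f"
      unfolding f_def by (rule Bochner_Integration.integrable_bound[OF loc[of "real n"]])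
        (auto simp: indicator_def)
    note [measurable] = borel_measurable_integrable[OF f_int]
    have open_zero: "(\<integral>x. indicator U x * f x \<partial>\<rho>) = 0" if U: "open U" for U
    proof -
      have [measurable]: "U \<in> sets borel" using U by simp
      define W where "W = U \<inter> ball 0 (real n)"
      have W: "open W" using U by (auto simp: W_def)
      have [measurable]: "W \<in> sets borel" using W by simp
      have ne: "- W \<noteq> {}"
      proof
        assume "- W = {}"
        hence "(UNIV :: 'a set) \<subseteq> ball 0 (real n)" unfolding W_def by blast
        from bounded_subset[OF bounded_ball this] show False by simp
      qed
      have pos: "0 < infdist x (- W)" if "x \<in> W" for x
        using infdist_pos_not_in_closed[of "- W" x] W ne that by (auto simp: closed_def)
      define \<psi> where "\<psi> k x = min 1 (real k * infdist x (- W))" for k x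
      have "(\<integral>x. \<psi> k x * h x \<partial>\<rho>) = 0" for k
      proof (rule test[of _ "real k" "real n"])
        fix x y
        have "\<bar>\<psi> k x - \<psi> k y\<bar> \<le> \<bar>real k * infdist x (- W) - real k * infdist y (- W)\<bar>"
          unfolding \<psi>_def by linarith
        also have "\<dots> = real k * \<bar>infdist x (- W) - infdist y (- W)\<bar>"
          by (simp add: abs_mult flip: right_diff_distrib)
        also have "\<dots> \<le> real k * dist x y" by (intro mult_left_mono infdist_triangle_abs) auto
        finally show "\<bar>\<psi> k x - \<psi> k y\<bar> \<le> real k * dist x y" .
      next
        fix x show "\<bar>\<psi> k x\<bar> \<le> 1"
          by (smt (verit) \<psi>_def infdist_nonneg mult_nonneg_nonneg of_nat_0_le_iff)
      next
        fix x :: 'a assume "real n < norm x"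
        hence "x \<in> - W" by (auto simp: W_def)
        thus "\<psi> k x = 0" by (simp add: \<psi>_def)
      qed
      moreover have "(\<lambda>k. \<integral>x. \<psi> k x * h x \<partial>\<rho>) \<longlonglongrightarrow> (\<integral>x. indicator U x * f x \<partial>\<rho>)"
      proof (rule integral_dominated_convergence[where w = "\<lambda>x. norm (f x)"])
        show "(\<lambda>x. \<psi> k x * h x) \<in> borel_measurable \<rho>" for k
        proof -
          have "\<psi> k \<in> borel_measurable borel"
            unfolding \<psi>_def by (intro borel_measurable_continuous_onI continuous_intros)
          thus ?thesis by measurable
        qed
        show "(\<lambda>x. indicator U x * f x) \<in> borel_measurable \<rho>" by measurable
        show "AE x in \<rho>. (\<lambda>k. \<psi> k x * h x) \<longlonglongrightarrow> indicator U x * f x"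
        proof (rule AE_I2)
          fix x
          have "(\<lambda>k. \<psi> k x) \<longlonglongrightarrow> indicator W x"
          proof (cases "x \<in> W")
            case True
            obtain k0 where k0: "1 / infdist x (- W) < real k0" using reals_Archimedean2 by blast
            have "\<psi> k x = 1" if "k \<ge> k0" for k
            proof -
              have "1 / infdist x (- W) < real k" using k0 that by linarith
              thus ?thesis using pos[OF True] by (simp add: \<psi>_def field_simps)
            qed
            hence "eventually (\<lambda>k. \<psi> k x = 1) sequentially" by (auto simp: eventually_sequentially)
            thus ?thesis using True by (simp add: tendsto_eventually)
          next
            case False
            thus ?thesis by (simp add: \<psi>_def)
          qed
          hence "(\<lambda>k. \<psi> k x * h x) \<longlonglongrightarrow> indicator W x * h x" by (intro tendsto_intros)
          moreover have "indicator W x * h x = indicator U x * f x" by (auto simp: W_def f_def indicator_def)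
          ultimately show "(\<lambda>k. \<psi> k x * h x) \<longlonglongrightarrow> indicator U x * f x" by simp
        qed
        show "AE x in \<rho>. norm (\<psi> k x * h x) \<le> norm (f x)" for k
        proof (rule AE_I2)
          fix x
          have "\<bar>\<psi> k x\<bar> \<le> 1" by (smt (verit) \<psi>_def infdist_nonneg mult_nonneg_nonneg of_nat_0_le_iff)
          moreover have "\<psi> k x = 0" if "x \<notin> ball 0 (real n)" using that by (simp add: \<psi>_def W_def)
          ultimately show "norm (\<psi> k x * h x) \<le> norm (f x)"
            by (cases "x \<in> ball 0 (real n)") (auto simp: f_def abs_mult mult_left_le_one_le)
        qed
      qed (use f_int in auto)
      ultimately show ?thesis by (simp add: LIMSEQ_const_iff)
    qed
    have all_zero: "(\<integral>x. indicator A x * f x \<partial>\<rho>) = 0" if "A \<in> sets borel" for A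
    proof -
      have "Int_stable {S :: 'a set. open S}" by (auto simp: Int_stable_def)
      moreover have "{S :: 'a set. open S} \<subseteq> Pow UNIV" by simp
      moreover have "A \<in> sigma_sets UNIV {S. open S}" using that by (simp add: borel_def)
      ultimately show ?thesis
    proof (induction rule: sigma_sets_induct_disjoint)
      case (basic A)
      thus ?case using open_zero by simp
    next
      case empty
      show ?case by simp
    next
      case (compl A)
      hence [measurable]: "A \<in> sets borel" by (simp add: borel_def)
      have "(\<integral>x. indicator (UNIV - A) x * f x \<partial>\<rho>) = (\<integral>x. indicator UNIV x * f x - indicator A x * f x \<partial>\<rho>)"
        by (intro Bochner_Integration.integral_cong) (auto simp: indicator_def)
      also have "\<dots> = (\<integral>x. indicator UNIV x * f x \<partial>\<rho>) - (\<integral>x. indicator A x * f x \<partial>\<rho>)"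
        using f_int integrable_mult_indicator[of A \<rho> f] by (intro Bochner_Integration.integral_diff) auto
      finally show ?case using compl open_zero[of UNIV] by simp
    next
      case (union A)
      hence A: "A i \<in> sets \<rho>" for i using \<rho>(2) by (auto simp: borel_def)
      have "(\<integral>x\<in>(\<Union>i. A i). f x \<partial>\<rho>) = (\<Sum>i. \<integral>x\<in>A i. f x \<partial>\<rho>)"
      proof (rule lebesgue_integral_countable_add[OF A])
        show "A i \<inter> A j = {}" if "i \<noteq> j" for i j using union(1) that by (auto simp: disjoint_family_on_def)
        show "set_integrable \<rho> (\<Union>i. A i) f"
          unfolding set_integrable_def using A by (intro integrable_mult_indicator f_int) auto
      qed
      thus ?case using union(3) by (simp add: set_lebesgue_integral_def)
    qed
    qed
    have "AE x in \<rho>. f x = 0"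
      by (rule density_unique_real[OF f_int])
         (use all_zero \<rho>(2) in \<open>auto simp: set_lebesgue_integral_def\<close>)
    thus ?thesis by (simp add: f_def)
  qed
  hence "AE x in \<rho>. \<forall>n. indicator (ball 0 (real n)) x * h x = 0" by (simp only: AE_all_countable) simp
  thus ?thesis
  proof eventually_elim
    case (elim x)
    obtain n :: nat where "norm x < real n" using reals_Archimedean2 by blast
    thus ?case using spec[OF elim, of n] by simp
  qed
qed


section \<open>Passage to the limit\<close>

lemma nn_integral_empirical:
  fixes h :: "'a::euclidean_space \<Rightarrow> ennreal"
  assumes [measurable]: "h \<in> borel_measurable borel"
  shows "(\<integral>\<^sup>+v. h v \<partial>empirical N x) = (\<Sum>i\<in>{1..N}. ennreal (1 / real N) * h (x i))"
proof -
  have "x \<in> measurable (uniform_count_measure {1..N}) borel"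
    by (auto simp: measurable_def space_uniform_count_measure sets_uniform_count_measure)
  thus ?thesis
    unfolding empirical_def
    by (subst nn_integral_distr) (auto simp: uniform_count_measure_def nn_integral_point_measure_finite)
qed

lemma nn_integral_empirical_pair:
  fixes h :: "'a::euclidean_space \<times> 'a \<Rightarrow> real"
  assumes N: "0 < N" and [measurable]: "h \<in> borel_measurable (borel \<Otimes>\<^sub>M borel)" and h: "\<And>z. 0 \<le> h z"
  shows "(\<integral>\<^sup>+z. ennreal (h z) \<partial>(empirical N x \<Otimes>\<^sub>M empirical N x))
    = ennreal ((1 / real N ^ 2) * (\<Sum>i\<in>{1..N}. \<Sum>j\<in>{1..N}. h (x i, x j)))"
proof -
  interpret prob_space "empirical N x" using N by (rule prob_space_empirical)
  have "(\<integral>\<^sup>+z. ennreal (h z) \<partial>(empirical N x \<Otimes>\<^sub>M empirical N x))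
      = (\<integral>\<^sup>+u. \<integral>\<^sup>+v. ennreal (h (u, v)) \<partial>empirical N x \<partial>empirical N x)"
    by (rule nn_integral_fst[symmetric]) measurable
  also have "\<dots> = (\<Sum>i\<in>{1..N}. ennreal (1 / real N) * (\<integral>\<^sup>+v. ennreal (h (x i, v)) \<partial>empirical N x))"
    by (rule nn_integral_empirical) measurable
  also have "\<dots> = (\<Sum>i\<in>{1..N}. ennreal (1 / real N) * (\<Sum>j\<in>{1..N}. ennreal (1 / real N) * ennreal (h (x i, x j))))"
    by (intro sum.cong arg_cong2[where f = "(*)"] nn_integral_empirical refl) measurable
  also have "\<dots> = ennreal (\<Sum>i\<in>{1..N}. (1 / real N) * (\<Sum>j\<in>{1..N}. (1 / real N) * h (x i, x j)))"
    using h by (simp add: sum_nonneg flip: ennreal_mult)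
  also have "(\<Sum>i\<in>{1..N}. (1 / real N) * (\<Sum>j\<in>{1..N}. (1 / real N) * h (x i, x j)))
      = (1 / real N ^ 2) * (\<Sum>i\<in>{1..N}. \<Sum>j\<in>{1..N}. h (x i, x j))"
    by (simp add: sum_distrib_left power2_eq_square)
  finally show ?thesis .
qed

lemma nn_integral_norm_pair:
  fixes x :: "nat \<Rightarrow> 'a::euclidean_space"
  assumes "0 < N"
  shows "(\<integral>\<^sup>+z. ennreal (norm (fst z - snd z) powr s) \<partial>(empirical N x \<Otimes>\<^sub>M empirical N x))
    = ennreal ((1 / real N ^ 2) * pair_sum s N x)"
  unfolding pair_sum_def using assms by (subst nn_integral_empirical_pair) auto

lemma integral_empirical_pair:
  fixes h :: "'a::euclidean_space \<times> 'a \<Rightarrow> real"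
  assumes N: "0 < N" and [measurable]: "h \<in> borel_measurable (borel \<Otimes>\<^sub>M borel)"
  shows "(\<integral>z. h z \<partial>(empirical N x \<Otimes>\<^sub>M empirical N x))
    = (1 / real N ^ 2) * (\<Sum>i\<in>{1..N}. \<Sum>j\<in>{1..N}. h (x i, x j))"
proof -
  interpret prob_space "empirical N x" using N by (rule prob_space_empirical)
  interpret pair_sigma_finite "empirical N x" "empirical N x" ..
  have "integrable (empirical N x \<Otimes>\<^sub>M empirical N x) h"
    unfolding integrable_iff_bounded using nn_integral_empirical_pair[OF N, of "\<lambda>z. norm (h z)" x] by auto
  hence "(\<integral>z. h z \<partial>(empirical N x \<Otimes>\<^sub>M empirical N x)) = (\<integral>u. \<integral>v. h (u, v) \<partial>empirical N x \<partial>empirical N x)"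
    by (rule integral_fst'[symmetric])
  also have "\<dots> = (1 / real N) *\<^sub>R (\<Sum>i\<in>{1..N}. \<integral>v. h (x i, v) \<partial>empirical N x)"
    by (rule integral_empirical) measurable
  also have "\<dots> = (1 / real N) *\<^sub>R (\<Sum>i\<in>{1..N}. (1 / real N) *\<^sub>R (\<Sum>j\<in>{1..N}. h (x i, x j)))"
    by (intro arg_cong2[where f = "(*\<^sub>R)"] sum.cong integral_empirical refl) measurable
  also have "\<dots> = (1 / real N ^ 2) * (\<Sum>i\<in>{1..N}. \<Sum>j\<in>{1..N}. h (x i, x j))"
    by (simp add: sum_distrib_left power2_eq_square)
  finally show ?thesis .
qed

lemma distr_independent_copies:
  fixes V :: "'b \<Rightarrow> 'a::euclidean_space"
  assumes \<Omega>: "prob_space \<Omega>" and [measurable]: "V \<in> borel_measurable \<Omega>"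
  shows "distr (\<Omega> \<Otimes>\<^sub>M \<Omega>) (borel \<Otimes>\<^sub>M borel) (\<lambda>z. (V (fst z), V (snd z))) = distr \<Omega> borel V \<Otimes>\<^sub>M distr \<Omega> borel V"
proof -
  interpret prob_space \<Omega> by fact
  interpret D: prob_space "distr \<Omega> borel V" by (rule prob_space_distr) measurable
  have "sigma_finite_measure (distr \<Omega> borel V)" ..
  from pair_measure_distr[OF _ _ this, of V \<Omega> borel] show ?thesis
    by (simp add: case_prod_unfold)
qed

context regular_target
begin

text \<open>
  Multiplying the force balance by \<open>\<psi> u\<close> and symmetrizing leads to this function of a pair
  of particles. Unlike the kernel it is continuous on the diagonal, because \<open>\<psi>\<close> is Lipschitz.
\<close>
definition sym_test :: "('a \<Rightarrow> real) \<Rightarrow> 'a \<Rightarrow> 'a \<times> 'a \<Rightarrow> real" where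
  "sym_test \<psi> u z = (\<psi> (fst z) - \<psi> (snd z)) * (grad_ker q (fst z - snd z) \<bullet> u)"

lemma sym_test_measurable [measurable]:
  assumes [measurable]: "\<psi> \<in> borel_measurable borel"
  shows "sym_test \<psi> u \<in> borel_measurable (borel \<Otimes>\<^sub>M borel)"
  unfolding sym_test_def by measurable

text \<open>
  The Lipschitz bound is used for particles that are close and continuity on the diagonal, the
  bound on \<open>\<psi>\<close> in \<open>sym_test_bound'\<close> for particles that are far apart.
\<close>
lemma sym_test_bound:
  assumes lip: "\<And>x y. \<bar>\<psi> x - \<psi> y\<bar> \<le> L * dist x y" and u: "norm u = 1"
  shows "\<bar>sym_test \<psi> u (x, y)\<bar> \<le> q * L * norm (x - y) powr q"
proof -
  have "\<bar>sym_test \<psi> u (x, y)\<bar> = \<bar>\<psi> x - \<psi> y\<bar> * \<bar>grad_ker q (x - y) \<bullet> u\<bar>"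
    by (simp add: sym_test_def abs_mult)
  also have "\<dots> \<le> (L * norm (x - y)) * (q * norm (x - y) powr (q - 1))"
  proof (rule mult_mono)
    show "\<bar>\<psi> x - \<psi> y\<bar> \<le> L * norm (x - y)" using lip[of x y] by (simp add: dist_norm)
    show "\<bar>grad_ker q (x - y) \<bullet> u\<bar> \<le> q * norm (x - y) powr (q - 1)"
      using Cauchy_Schwarz_ineq2[of "grad_ker q (x - y)" u] u q by (simp add: norm_grad_ker)
    show "0 \<le> L * norm (x - y)" using lip[of x y] abs_ge_zero[of "\<psi> x - \<psi> y"] by (simp add: dist_norm)
  qed simp
  also have "\<dots> = q * L * norm (x - y) powr q"
    using powr_mult_base[of "norm (x - y)" "q - 1"] by simp
  finally show ?thesis .
qed

lemma sym_test_bound':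
  assumes b: "\<And>x. \<bar>\<psi> x\<bar> \<le> 1" and u: "norm u = 1"
  shows "\<bar>sym_test \<psi> u (x, y)\<bar> \<le> 2 * q * norm (x - y) powr (q - 1)"
proof -
  have "\<bar>sym_test \<psi> u (x, y)\<bar> = \<bar>\<psi> x - \<psi> y\<bar> * \<bar>grad_ker q (x - y) \<bullet> u\<bar>"
    by (simp add: sym_test_def abs_mult)
  also have "\<dots> \<le> 2 * (q * norm (x - y) powr (q - 1))"
  proof (rule mult_mono)
    show "\<bar>\<psi> x - \<psi> y\<bar> \<le> 2" using b[of x] b[of y] by linarith
    show "\<bar>grad_ker q (x - y) \<bullet> u\<bar> \<le> q * norm (x - y) powr (q - 1)"
      using Cauchy_Schwarz_ineq2[of "grad_ker q (x - y)" u] u q by (simp add: norm_grad_ker)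
  qed auto
  finally show ?thesis by simp
qed

lemma sym_test_tendsto:
  assumes lip: "\<And>x y. \<bar>\<psi> x - \<psi> y\<bar> \<le> L * dist x y" and cont: "\<And>x. isCont \<psi> x" and u: "norm u = 1"
    and v: "(v \<longlongrightarrow> a) F" and w: "(w \<longlongrightarrow> b) F"
  shows "((\<lambda>k. sym_test \<psi> u (v k, w k)) \<longlongrightarrow> sym_test \<psi> u (a, b)) F"
proof (cases "a = b")
  case True
  have "((\<lambda>k. q * L * norm (v k - w k) powr q) \<longlongrightarrow> q * L * norm (a - b) powr q) F"
    using v w q by (intro tendsto_intros tendsto_norm_powr)
  hence lim: "((\<lambda>k. q * L * norm (v k - w k) powr q) \<longlongrightarrow> 0) F" using True by simp
  have "((\<lambda>k. sym_test \<psi> u (v k, w k)) \<longlongrightarrow> 0) F"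
    by (rule Lim_null_comparison[OF _ lim]) (use sym_test_bound[OF lip u] in simp)
  thus ?thesis using True by (simp add: sym_test_def)
next
  case False
  hence c: "isCont (grad_ker q) (a - b)" by (intro isCont_grad_ker) auto
  have "((\<lambda>k. grad_ker q (v k - w k)) \<longlongrightarrow> grad_ker q (a - b)) F"
    by (rule isCont_tendsto_compose[OF c]) (intro tendsto_intros v w)
  thus ?thesis
    unfolding sym_test_def fst_conv snd_conv
    by (intro tendsto_intros isCont_tendsto_compose[OF cont] v w)
qed

lemma drift_test_bounded:
  assumes b: "\<And>x. \<bar>\<psi> x\<bar> \<le> 1" and supp: "\<And>x. R < norm x \<Longrightarrow> \<psi> x = 0" and u: "norm u = 1"
  obtains D where "\<And>x. norm (\<psi> x * (drift x \<bullet> u)) \<le> D"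
proof -
  have "continuous_on (cball 0 R) drift"
    using continuous_drift by (intro continuous_at_imp_continuous_on) auto
  hence "bounded (drift ` cball 0 R)" by (intro compact_imp_bounded compact_continuous_image) auto
  then obtain D where D: "\<And>x. x \<in> cball 0 R \<Longrightarrow> norm (drift x) \<le> D" unfolding bounded_iff by blast
  have "norm (\<psi> x * (drift x \<bullet> u)) \<le> max D 0" for x
  proof (cases "x \<in> cball 0 R")
    case True
    have "\<bar>\<psi> x\<bar> * \<bar>drift x \<bullet> u\<bar> \<le> 1 * norm (drift x)"
      using b Cauchy_Schwarz_ineq2[of "drift x" u] u by (intro mult_mono) auto
    thus ?thesis using D[OF True] by (simp add: abs_mult le_max_iff_disj)
  qed (use supp[of x] in simp)
  thus ?thesis using that by blast
qed

lemma sym_test_stationary: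
  assumes N: "0 < N" and stat: "\<And>i. i \<in> {1..N} \<Longrightarrow> particle_velocity q \<mu> N y i = 0"
    and [measurable]: "\<psi> \<in> borel_measurable borel"
  shows "(\<integral>z. sym_test \<psi> u z \<partial>(empirical N y \<Otimes>\<^sub>M empirical N y)) = 2 * (\<integral>x. \<psi> x * (drift x \<bullet> u) \<partial>empirical N y)"
proof -
  have "(\<Sum>i\<in>{1..N}. \<Sum>j\<in>{1..N}. sym_test \<psi> u (y i, y j))
      = (\<Sum>i\<in>{1..N}. \<Sum>j\<in>{1..N}. grad_ker q (y i - y j) \<bullet> (\<psi> (y i) *\<^sub>R u - \<psi> (y j) *\<^sub>R u))"
    by (simp add: sym_test_def inner_diff_right algebra_simps)
  also have "\<dots> = 2 * (\<Sum>i\<in>{1..N}. (\<Sum>j\<in>{1..N}. grad_ker q (y i - y j)) \<bullet> (\<psi> (y i) *\<^sub>R u))"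
    by (rule sum_grad_ker_symmetrize)
  also have "(\<Sum>i\<in>{1..N}. (\<Sum>j\<in>{1..N}. grad_ker q (y i - y j)) \<bullet> (\<psi> (y i) *\<^sub>R u))
      = real N * (\<Sum>i\<in>{1..N}. \<psi> (y i) * (drift (y i) \<bullet> u))"
    unfolding sum_distrib_left
    using stationary_force_balance[OF N stat] by (intro sum.cong) auto
  finally have s: "(\<Sum>i\<in>{1..N}. \<Sum>j\<in>{1..N}. sym_test \<psi> u (y i, y j)) = 2 * (real N * (\<Sum>i\<in>{1..N}. \<psi> (y i) * (drift (y i) \<bullet> u)))" .
  have "(\<integral>z. sym_test \<psi> u z \<partial>(empirical N y \<Otimes>\<^sub>M empirical N y))
      = (1 / real N ^ 2) * (2 * (real N * (\<Sum>i\<in>{1..N}. \<psi> (y i) * (drift (y i) \<bullet> u))))"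
    unfolding s[symmetric] by (rule integral_empirical_pair[OF N]) measurable
  moreover have "(\<integral>x. \<psi> x * (drift x \<bullet> u) \<partial>empirical N y) = (1 / real N) *\<^sub>R (\<Sum>i\<in>{1..N}. \<psi> (y i) * (drift (y i) \<bullet> u))"
    by (rule integral_empirical) measurable
  ultimately show ?thesis using N by (simp add: power2_eq_square)
qed

text \<open>
  The first bound is the assumption if \<open>q < 1\<close>, and the kernel is at most \<open>1\<close> if \<open>q = 1\<close>. If \<open>q > 1\<close>, the tails
  control moments of every order \<open>s < q / 2\<close>, and \<open>q - 1 < q / 2\<close> leaves room for \<open>r > 1\<close> with \<open>(q - 1) r < q / 2\<close>.
\<close>
lemma kernel_pair_moments:
  obtains r C where "1 < r" "0 \<le> C"
    "\<And>N y. 0 < N \<Longrightarrow> particle_energy q \<mu> N y \<le> E0 \<Longrightarrow>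
      (q < 1 \<longrightarrow> (1 / real N ^ 2) * pair_sum (q - 1) N y \<le> S) \<Longrightarrow>
      (\<integral>\<^sup>+z. ennreal (norm (fst z - snd z) powr (q - 1)) \<partial>(empirical N y \<Otimes>\<^sub>M empirical N y)) \<le> ennreal C"
    "\<And>N y. 0 < N \<Longrightarrow> particle_energy q \<mu> N y \<le> E0 \<Longrightarrow> 1 < q \<Longrightarrow>
      (\<integral>\<^sup>+z. ennreal ((norm (fst z - snd z) powr (q - 1)) powr r) \<partial>(empirical N y \<Otimes>\<^sub>M empirical N y)) \<le> ennreal C"
proof -
  show ?thesis
  proof (cases "1 < q")
    case False
    have le: "(1 / real N ^ 2) * pair_sum (q - 1) N y \<le> max S 1"
      if N: "0 < N" and S: "q < 1 \<longrightarrow> (1 / real N ^ 2) * pair_sum (q - 1) N y \<le> S"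
      for N and y :: "nat \<Rightarrow> 'a"
    proof (cases "q < 1")
      case False
      hence "q = 1" using \<open>\<not> 1 < q\<close> by simp
      hence "pair_sum (q - 1) N y \<le> (\<Sum>i\<in>{1..N}. \<Sum>j\<in>{1..N}. 1)"
        unfolding pair_sum_def by (intro sum_mono) auto
      hence "(1 / real N ^ 2) * pair_sum (q - 1) N y \<le> 1"
        using N by (simp add: power2_eq_square field_simps)
      thus ?thesis by simp
    qed (use S in auto)
    show ?thesis
    proof (rule that[of 2 "max S 1"])
      fix N and y :: "nat \<Rightarrow> 'a"
      assume N: "0 < N" and "q < 1 \<longrightarrow> (1 / real N ^ 2) * pair_sum (q - 1) N y \<le> S"
      from le[OF this] show "(\<integral>\<^sup>+z. ennreal (norm (fst z - snd z) powr (q - 1)) \<partial>(empirical N y \<Otimes>\<^sub>M empirical N y)) \<le> ennreal (max S 1)"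
        unfolding nn_integral_norm_pair[OF N] by (rule ennreal_leI)
    qed (use False in auto)
  next
    case True
    define s where "s = ((q - 1) + q / 2) / 2"
    have s: "q - 1 < s" "s < q / 2" "0 < s" "s \<le> 1" using True q by (auto simp: s_def)
    obtain C where C: "\<And>N y. 0 < N \<Longrightarrow> particle_energy q \<mu> N y \<le> E0 \<Longrightarrow>
      (\<integral>\<^sup>+x. ennreal (norm x powr s) \<partial>empirical N y) \<le> ennreal C"
      using empirical_moment_bound[OF s(3,2)] by blast
    define r where "r = s / (q - 1)"
    have r: "1 < r" using s True by (simp add: r_def)
    have rs: "(norm z powr (q - 1)) powr r = norm z powr s" for z :: 'a
      using True by (simp add: powr_powr r_def)
    have bound: "(1 / real N ^ 2) * pair_sum s N y \<le> 2 * max C 0"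
      if N: "0 < N" and E: "particle_energy q \<mu> N y \<le> E0" for N y
    proof -
      define m where "m = (\<Sum>i\<in>{1..N}. norm (y i) powr s)"
      have "(\<integral>\<^sup>+x. ennreal (norm x powr s) \<partial>empirical N y) = (\<Sum>i\<in>{1..N}. ennreal (1 / real N) * ennreal (norm (y i) powr s))"
        by (rule nn_integral_empirical) measurable
      also have "\<dots> = ennreal ((1 / real N) * m)"
        by (simp add: m_def sum_distrib_left flip: ennreal_mult)
      finally have "ennreal ((1 / real N) * m) \<le> ennreal C" using C[OF N E] by simp
      also have "\<dots> \<le> ennreal (max C 0)" by (intro ennreal_leI) auto
      finally have m: "(1 / real N) * m \<le> max C 0" by (subst (asm) ennreal_le_iff) auto
      have "pair_sum s N y \<le> (\<Sum>i\<in>{1..N}. \<Sum>j\<in>{1..N}. norm (y i) powr s + norm (y j) powr s)"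
        unfolding pair_sum_def
      proof (intro sum_mono)
        fix i j
        have "norm (y i - y j) powr s \<le> (norm (y i) + norm (y j)) powr s"
          using s by (intro powr_mono2 norm_triangle_ineq4) auto
        also have "\<dots> \<le> norm (y i) powr s + norm (y j) powr s" using s by (intro powr_subadditive) auto
        finally show "norm (y i - y j) powr s \<le> norm (y i) powr s + norm (y j) powr s" .
      qed
      also have "\<dots> = 2 * real N * m"
        by (simp add: sum.distrib m_def sum_distrib_left mult.assoc)
      finally have "(1 / real N ^ 2) * pair_sum s N y \<le> (1 / real N ^ 2) * (2 * real N * m)"
        by (intro mult_left_mono) auto
      also have "\<dots> = 2 * ((1 / real N) * m)" using N by (simp add: power2_eq_square)
      finally show ?thesis using m by linarith
    qed
    show ?thesis
    proof (rule that[OF r, of "1 + 2 * max C 0"])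
      fix N and y :: "nat \<Rightarrow> 'a"
      assume N: "0 < N" and E: "particle_energy q \<mu> N y \<le> E0"
      have "(\<integral>\<^sup>+z. ennreal ((norm (fst z - snd z) powr (q - 1)) powr r) \<partial>(empirical N y \<Otimes>\<^sub>M empirical N y))
          = ennreal ((1 / real N ^ 2) * pair_sum s N y)"
        unfolding rs by (rule nn_integral_norm_pair[OF N])
      also have "\<dots> \<le> ennreal (1 + 2 * max C 0)" using bound[OF N E] by (intro ennreal_leI) linarith
      finally show "(\<integral>\<^sup>+z. ennreal ((norm (fst z - snd z) powr (q - 1)) powr r) \<partial>(empirical N y \<Otimes>\<^sub>M empirical N y)) \<le> ennreal (1 + 2 * max C 0)" .
      have "pair_sum (q - 1) N y \<le> (\<Sum>i\<in>{1..N}. \<Sum>j\<in>{1..N}. 1 + norm (y i - y j) powr s)"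
        unfolding pair_sum_def
      proof (intro sum_mono)
        fix i j
        show "norm (y i - y j) powr (q - 1) \<le> 1 + norm (y i - y j) powr s"
        proof (cases "norm (y i - y j) \<le> 1")
          case True
          hence "norm (y i - y j) powr (q - 1) \<le> 1" using \<open>1 < q\<close> by (intro powr_le1) auto
          thus ?thesis by (simp add: add_increasing2)
        next
          case False
          hence "norm (y i - y j) powr (q - 1) \<le> norm (y i - y j) powr s" using s by (intro powr_mono) auto
          thus ?thesis by simp
        qed
      qed
      also have "\<dots> = real N ^ 2 + pair_sum s N y"
        by (simp add: pair_sum_def sum.distrib power2_eq_square)
      finally have "(1 / real N ^ 2) * pair_sum (q - 1) N y
          \<le> (1 / real N ^ 2) * (real N ^ 2 + pair_sum s N y)"
        by (intro mult_left_mono) auto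
      also have "\<dots> = 1 + (1 / real N ^ 2) * pair_sum s N y"
        using N by (simp add: distrib_left)
      finally have "(1 / real N ^ 2) * pair_sum (q - 1) N y \<le> 1 + 2 * max C 0"
        using bound[OF N E] by linarith
      thus "(\<integral>\<^sup>+z. ennreal (norm (fst z - snd z) powr (q - 1)) \<partial>(empirical N y \<Otimes>\<^sub>M empirical N y)) \<le> ennreal (1 + 2 * max C 0)"
        unfolding nn_integral_norm_pair[OF N] by (rule ennreal_leI)
    qed auto
  qed
qed

text \<open>
  A weak solution of the force balance is a Lagrangian critical point once the kernel is
  integrable with respect to \<open>\<rho> \<otimes> \<rho>\<close>: the symmetrization can then be undone.
\<close>
lemma lagrangian_critical_of_weak:
  assumes \<rho>: "prob_space \<rho>" "sets \<rho> = sets borel"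
    and ker: "integrable (\<rho> \<Otimes>\<^sub>M \<rho>) (\<lambda>z. norm (fst z - snd z) powr (q - 1))"
    and weak: "\<And>\<psi> u L R. norm u = 1 \<Longrightarrow> (\<And>x y. \<bar>\<psi> x - \<psi> y\<bar> \<le> L * dist x y) \<Longrightarrow> (\<And>x. \<bar>\<psi> x\<bar> \<le> 1) \<Longrightarrow>
      (\<And>x. R < norm x \<Longrightarrow> \<psi> x = 0) \<Longrightarrow> (\<And>x. isCont \<psi> x) \<Longrightarrow>
      (\<integral>z. sym_test \<psi> u z \<partial>(\<rho> \<Otimes>\<^sub>M \<rho>)) = 2 * (\<integral>x. \<psi> x * (drift x \<bullet> u) \<partial>\<rho>)"
  shows "lagrangian_critical q \<mu> \<rho>"
proof -
  interpret R: prob_space \<rho> by fact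
  interpret RR: pair_sigma_finite \<rho> \<rho> ..
  note [measurable_cong] = \<rho>(2)
  have [simp]: "space \<rho> = UNIV" using sets_eq_imp_space_eq[OF \<rho>(2)] by simp
  define G where "G x = (\<integral>y. grad_ker q (x - y) \<partial>\<rho>)" for x
  have G_meas [measurable]: "G \<in> borel_measurable borel" unfolding G_def by measurable
  have gk: "integrable (\<rho> \<Otimes>\<^sub>M \<rho>) (\<lambda>z. grad_ker q (fst z - snd z))"
  proof (rule Bochner_Integration.integrable_bound)
    show "integrable (\<rho> \<Otimes>\<^sub>M \<rho>) (\<lambda>z. q * norm (fst z - snd z) powr (q - 1))" using ker by simp
  qed (use q in \<open>auto simp: norm_grad_ker\<close>)
  have G_int: "integrable \<rho> G"
    using RR.integrable_fst'[OF gk] by (simp add: G_def[abs_def])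
  have conv_ae: "AE x in \<rho>. integrable \<rho> (\<lambda>y. grad_ker q (x - y))"
    using RR.AE_integrable_fst'[OF gk] by simp
  have comp: "AE x in \<rho>. (G x - drift x) \<bullet> u = 0" if u: "norm u = 1" for u
  proof (rule AE_zero_of_lipschitz_tests[OF \<rho>])
    show "(\<lambda>x. (G x - drift x) \<bullet> u) \<in> borel_measurable borel" by measurable
    fix R :: real
    have [measurable]: "cball (0 :: 'a) R \<in> sets borel" by simp
    obtain D where "\<And>x. norm (indicator (cball 0 R) x * (drift x \<bullet> u)) \<le> D"
      using drift_test_bounded[of "indicator (cball 0 R)" R u] u by (auto simp: indicator_def)
    hence "integrable \<rho> (\<lambda>x. indicator (cball 0 R) x * (drift x \<bullet> u))"
      by (intro R.integrable_const_bound[of _ D] AE_I2) measurable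
    moreover have "integrable \<rho> (\<lambda>x. indicator (cball 0 R) x * (G x \<bullet> u))"
      using integrable_mult_indicator[of "cball 0 R" \<rho> "\<lambda>x. G x \<bullet> u"] G_int by simp
    ultimately have "integrable \<rho> (\<lambda>x. indicator (cball 0 R) x * (G x \<bullet> u) - indicator (cball 0 R) x * (drift x \<bullet> u))"
      by (intro Bochner_Integration.integrable_diff)
    thus "integrable \<rho> (\<lambda>x. indicator (cball 0 R) x * ((G x - drift x) \<bullet> u))"
      by (simp add: inner_diff_left right_diff_distrib)
  next
    fix \<psi> :: "'a \<Rightarrow> real" and L R :: real
    assume lip: "\<And>x y. \<bar>\<psi> x - \<psi> y\<bar> \<le> L * dist x y" and b: "\<And>x. \<bar>\<psi> x\<bar> \<le> 1" and supp: "\<And>x. R < norm x \<Longrightarrow> \<psi> x = 0"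
    have cont: "isCont \<psi> x" for x
    proof -
      have "((\<lambda>y. \<psi> y - \<psi> x) \<longlongrightarrow> 0) (at x)"
      proof (rule Lim_null_comparison)
        show "\<forall>\<^sub>F y in at x. norm (\<psi> y - \<psi> x) \<le> L * dist y x" using lip by simp
        have "((\<lambda>y. L * dist y x) \<longlongrightarrow> L * dist x x) (at x)" by (intro tendsto_intros)
        thus "((\<lambda>y. L * dist y x) \<longlongrightarrow> 0) (at x)" by simp
      qed
      hence "(\<psi> \<longlongrightarrow> \<psi> x) (at x)" by (rule LIM_zero_cancel)
      thus ?thesis by (simp add: isCont_def)
    qed
    have [measurable]: "\<psi> \<in> borel_measurable borel"
      using cont by (intro borel_measurable_continuous_onI continuous_at_imp_continuous_on) auto
    have w: "(\<integral>z. sym_test \<psi> u z \<partial>(\<rho> \<Otimes>\<^sub>M \<rho>)) = 2 * (\<integral>x. \<psi> x * (drift x \<bullet> u) \<partial>\<rho>)"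
      using u lip b supp cont by (rule weak)
    define f where "f z = \<psi> (fst z) * (grad_ker q (fst z - snd z) \<bullet> u)" for z
    have f_int: "integrable (\<rho> \<Otimes>\<^sub>M \<rho>) f"
    proof (rule Bochner_Integration.integrable_bound[of _ "\<lambda>z. norm (grad_ker q (fst z - snd z))"])
      show "AE z in \<rho> \<Otimes>\<^sub>M \<rho>. norm (f z) \<le> norm (norm (grad_ker q (fst z - snd z)))"
      proof (rule AE_I2)
        fix z
        have "\<bar>grad_ker q (fst z - snd z) \<bullet> u\<bar> \<le> norm (grad_ker q (fst z - snd z))"
          using Cauchy_Schwarz_ineq2[of "grad_ker q (fst z - snd z)" u] u by simp
        hence "\<bar>\<psi> (fst z)\<bar> * \<bar>grad_ker q (fst z - snd z) \<bullet> u\<bar> \<le> 1 * norm (grad_ker q (fst z - snd z))"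
          using b by (intro mult_mono) auto
        thus "norm (f z) \<le> norm (norm (grad_ker q (fst z - snd z)))" by (simp add: f_def abs_mult)
      qed
      show "f \<in> borel_measurable (\<rho> \<Otimes>\<^sub>M \<rho>)" unfolding f_def by measurable
    qed (use gk in simp)
    have "(\<integral>z. f z \<partial>(\<rho> \<Otimes>\<^sub>M \<rho>)) = (\<integral>x. \<integral>y. f (x, y) \<partial>\<rho> \<partial>\<rho>)"
      by (rule RR.integral_fst'[OF f_int, symmetric])
    also have "\<dots> = (\<integral>x. \<psi> x * (G x \<bullet> u) \<partial>\<rho>)"
    proof (rule integral_cong_AE)
      show "AE x in \<rho>. (\<integral>y. f (x, y) \<partial>\<rho>) = \<psi> x * (G x \<bullet> u)"
        using conv_ae
      proof eventually_elim
        case (elim x)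
        thus ?case unfolding f_def G_def by (simp add: integral_inner_left)
      qed
    qed (auto simp: f_def)
    finally have f1: "(\<integral>z. f z \<partial>(\<rho> \<Otimes>\<^sub>M \<rho>)) = (\<integral>x. \<psi> x * (G x \<bullet> u) \<partial>\<rho>)" .
    have f2: "integrable (\<rho> \<Otimes>\<^sub>M \<rho>) (\<lambda>(x, y). f (y, x))" by (rule RR.integrable_product_swap[OF f_int])
    have f3: "(\<integral>(x, y). f (y, x) \<partial>(\<rho> \<Otimes>\<^sub>M \<rho>)) = (\<integral>z. f z \<partial>(\<rho> \<Otimes>\<^sub>M \<rho>))"
      using f_int by (intro RR.integral_product_swap) auto
    have "sym_test \<psi> u z = f z + (case z of (x, y) \<Rightarrow> f (y, x))" for z
    proof (cases z)
      case (Pair x y)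
      have "grad_ker q (y - x) \<bullet> u = - (grad_ker q (x - y) \<bullet> u)"
        by (subst grad_ker_commute) simp
      thus ?thesis using Pair by (simp add: sym_test_def f_def algebra_simps)
    qed
    hence "(\<integral>z. sym_test \<psi> u z \<partial>(\<rho> \<Otimes>\<^sub>M \<rho>)) = (\<integral>z. f z + (case z of (x, y) \<Rightarrow> f (y, x)) \<partial>(\<rho> \<Otimes>\<^sub>M \<rho>))" by simp
    also have "\<dots> = 2 * (\<integral>x. \<psi> x * (G x \<bullet> u) \<partial>\<rho>)"
      using f_int f2 f3 f1 by (simp add: Bochner_Integration.integral_add)
    finally have eq: "(\<integral>x. \<psi> x * (G x \<bullet> u) \<partial>\<rho>) = (\<integral>x. \<psi> x * (drift x \<bullet> u) \<partial>\<rho>)" using w by simp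
    have i1: "integrable \<rho> (\<lambda>x. \<psi> x * (G x \<bullet> u))"
    proof (rule Bochner_Integration.integrable_bound[of _ "\<lambda>x. norm (G x)"])
      show "AE x in \<rho>. norm (\<psi> x * (G x \<bullet> u)) \<le> norm (norm (G x))"
      proof (rule AE_I2)
        fix x
        have "\<bar>\<psi> x\<bar> * \<bar>G x \<bullet> u\<bar> \<le> 1 * norm (G x)"
          using b Cauchy_Schwarz_ineq2[of "G x" u] u by (intro mult_mono) auto
        thus "norm (\<psi> x * (G x \<bullet> u)) \<le> norm (norm (G x))" by (simp add: abs_mult)
      qed
    qed (use G_int in auto)
    obtain D where "\<And>x. norm (\<psi> x * (drift x \<bullet> u)) \<le> D"
      using drift_test_bounded[where \<psi> = \<psi>, OF b supp u] by blast
    hence i2: "integrable \<rho> (\<lambda>x. \<psi> x * (drift x \<bullet> u))"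
      by (intro R.integrable_const_bound[of _ D] AE_I2) measurable
    have "(\<integral>x. \<psi> x * ((G x - drift x) \<bullet> u) \<partial>\<rho>) = (\<integral>x. \<psi> x * (G x \<bullet> u) - \<psi> x * (drift x \<bullet> u) \<partial>\<rho>)"
      by (simp add: inner_diff_left right_diff_distrib)
    also have "\<dots> = 0" using i1 i2 eq by simp
    finally show "(\<integral>x. \<psi> x * ((G x - drift x) \<bullet> u) \<partial>\<rho>) = 0" .
  qed
  have "AE x in \<rho>. \<forall>u\<in>Basis. (G x - drift x) \<bullet> u = 0"
    using comp by (intro AE_finite_allI) auto
  hence G_drift: "AE x in \<rho>. G x = drift x"
    by eventually_elim (simp add: euclidean_eq_iff[of "G _"] inner_diff_left)
  have fc: "force_converges q \<mu> \<rho> x \<longleftrightarrow> integrable \<rho> (\<lambda>y. grad_ker q (x - y))" for x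
    using integrable_grad_ker by (simp add: force_converges_def)
  have force_eq: "mmd_force q \<mu> \<rho> x = (if (\<integral>\<^sup>+y. ennreal (norm (grad_ker q (x - y))) \<partial>\<rho>) < \<infinity> then G x - drift x else 0)" for x
    unfolding mmd_force_def fc integral_diff_def G_def drift_def by (simp add: integrable_iff_bounded)
  have force_meas [measurable]: "mmd_force q \<mu> \<rho> \<in> borel_measurable borel"
    unfolding force_eq by measurable
  have conv: "AE x in \<rho>. force_converges q \<mu> \<rho> x" using conv_ae by (simp add: fc)
  have zero: "AE x in \<rho>. mmd_force q \<mu> \<rho> x = 0"
    using G_drift by eventually_elim (simp add: force_eq)
  have "set_integrable \<rho> C (mmd_force q \<mu> \<rho>)" if "compact C" for C
  proof -
    have [measurable]: "C \<in> sets borel" using compact_imp_closed[OF that] by simp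
    have "integrable \<rho> (\<lambda>x. indicator C x *\<^sub>R mmd_force q \<mu> \<rho> x) \<longleftrightarrow> integrable \<rho> (\<lambda>x. 0 :: 'a)"
    proof (rule integrable_cong_AE)
      show "AE x in \<rho>. indicator C x *\<^sub>R mmd_force q \<mu> \<rho> x = 0" using zero by eventually_elim simp
    qed auto
    thus ?thesis by (simp add: set_integrable_def)
  qed
  thus ?thesis using \<rho> conv zero by (auto simp: lagrangian_critical_def borel_prob_def)
qed

end


section \<open>Limits of stationary configurations\<close>

context regular_target
begin

text \<open>
  With almost surely convergent random variables of the laws in question, double integrals over the empirical
  measures become integrals over \<open>\<Omega> \<otimes> \<Omega>\<close> in which the integrands converge almost everywhere, so that
  convergence theorems apply to the force balance tested with \<open>sym_test\<close>.
\<close>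
lemma stationary_sequence_limit:
  fixes y :: "nat \<Rightarrow> nat \<Rightarrow> 'a"
  assumes N: "\<And>k. 0 < N k"
    and stat: "\<And>k i. i \<in> {1..N k} \<Longrightarrow> particle_velocity q \<mu> (N k) (y k) i = 0"
    and E: "\<And>k. particle_energy q \<mu> (N k) (y k) \<le> E0"
    and S: "\<And>k. q < 1 \<Longrightarrow> (1 / real (N k) ^ 2) * pair_sum (q - 1) (N k) (y k) \<le> S"
    and tail: "\<And>e. 0 < e \<Longrightarrow> \<exists>R. \<forall>k. measure (empirical (N k) (y k)) {x. R \<le> norm x} \<le> e"
  obtains r \<rho> where "strict_mono r" "lagrangian_critical q \<mu> \<rho>"
    "narrowly_converges (\<lambda>k. empirical (N (r k)) (y (r k))) \<rho>"
proof -
  obtain r :: "nat \<Rightarrow> nat" and \<Omega> :: "real measure" and V :: "nat \<Rightarrow> real \<Rightarrow> 'a" and W :: "real \<Rightarrow> 'a"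
    where r: "strict_mono r" and \<Omega>: "prob_space \<Omega>"
    and V_meas [measurable]: "\<And>k. V k \<in> borel_measurable \<Omega>" and W_meas [measurable]: "W \<in> borel_measurable \<Omega>"
    and law: "\<And>k. distr \<Omega> borel (V k) = empirical (N (r k)) (y (r k))"
    and lim: "AE \<omega> in \<Omega>. (\<lambda>k. V k \<omega>) \<longlonglongrightarrow> W \<omega>"
  proof (rule empirical_skorohod[of N y, OF N])
    show "\<exists>R. \<forall>k. measure (empirical (N k) (y k)) {x. R \<le> norm x} \<le> e" if "0 < e" for e
      using that by (rule tail)
  qed (rule that)
  interpret O: prob_space \<Omega> by fact
  interpret OO: pair_prob_space \<Omega> \<Omega> ..
  define \<rho> where "\<rho> = distr \<Omega> borel W"
  have \<rho>: "prob_space \<rho>" "sets \<rho> = sets borel"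
    unfolding \<rho>_def by (auto intro: O.prob_space_distr)
  note [measurable_cong] = \<rho>(2)
  define em where "em k = empirical (N (r k)) (y (r k))" for k
  have em_sets [measurable_cong]: "sets (em k) = sets borel" for k by (simp add: em_def)
  have narrow: "narrowly_converges em \<rho>"
    unfolding narrowly_converges_def
  proof (intro allI impI)
    fix \<phi> :: "'a \<Rightarrow> real" assume \<phi>: "continuous_on UNIV \<phi>" "bounded (range \<phi>)"
    obtain B where B: "\<And>x. norm (\<phi> x) \<le> B" using \<phi>(2) unfolding bounded_iff by auto
    have [measurable]: "\<phi> \<in> borel_measurable borel" using \<phi>(1) by (rule borel_measurable_continuous_onI)
    have "(\<lambda>k. \<integral>\<omega>. \<phi> (V k \<omega>) \<partial>\<Omega>) \<longlonglongrightarrow> (\<integral>\<omega>. \<phi> (W \<omega>) \<partial>\<Omega>)"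
    proof (rule integral_dominated_convergence[where w = "\<lambda>_. B"])
      show "AE \<omega> in \<Omega>. (\<lambda>k. \<phi> (V k \<omega>)) \<longlonglongrightarrow> \<phi> (W \<omega>)"
        using lim
      proof eventually_elim
        case (elim \<omega>)
        have "isCont \<phi> (W \<omega>)" using \<phi>(1) by (simp add: continuous_on_eq_continuous_at)
        thus ?case using elim by (rule isCont_tendsto_compose)
      qed
    qed (use B in auto)
    moreover have "(\<integral>\<omega>. \<phi> (V k \<omega>) \<partial>\<Omega>) = (\<integral>x. \<phi> x \<partial>em k)" for k
      unfolding em_def law[symmetric] by (rule integral_distr[symmetric]) measurable
    moreover have "(\<integral>\<omega>. \<phi> (W \<omega>) \<partial>\<Omega>) = (\<integral>x. \<phi> x \<partial>\<rho>)"
      unfolding \<rho>_def by (rule integral_distr[symmetric]) measurable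
    ultimately show "(\<lambda>k. \<integral>x. \<phi> x \<partial>em k) \<longlonglongrightarrow> (\<integral>x. \<phi> x \<partial>\<rho>)" by simp
  qed
  have pair_V: "distr (\<Omega> \<Otimes>\<^sub>M \<Omega>) (borel \<Otimes>\<^sub>M borel) (\<lambda>z. (V k (fst z), V k (snd z))) = em k \<Otimes>\<^sub>M em k" for k
    unfolding em_def law[symmetric] by (rule distr_independent_copies[OF \<Omega>]) measurable
  have pair_W: "distr (\<Omega> \<Otimes>\<^sub>M \<Omega>) (borel \<Otimes>\<^sub>M borel) (\<lambda>z. (W (fst z), W (snd z))) = \<rho> \<Otimes>\<^sub>M \<rho>"
    unfolding \<rho>_def by (rule distr_independent_copies[OF \<Omega>]) measurable
  have lim_fst: "AE z in \<Omega> \<Otimes>\<^sub>M \<Omega>. (\<lambda>k. V k (fst z)) \<longlonglongrightarrow> W (fst z)"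
  proof (rule AE_distrD[OF measurable_fst])
    show "AE z in distr (\<Omega> \<Otimes>\<^sub>M \<Omega>) \<Omega> fst. (\<lambda>k. V k z) \<longlonglongrightarrow> W z"
      unfolding O.distr_pair_fst by (rule lim)
  qed
  have lim_snd: "AE z in \<Omega> \<Otimes>\<^sub>M \<Omega>. (\<lambda>k. V k (snd z)) \<longlonglongrightarrow> W (snd z)"
  proof -
    have "AE z in distr (\<Omega> \<Otimes>\<^sub>M \<Omega>) (\<Omega> \<Otimes>\<^sub>M \<Omega>) (\<lambda>(x, y). (y, x)). (\<lambda>k. V k (fst z)) \<longlonglongrightarrow> W (fst z)"
      by (subst OO.distr_pair_swap[symmetric]) (rule lim_fst)
    from AE_distrD[OF _ this] show ?thesis by (auto simp: case_prod_unfold)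
  qed
  obtain rr C where rr: "1 < rr" and C: "0 \<le> C"
    and mom1: "\<And>N y. 0 < N \<Longrightarrow> particle_energy q \<mu> N y \<le> E0 \<Longrightarrow>
      (q < 1 \<longrightarrow> (1 / real N ^ 2) * pair_sum (q - 1) N y \<le> S) \<Longrightarrow>
      (\<integral>\<^sup>+z. ennreal (norm (fst z - snd z) powr (q - 1)) \<partial>(empirical N y \<Otimes>\<^sub>M empirical N y)) \<le> ennreal C"
    and mom2: "\<And>N y. 0 < N \<Longrightarrow> particle_energy q \<mu> N y \<le> E0 \<Longrightarrow> 1 < q \<Longrightarrow>
      (\<integral>\<^sup>+z. ennreal ((norm (fst z - snd z) powr (q - 1)) powr rr) \<partial>(empirical N y \<Otimes>\<^sub>M empirical N y)) \<le> ennreal C"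
    using kernel_pair_moments[of E0 S] by blast
  have ker: "integrable (\<rho> \<Otimes>\<^sub>M \<rho>) (\<lambda>z. norm (fst z - snd z) powr (q - 1))"
  proof -
    define g where "g z = norm (W (fst z) - W (snd z)) powr (q - 1)" for z
    \<comment> \<open>The kernel is put to zero where the limits coincide, since there it need not converge for \<open>q < 1\<close>.\<close>
    define h where "h k z = (if W (fst z) = W (snd z) then 0 else norm (V k (fst z) - V k (snd z)) powr (q - 1))" for k z
    have "(\<integral>\<^sup>+z. ennreal (g z) \<partial>(\<Omega> \<Otimes>\<^sub>M \<Omega>)) \<le> ennreal C"
    proof (rule nn_integral_limit_le[where h = h])
      show "h k \<in> borel_measurable (\<Omega> \<Otimes>\<^sub>M \<Omega>)" for k unfolding h_def by measurable
      show "AE z in \<Omega> \<Otimes>\<^sub>M \<Omega>. (\<lambda>k. h k z) \<longlonglongrightarrow> g z"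
        using lim_fst lim_snd
      proof eventually_elim
        case (elim z)
        show ?case
        proof (cases "W (fst z) = W (snd z)")
          case True
          thus ?thesis by (simp add: h_def g_def)
        next
          case False
          have "(\<lambda>k. norm (V k (fst z) - V k (snd z)) powr (q - 1)) \<longlonglongrightarrow> g z"
            unfolding g_def using elim False by (intro tendsto_intros) auto
          thus ?thesis using False by (simp add: h_def)
        qed
      qed
      fix k
      have "(\<integral>\<^sup>+z. ennreal (h k z) \<partial>(\<Omega> \<Otimes>\<^sub>M \<Omega>))
          \<le> (\<integral>\<^sup>+z. ennreal (norm (fst (V k (fst z), V k (snd z)) - snd (V k (fst z), V k (snd z))) powr (q - 1)) \<partial>(\<Omega> \<Otimes>\<^sub>M \<Omega>))"
        by (intro nn_integral_mono ennreal_leI) (auto simp: h_def)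
      also have "\<dots> = (\<integral>\<^sup>+z. ennreal (norm (fst z - snd z) powr (q - 1)) \<partial>(em k \<Otimes>\<^sub>M em k))"
        unfolding pair_V[symmetric] by (rule nn_integral_distr[symmetric]) measurable
      also have "\<dots> \<le> ennreal C" unfolding em_def using N E S by (intro mom1) auto
      finally show "(\<integral>\<^sup>+z. ennreal (h k z) \<partial>(\<Omega> \<Otimes>\<^sub>M \<Omega>)) \<le> ennreal C" .
    qed
    moreover have "(\<integral>\<^sup>+z. ennreal (norm (fst z - snd z) powr (q - 1)) \<partial>(\<rho> \<Otimes>\<^sub>M \<rho>)) = (\<integral>\<^sup>+z. ennreal (g z) \<partial>(\<Omega> \<Otimes>\<^sub>M \<Omega>))"
      unfolding pair_W[symmetric] by (subst nn_integral_distr) (auto simp: g_def)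
    ultimately show ?thesis
      unfolding integrable_iff_bounded by (auto intro: order.strict_trans1)
  qed
  have weak: "(\<integral>z. sym_test \<psi> u z \<partial>(\<rho> \<Otimes>\<^sub>M \<rho>)) = 2 * (\<integral>x. \<psi> x * (drift x \<bullet> u) \<partial>\<rho>)"
    if u: "norm u = 1" and lip: "\<And>x y. \<bar>\<psi> x - \<psi> y\<bar> \<le> L * dist x y" and b: "\<And>x. \<bar>\<psi> x\<bar> \<le> 1"
      and supp: "\<And>x. R < norm x \<Longrightarrow> \<psi> x = 0" and cont: "\<And>x. isCont \<psi> x" for \<psi> u L R
  proof -
    have [measurable]: "\<psi> \<in> borel_measurable borel"
      using cont by (intro borel_measurable_continuous_onI continuous_at_imp_continuous_on) auto
    define B where "B = q * (\<bar>L\<bar> + 2)"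
    have B: "0 \<le> B" using q by (simp add: B_def)
    define K where "K = max (B powr rr) ((2 * q) powr rr * C)"
    have bound: "(\<integral>\<^sup>+z. ennreal (norm (sym_test \<psi> u z) powr rr) \<partial>(em k \<Otimes>\<^sub>M em k)) \<le> ennreal K" for k
    proof (cases "1 < q")
      case True
      have "(\<integral>\<^sup>+z. ennreal (norm (sym_test \<psi> u z) powr rr) \<partial>(em k \<Otimes>\<^sub>M em k))
          \<le> (\<integral>\<^sup>+z. ennreal ((2 * q) powr rr) * ennreal ((norm (fst z - snd z) powr (q - 1)) powr rr) \<partial>(em k \<Otimes>\<^sub>M em k))"
      proof (intro nn_integral_mono)
        fix z
        have "norm (sym_test \<psi> u z) \<le> 2 * q * norm (fst z - snd z) powr (q - 1)"
          using sym_test_bound'[where \<psi> = \<psi> and x = "fst z" and y = "snd z", OF b u] by simp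
        hence "norm (sym_test \<psi> u z) powr rr \<le> (2 * q * norm (fst z - snd z) powr (q - 1)) powr rr"
          using rr by (intro powr_mono2) auto
        also have "\<dots> = (2 * q) powr rr * (norm (fst z - snd z) powr (q - 1)) powr rr" by (rule powr_mult)
        finally show "ennreal (norm (sym_test \<psi> u z) powr rr) \<le> ennreal ((2 * q) powr rr) * ennreal ((norm (fst z - snd z) powr (q - 1)) powr rr)"
          by (simp add: ennreal_leI flip: ennreal_mult)
      qed
      also have "\<dots> = ennreal ((2 * q) powr rr) * (\<integral>\<^sup>+z. ennreal ((norm (fst z - snd z) powr (q - 1)) powr rr) \<partial>(em k \<Otimes>\<^sub>M em k))"
        by (rule nn_integral_cmult) measurable
      also have "\<dots> \<le> ennreal ((2 * q) powr rr) * ennreal C"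
        unfolding em_def using N E True by (intro mult_left_mono mom2) auto
      also have "\<dots> = ennreal ((2 * q) powr rr * C)" using C by (simp add: ennreal_mult)
      also have "\<dots> \<le> ennreal K" by (intro ennreal_leI) (simp add: K_def)
      finally show ?thesis .
    next
      case False
      interpret ek: prob_space "em k" unfolding em_def using N by (rule prob_space_empirical)
      interpret ekk: pair_prob_space "em k" "em k" ..
      have "norm (sym_test \<psi> u z) \<le> B" for z
      proof (cases "norm (fst z - snd z) \<le> 1")
        case True
        have "norm (sym_test \<psi> u z) \<le> q * L * norm (fst z - snd z) powr q"
          using sym_test_bound[where \<psi> = \<psi> and x = "fst z" and y = "snd z", OF lip u] by simp
        also have "\<dots> \<le> (q * \<bar>L\<bar>) * norm (fst z - snd z) powr q"
          using q by (intro mult_right_mono mult_left_mono) auto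
        also have "\<dots> \<le> (q * \<bar>L\<bar>) * 1"
          using True q by (intro mult_left_mono powr_le1) auto
        also have "\<dots> \<le> B" using q by (simp add: B_def distrib_left)
        finally show ?thesis .
      next
        case large: False
        have "norm (sym_test \<psi> u z) \<le> 2 * q * norm (fst z - snd z) powr (q - 1)"
          using sym_test_bound'[where \<psi> = \<psi> and x = "fst z" and y = "snd z", OF b u] by simp
        also have "norm (fst z - snd z) powr (q - 1) \<le> 1 powr (q - 1)"
          using large False by (intro powr_mono2') auto
        finally have "norm (sym_test \<psi> u z) \<le> 2 * q" using q by simp
        also have "\<dots> \<le> B" using q by (simp add: B_def distrib_left)
        finally show ?thesis .
      qed
      hence "(\<integral>\<^sup>+z. ennreal (norm (sym_test \<psi> u z) powr rr) \<partial>(em k \<Otimes>\<^sub>M em k)) \<le> (\<integral>\<^sup>+z. ennreal (B powr rr) \<partial>(em k \<Otimes>\<^sub>M em k))"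
        using rr by (intro nn_integral_mono ennreal_leI powr_mono2) auto
      also have "\<dots> = ennreal (B powr rr)" using ekk.emeasure_space_1 by simp
      also have "\<dots> \<le> ennreal K" by (intro ennreal_leI) (simp add: K_def)
      finally show ?thesis .
    qed
    have lim_pair: "(\<lambda>k. \<integral>z. sym_test \<psi> u (V k (fst z), V k (snd z)) \<partial>(\<Omega> \<Otimes>\<^sub>M \<Omega>)) \<longlonglongrightarrow> (\<integral>z. sym_test \<psi> u (W (fst z), W (snd z)) \<partial>(\<Omega> \<Otimes>\<^sub>M \<Omega>))"
    proof (rule bounded_moment_convergence(3)[OF OO.prob_space_axioms rr, where C = K])
      show "AE z in \<Omega> \<Otimes>\<^sub>M \<Omega>. (\<lambda>k. sym_test \<psi> u (V k (fst z), V k (snd z))) \<longlonglongrightarrow> sym_test \<psi> u (W (fst z), W (snd z))"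
        using lim_fst lim_snd by eventually_elim (rule sym_test_tendsto[where \<psi> = \<psi>, OF lip cont u])
      fix k
      have "(\<integral>\<^sup>+z. ennreal (norm (sym_test \<psi> u (V k (fst z), V k (snd z))) powr rr) \<partial>(\<Omega> \<Otimes>\<^sub>M \<Omega>))
          = (\<integral>\<^sup>+z. ennreal (norm (sym_test \<psi> u z) powr rr) \<partial>(em k \<Otimes>\<^sub>M em k))"
        unfolding pair_V[symmetric] by (rule nn_integral_distr[symmetric]) measurable
      thus "(\<integral>\<^sup>+z. ennreal (norm (sym_test \<psi> u (V k (fst z), V k (snd z))) powr rr) \<partial>(\<Omega> \<Otimes>\<^sub>M \<Omega>)) \<le> ennreal K"
        using bound[of k] by simp
    qed measurable
    have balance: "(\<integral>z. sym_test \<psi> u (V k (fst z), V k (snd z)) \<partial>(\<Omega> \<Otimes>\<^sub>M \<Omega>)) = 2 * (\<integral>\<omega>. \<psi> (V k \<omega>) * (drift (V k \<omega>) \<bullet> u) \<partial>\<Omega>)" for k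
    proof -
      have "(\<integral>z. sym_test \<psi> u (V k (fst z), V k (snd z)) \<partial>(\<Omega> \<Otimes>\<^sub>M \<Omega>)) = (\<integral>z. sym_test \<psi> u z \<partial>(em k \<Otimes>\<^sub>M em k))"
        unfolding pair_V[symmetric] by (rule integral_distr[symmetric]) measurable
      also have "\<dots> = 2 * (\<integral>x. \<psi> x * (drift x \<bullet> u) \<partial>em k)"
        unfolding em_def by (rule sym_test_stationary[OF N stat]) auto
      also have "(\<integral>x. \<psi> x * (drift x \<bullet> u) \<partial>em k) = (\<integral>\<omega>. \<psi> (V k \<omega>) * (drift (V k \<omega>) \<bullet> u) \<partial>\<Omega>)"
        unfolding em_def law[symmetric] by (rule integral_distr) measurable
      finally show ?thesis .
    qed
    have lim_single: "(\<lambda>k. 2 * (\<integral>\<omega>. \<psi> (V k \<omega>) * (drift (V k \<omega>) \<bullet> u) \<partial>\<Omega>)) \<longlonglongrightarrow> 2 * (\<integral>\<omega>. \<psi> (W \<omega>) * (drift (W \<omega>) \<bullet> u) \<partial>\<Omega>)"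
    proof (intro tendsto_mult_left)
      obtain D where D: "\<And>x. norm (\<psi> x * (drift x \<bullet> u)) \<le> D"
        using drift_test_bounded[where \<psi> = \<psi>, OF b supp u] by blast
      show "(\<lambda>k. \<integral>\<omega>. \<psi> (V k \<omega>) * (drift (V k \<omega>) \<bullet> u) \<partial>\<Omega>) \<longlonglongrightarrow> (\<integral>\<omega>. \<psi> (W \<omega>) * (drift (W \<omega>) \<bullet> u) \<partial>\<Omega>)"
      proof (rule integral_dominated_convergence[where w = "\<lambda>_. D"])
        show "AE \<omega> in \<Omega>. (\<lambda>k. \<psi> (V k \<omega>) * (drift (V k \<omega>) \<bullet> u)) \<longlonglongrightarrow> \<psi> (W \<omega>) * (drift (W \<omega>) \<bullet> u)"
          using lim
          by eventually_elim (intro tendsto_intros isCont_tendsto_compose[OF cont] isCont_tendsto_compose[OF continuous_drift])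
        show "AE \<omega> in \<Omega>. norm (\<psi> (V k \<omega>) * (drift (V k \<omega>) \<bullet> u)) \<le> D" for k
          using D by (intro AE_I2)
        show "(\<lambda>\<omega>. \<psi> (V k \<omega>) * (drift (V k \<omega>) \<bullet> u)) \<in> borel_measurable \<Omega>" for k by measurable
        show "(\<lambda>\<omega>. \<psi> (W \<omega>) * (drift (W \<omega>) \<bullet> u)) \<in> borel_measurable \<Omega>" by measurable
      qed simp
    qed
    have "(\<integral>z. sym_test \<psi> u (W (fst z), W (snd z)) \<partial>(\<Omega> \<Otimes>\<^sub>M \<Omega>)) = 2 * (\<integral>\<omega>. \<psi> (W \<omega>) * (drift (W \<omega>) \<bullet> u) \<partial>\<Omega>)"
      by (rule LIMSEQ_unique[OF lim_pair[unfolded balance] lim_single])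
    moreover have "(\<integral>z. sym_test \<psi> u z \<partial>(\<rho> \<Otimes>\<^sub>M \<rho>)) = (\<integral>z. sym_test \<psi> u (W (fst z), W (snd z)) \<partial>(\<Omega> \<Otimes>\<^sub>M \<Omega>))"
      unfolding pair_W[symmetric] by (rule integral_distr) measurable
    moreover have "(\<integral>x. \<psi> x * (drift x \<bullet> u) \<partial>\<rho>) = (\<integral>\<omega>. \<psi> (W \<omega>) * (drift (W \<omega>) \<bullet> u) \<partial>\<Omega>)"
      unfolding \<rho>_def by (rule integral_distr) measurable
    ultimately show ?thesis by simp
  qed
  have "lagrangian_critical q \<mu> \<rho>"
    by (rule lagrangian_critical_of_weak[OF \<rho> ker]) (rule weak)
  with that[OF r _ narrow[unfolded em_def]] show ?thesis by blast
qed

lemma empirical_tails_vanish: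
  assumes N: "\<And>k. 0 < N k" and E: "\<And>k. particle_energy q \<mu> (N k) (y k) \<le> E0" and e: "0 < e"
  shows "\<exists>R. \<forall>k. measure (empirical (N k) (y k)) {x. R \<le> norm x} \<le> e"
proof -
  define K where "K = 2 * (2 * (\<integral>v. norm v powr q \<partial>\<mu>) + max E0 0 + 1)"
  have "0 \<le> (\<integral>v. norm v powr q \<partial>\<mu>)" by simp
  hence K: "0 < K" unfolding K_def by (simp only: zero_less_mult_iff) linarith
  define R where "R = max 1 ((K / e) powr (2 / q))"
  have "K * R powr (- q / 2) \<le> e"
  proof -
    have "R powr (- q / 2) \<le> ((K / e) powr (2 / q)) powr (- q / 2)"
      using K e q by (intro powr_mono2') (auto simp: R_def)
    also have "\<dots> = e / K" using K e q by (simp add: powr_powr powr_minus)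
    finally show ?thesis using K by (simp add: field_simps)
  qed
  moreover have "measure (empirical (N k) (y k)) {x. 2 powr (1 / (2 - q)) * R \<le> norm x} \<le> K * R powr (- q / 2)" for k
    unfolding K_def using E[of k] by (intro empirical_tail_bound N) (auto simp: R_def)
  ultimately show ?thesis by (intro exI[of _ "2 powr (1 / (2 - q)) * R"]) (meson order_trans)
qed

end

lemma narrowly_converges_perturb:
  fixes x y :: "nat \<Rightarrow> nat \<Rightarrow> 'a::euclidean_space"
  assumes conv: "narrowly_converges (\<lambda>k. empirical (n k) (y k)) \<rho>"
    and n: "\<And>k. 0 < n k"
    and tail: "\<And>e. 0 < e \<Longrightarrow> \<exists>R. \<forall>k. measure (empirical (n k) (y k)) {x. R \<le> norm x} \<le> e"
    and close: "\<And>k i. i \<in> {1..n k} \<Longrightarrow> dist (x k i) (y k i) < 1 / real (Suc k)"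
  shows "narrowly_converges (\<lambda>k. empirical (n k) (x k)) \<rho>"
  unfolding narrowly_converges_def
proof (intro allI impI)
  fix \<phi> :: "'a \<Rightarrow> real" assume \<phi>: "continuous_on UNIV \<phi>" "bounded (range \<phi>)"
  obtain B0 where B0: "\<And>x. norm (\<phi> x) \<le> B0" using \<phi>(2) unfolding bounded_iff by auto
  define B where "B = max B0 0"
  have B: "\<bar>\<phi> x\<bar> \<le> B" "0 \<le> B" for x using B0[of x] by (auto simp: B_def)
  have \<phi>_meas: "\<phi> \<in> borel_measurable borel" using \<phi>(1) by (rule borel_measurable_continuous_onI)
  have "(\<lambda>k. (\<integral>v. \<phi> v \<partial>empirical (n k) (x k)) - (\<integral>v. \<phi> v \<partial>empirical (n k) (y k))) \<longlonglongrightarrow> 0"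
  proof (rule LIMSEQ_I)
    fix e :: real assume e: "0 < e"
    define c where "c = 1 + 2 * B"
    have c: "0 < c" using B(2) by (simp add: c_def)
    define e' where "e' = e / 2 / c"
    have e': "0 < e'" using e c by (simp add: e'_def)
    obtain R where R: "\<And>k. measure (empirical (n k) (y k)) {x. R \<le> norm x} \<le> e'" using tail[OF e'] by blast
    have "continuous_on (cball 0 (R + 1)) \<phi>" using \<phi>(1) by (rule continuous_on_subset) simp
    hence uc: "uniformly_continuous_on (cball 0 (R + 1)) \<phi>"
      by (rule compact_uniformly_continuous) simp
    have "\<exists>d>0. \<forall>u\<in>cball 0 (R + 1). \<forall>v\<in>cball 0 (R + 1). dist v u < d \<longrightarrow> dist (\<phi> v) (\<phi> u) < e'"
      by (rule mp[OF spec[OF uc[unfolded uniformly_continuous_on_def], of e'] e'])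
    then obtain d where "0 < d" "\<forall>u\<in>cball 0 (R + 1). \<forall>v\<in>cball 0 (R + 1). dist v u < d \<longrightarrow> dist (\<phi> v) (\<phi> u) < e'"
      by (elim exE conjE)
    hence d: "0 < d" "\<And>u v. u \<in> cball 0 (R + 1) \<Longrightarrow> v \<in> cball 0 (R + 1) \<Longrightarrow> dist v u < d \<Longrightarrow> dist (\<phi> v) (\<phi> u) < e'"
      by auto
    obtain k0 where k0: "1 / real (Suc k0) < d" using reals_Archimedean[OF d(1)] by (auto simp: inverse_eq_divide)
    have "norm ((\<integral>v. \<phi> v \<partial>empirical (n k) (x k)) - (\<integral>v. \<phi> v \<partial>empirical (n k) (y k)) - 0) < e" if k: "k \<ge> k0" for k
    proof -
      define A where "A = {x :: 'a. R \<le> norm x}"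
      have A: "A \<in> sets borel" unfolding A_def by measurable
      have "1 / real (Suc k) \<le> 1 / real (Suc k0)" using k by (intro divide_left_mono) auto
      hence kd: "1 / real (Suc k) < d" "1 / real (Suc k) \<le> 1" using k0 by auto
      have pt: "\<bar>\<phi> (x k i) - \<phi> (y k i)\<bar> \<le> e' + 2 * B * indicator A (y k i)" if i: "i \<in> {1..n k}" for i
      proof (cases "y k i \<in> A")
        case True
        thus ?thesis using B(1)[of "x k i"] B(1)[of "y k i"] e' by (simp add: abs_le_iff)
      next
        case False
        have xy: "dist (x k i) (y k i) < d" "norm (x k i - y k i) \<le> 1"
          using close[OF i] kd unfolding dist_norm by linarith+
        have "norm (x k i) \<le> R + 1" using False xy(2) norm_triangle_sub[of "x k i" "y k i"] by (simp add: A_def)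
        hence "dist (\<phi> (x k i)) (\<phi> (y k i)) < e'" using False xy by (intro d(2)) (auto simp: A_def)
        thus ?thesis using False by (simp add: dist_real_def)
      qed
      have "(\<integral>v. \<phi> v \<partial>empirical (n k) (x k)) - (\<integral>v. \<phi> v \<partial>empirical (n k) (y k)) = (1 / real (n k)) * (\<Sum>i\<in>{1..n k}. \<phi> (x k i) - \<phi> (y k i))"
        unfolding integral_empirical[OF \<phi>_meas] by (simp add: sum_subtractf right_diff_distrib)
      hence "\<bar>(\<integral>v. \<phi> v \<partial>empirical (n k) (x k)) - (\<integral>v. \<phi> v \<partial>empirical (n k) (y k))\<bar> = (1 / real (n k)) * \<bar>\<Sum>i\<in>{1..n k}. \<phi> (x k i) - \<phi> (y k i)\<bar>"
        by (simp add: abs_mult)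
      also have "\<dots> \<le> (1 / real (n k)) * (\<Sum>i\<in>{1..n k}. e' + 2 * B * indicator A (y k i))"
        by (intro mult_left_mono order_trans[OF sum_abs sum_mono] pt) auto
      also have "\<dots> = e' + 2 * B * ((1 / real (n k)) * (\<Sum>i\<in>{1..n k}. indicator A (y k i)))"
      proof -
        have "(\<Sum>i\<in>{1..n k}. e' + 2 * B * indicator A (y k i)) = real (n k) * e' + 2 * B * (\<Sum>i\<in>{1..n k}. indicator A (y k i))"
          unfolding sum.distrib sum_distrib_left[symmetric] by simp
        thus ?thesis using n[of k] by (simp add: field_simps)
      qed
      also have "(1 / real (n k)) * (\<Sum>i\<in>{1..n k}. indicator A (y k i)) = measure (empirical (n k) (y k)) A"
        by (rule measure_empirical[OF n A, symmetric])
      also have "e' + 2 * B * measure (empirical (n k) (y k)) A \<le> e' + 2 * B * e'"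
        using R[of k] B(2) unfolding A_def by (intro add_left_mono mult_left_mono) auto
      also have "\<dots> = c * e'" by (simp add: c_def algebra_simps)
      also have "\<dots> = e / 2" using c by (simp add: e'_def)
      finally show ?thesis using e by simp
    qed
    thus "\<exists>k0. \<forall>k\<ge>k0. norm ((\<integral>v. \<phi> v \<partial>empirical (n k) (x k)) - (\<integral>v. \<phi> v \<partial>empirical (n k) (y k)) - 0) < e" by blast
  qed
  moreover have "(\<lambda>k. \<integral>v. \<phi> v \<partial>empirical (n k) (y k)) \<longlonglongrightarrow> (\<integral>v. \<phi> v \<partial>\<rho>)"
    using conv \<phi> by (auto simp: narrowly_converges_def)
  ultimately show "(\<lambda>k. \<integral>v. \<phi> v \<partial>empirical (n k) (x k)) \<longlonglongrightarrow> (\<integral>v. \<phi> v \<partial>\<rho>)"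
    using tendsto_add by fastforce
qed

text \<open>
  The diagonal terms on the right are \<open>0 powr (q - 1) = 0\<close>.
\<close>
lemma singular_interaction_eq:
  assumes y: "y \<in> collision_free N" and N: "0 < N"
  shows "singular_interaction q N y
    = ennreal ((1 / real N ^ 2) * pair_sum (q - 1) N y)"
proof -
  define P where "P = {(i, j) \<in> {1..N} \<times> {1..N}. i \<noteq> j}"
  have P: "P \<subseteq> {1..N} \<times> {1..N}" by (auto simp: P_def)
  have "(\<Sum>(i, j)\<in>P. 1 / ennreal (norm (y i - y j) powr (1 - q))) = (\<Sum>(i, j)\<in>P. ennreal (norm (y i - y j) powr (q - 1)))"
  proof (intro sum.cong refl, clarify)
    fix i j assume "(i, j) \<in> P"
    hence "norm (y i - y j) > 0" using y by (auto simp: P_def collision_free_def)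
    hence "1 / ennreal (norm (y i - y j) powr (1 - q)) = ennreal (1 / norm (y i - y j) powr (1 - q))"
      by (simp add: divide_ennreal flip: ennreal_1)
    also have "1 / norm (y i - y j) powr (1 - q) = norm (y i - y j) powr (q - 1)"
      using powr_minus_divide[of "norm (y i - y j)" "1 - q"] by simp
    finally show "1 / ennreal (norm (y i - y j) powr (1 - q)) = ennreal (norm (y i - y j) powr (q - 1))" .
  qed
  also have "\<dots> = ennreal (\<Sum>(i, j)\<in>P. norm (y i - y j) powr (q - 1))"
    unfolding case_prod_unfold by (rule sum_ennreal) simp
  also have "(\<Sum>(i, j)\<in>P. norm (y i - y j) powr (q - 1)) = (\<Sum>(i, j)\<in>{1..N} \<times> {1..N}. norm (y i - y j) powr (q - 1))"
    using P by (intro sum.mono_neutral_left) (auto simp: P_def)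
  also have "\<dots> = pair_sum (q - 1) N y"
    unfolding pair_sum_def by (rule sum.cartesian_product[symmetric])
  finally have s: "(\<Sum>(i, j)\<in>P. 1 / ennreal (norm (y i - y j) powr (1 - q))) = ennreal (pair_sum (q - 1) N y)" .
  have "(1 :: ennreal) / of_nat (N ^ 2) = ennreal (1 / real N ^ 2)"
    using N by (simp add: divide_ennreal ennreal_of_nat_eq_real_of_nat flip: ennreal_1)
  thus ?thesis
    unfolding singular_interaction_def P_def[symmetric] s by (simp add: pair_sum_def sum_nonneg flip: ennreal_mult)
qed

theorem corollary4p7:
  fixes q :: real and p :: ereal
    and \<mu> :: "'a::euclidean_space measure"
    and X0 :: "nat \<Rightarrow> nat \<Rightarrow> 'a"
    and X :: "nat \<Rightarrow> real \<Rightarrow> nat \<Rightarrow> 'a"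
    and Y :: "nat \<Rightarrow> nat \<Rightarrow> 'a"
  assumes "0 < q" and "q < 2"
    and "(real DIM('a) + q - 2 > 0 \<and> ereal (real DIM('a) / (real DIM('a) + q - 2)) < p)
       \<or> (DIM('a) = 1 \<and> q = 1 \<and> p = \<infinity>)
       \<or> (DIM('a) = 1 \<and> q < 1 \<and> ereal (1 / q) < p)"
    and "\<mu> \<in> prob_moment (max 1 q) \<inter> Lp_density_measures p"
    and "\<And>N. N \<ge> 2 \<Longrightarrow> X0 N \<in> collision_free N"
    and "\<And>N. N \<ge> 2 \<Longrightarrow> global_solution q \<mu> N (X0 N) (X N)"
    and "\<And>N. N \<ge> 2 \<Longrightarrow> Y N \<in> omega_limit N (X N)"
  shows "(bdd_above ((\<lambda>N. particle_energy q \<mu> N (Y N)) ` {2..}) \<longrightarrow>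
          (q < 1 \<longrightarrow> (SUP N\<in>{2..}. singular_interaction q N (Y N)) < \<infinity>) \<longrightarrow>
          (\<exists>n t \<rho>. strict_mono n \<and> (\<forall>k. 2 \<le> n k) \<and>
             (\<forall>k. 0 \<le> t k) \<and> filterlim t at_top sequentially \<and>
             lagrangian_critical q \<mu> \<rho> \<and>
             narrowly_converges (\<lambda>k. empirical (n k) (X (n k) (t k))) \<rho>))
       \<and> (bdd_above ((\<lambda>N. particle_energy q \<mu> N (X0 N)) ` {2..})
            \<or> (\<exists>C. compact C \<and> emeasure \<mu> (- C) = 0) \<longrightarrow>
          bdd_above ((\<lambda>N. particle_energy q \<mu> N (Y N)) ` {2..}))"
proof -
  interpret regular_target \<mu> q
    using assms(1-4) by (rule regular_target_Lp_density)
  have flow: "particle_flow \<mu> q N (X0 N) (X N)" if "2 \<le> N" for N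
    using assms(6)[OF that] that by unfold_locales
  note cf = particle_flow.omega_limit_collision_free[OF flow assms(7)]
  note stat = particle_flow.omega_limit_stationary[OF flow assms(7)]
  show ?thesis
  proof (intro conjI impI)
    assume "bdd_above ((\<lambda>N. particle_energy q \<mu> N (Y N)) ` {2..})"
    then obtain E0 where E0: "\<And>N. 2 \<le> N \<Longrightarrow> particle_energy q \<mu> N (Y N) \<le> E0"
      by (auto simp: bdd_above_def)
    assume sing: "q < 1 \<longrightarrow> (SUP N\<in>{2..}. singular_interaction q N (Y N)) < \<infinity>"
    define S where "S = enn2real (SUP N\<in>{2..}. singular_interaction q N (Y N))"
    have S: "(1 / real N ^ 2) * pair_sum (q - 1) N (Y N) \<le> S"
      if "q < 1" "2 \<le> N" for N
    proof -
      have "singular_interaction q N (Y N) \<le> (SUP N\<in>{2..}. singular_interaction q N (Y N))"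
        using that by (intro SUP_upper) auto
      also have "\<dots> = ennreal S" using sing that by (simp add: S_def less_top)
      finally show ?thesis
        using singular_interaction_eq[OF cf[OF that(2) that(2)], of q] that
        by (simp add: S_def ennreal_le_iff)
    qed
    have tails: "\<exists>R. \<forall>k. measure (empirical (k + 2) (Y (k + 2))) {x. R \<le> norm x} \<le> e" if "0 < e" for e
      by (rule empirical_tails_vanish[of "\<lambda>k. k + 2" "\<lambda>k. Y (k + 2)" E0]) (use E0 that in auto)
    obtain r \<rho> where r: "strict_mono r" and \<rho>: "lagrangian_critical q \<mu> \<rho>"
      and conv: "narrowly_converges (\<lambda>k. empirical (r k + 2) (Y (r k + 2))) \<rho>"
    proof (rule stationary_sequence_limit[of "\<lambda>k. k + 2" "\<lambda>k. Y (k + 2)" E0 S])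
      show "particle_velocity q \<mu> (k + 2) (Y (k + 2)) i = 0" if "i \<in> {1..k + 2}" for k i
        using that by (intro stat) auto
      show "1 / real (k + 2) ^ 2 * pair_sum (q - 1) (k + 2) (Y (k + 2)) \<le> S"
        if "q < 1" for k
        using that by (rule S) simp
      show "particle_energy q \<mu> (k + 2) (Y (k + 2)) \<le> E0" for k by (rule E0) simp
      show "\<exists>R. \<forall>k. measure (empirical (k + 2) (Y (k + 2))) {x. R \<le> norm x} \<le> e" if "0 < e" for e
        using that by (rule tails)
    qed (simp, rule that)
    define n where "n k = r k + 2" for k
    have "\<exists>t. real k \<le> t \<and> 0 \<le> t \<and> (\<forall>i\<in>{1..n k}. dist (X (n k) t i) (Y (n k) i) < 1 / real (Suc k))" for k
    proof -
      interpret particle_flow \<mu> q "n k" "X0 (n k)" "X (n k)" by (rule flow) (simp add: n_def)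
      have "Y (n k) \<in> omega_limit (n k) (X (n k))" by (rule assms(7)) (simp add: n_def)
      from omega_limit_trapping[OF this, of "1 / real (Suc k)" 0 "real k"]
      obtain s where "real k \<le> s" "0 \<le> s" "\<And>t i. s \<le> t \<Longrightarrow> t \<le> s + 0 \<Longrightarrow> i \<in> {1..n k} \<Longrightarrow> dist (X (n k) t i) (Y (n k) i) < 1 / real (Suc k)"
        by (auto simp del: of_nat_Suc)
      thus ?thesis by (intro exI[of _ s]) auto
    qed
    then obtain t where t: "\<And>k. real k \<le> t k" "\<And>k. 0 \<le> t k"
      "\<And>k i. i \<in> {1..n k} \<Longrightarrow> dist (X (n k) (t k) i) (Y (n k) i) < 1 / real (Suc k)" by metis
    have "narrowly_converges (\<lambda>k. empirical (n k) (X (n k) (t k))) \<rho>"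
    proof (rule narrowly_converges_perturb)
      show "narrowly_converges (\<lambda>k. empirical (n k) (Y (n k))) \<rho>" using conv by (simp add: n_def)
      show "\<exists>R. \<forall>k. measure (empirical (n k) (Y (n k))) {x. R \<le> norm x} \<le> e" if "0 < e" for e
        using tails[OF that] unfolding n_def by blast
    qed (use t in \<open>auto simp: n_def\<close>)
    moreover have "filterlim t at_top sequentially"
      by (rule filterlim_at_top_mono[OF filterlim_real_sequentially]) (use t(1) in simp)
    moreover have "strict_mono n" using r by (simp add: n_def strict_mono_def)
    ultimately show "\<exists>n t \<rho>. strict_mono n \<and> (\<forall>k. 2 \<le> n k) \<and> (\<forall>k. 0 \<le> t k) \<and> filterlim t at_top sequentially \<and>
        lagrangian_critical q \<mu> \<rho> \<and> narrowly_converges (\<lambda>k. empirical (n k) (X (n k) (t k))) \<rho>"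
      using \<rho> t(2) by (intro exI[of _ n] exI[of _ t] exI[of _ \<rho>]) (auto simp: n_def)
  next
    assume "bdd_above ((\<lambda>N. particle_energy q \<mu> N (X0 N)) ` {2..}) \<or> (\<exists>C. compact C \<and> emeasure \<mu> (- C) = 0)"
    thus "bdd_above ((\<lambda>N. particle_energy q \<mu> N (Y N)) ` {2..})"
    proof (elim disjE exE conjE)
      assume "bdd_above ((\<lambda>N. particle_energy q \<mu> N (X0 N)) ` {2..})"
      then obtain B where B: "\<And>N. 2 \<le> N \<Longrightarrow> particle_energy q \<mu> N (X0 N) \<le> B"
        by (auto simp: bdd_above_def)
      have "particle_energy q \<mu> N (Y N) \<le> B" if "2 \<le> N" for N
        using particle_flow.omega_limit_energy_le[OF flow[OF that] assms(7)[OF that]] B[OF that] by linarith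
      thus ?thesis by (intro bdd_aboveI[of _ B]) auto
    next
      fix C assume C: "compact C" "emeasure \<mu> (- C) = 0"
      obtain R where R: "\<And>x. x \<in> C \<Longrightarrow> norm x \<le> R" using compact_imp_bounded[OF C(1)] unfolding bounded_iff by blast
      have "AE v in \<mu>. norm v \<le> R"
        using C R compact_imp_closed[OF C(1)] by (intro AE_I[of _ _ "- C"]) (auto simp: sets_target)
      then obtain B where B: "\<And>N Y. 0 < N \<Longrightarrow> (\<And>i. i \<in> {1..N} \<Longrightarrow> particle_velocity q \<mu> N Y i = 0)
        \<Longrightarrow> particle_energy q \<mu> N Y \<le> B"
        using stationary_energy_bounded by blast
      have "particle_energy q \<mu> N (Y N) \<le> B" if "2 \<le> N" for N
        using that stat[OF that that] by (intro B) auto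
      thus ?thesis by (intro bdd_aboveI[of _ B]) auto
    qed
  qed
qed

end
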